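(* Consider the one-parameter exponential family in which, conditionally on $\mathbf x_i$, the independent responses $Y_i$ ($i=1,\dots,n$) satisfy $$\log f_{Y_i}(y_i\mid\mathbf x_i;\theta_i)=\theta_iT(y_i)-d(\theta_i)+b(y_i),\qquad \theta_i=g(\beta_0+\mathbf x_i^{\rm T}\boldsymbol\beta).$$ Let $l_n(\boldsymbol\theta;\mathcal D)$ denote the average negative log-likelihood, optimized by $\hat\beta_0=g^{-1}(\hat\theta^{\rm MLE})$ when $\boldsymbol\beta=\mathbf 0$. Assume that $\hat\beta_0$ is consistent, that $\beta_0$ does not depend on $n$, that $d\in C^3$, and that $T(Y)$ has finite fourth moment. Assume further: (1) the vectors $\mathbf x_1,\dots,\mathbf x_n\in\mathbb R^p$ (the rows of $X$) are fixed, uniformly bounded, $|x_{ij}|\le B_n$, and standardized so that $\sum_{i=1}^n\mathbf x_i=\mathbf 0$ and $\sum_{i=1}^n x_{ij}^2=n$ for $j=1,\dots,p$; (2) the number of variables $p=p_n$ is allowed to tend to infinity in such a way that $B_n^4(\log(pn))^7=O(n^{1-c})$ for some $c>0$. Then PIC is asymptotically pivotal (as $n\to\infty$) for $$(\phi,g)=(\mathrm{id},\tilde d^{-1})\qquad\text{with}\qquad \tilde d(\theta)=\int^\theta\sqrt{d''(s)}\,\mathrm ds .$$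
   Context: $\mathcal D=(X,\mathbf y)$, $X=X^{(n)}\in\mathbb R^{n\times p_n}$, $\mathbf y$ a realization of $(Y_1,\dots,Y_n)$. $\hat\theta^{\rm MLE}$ is the maximum likelihood estimator of the common canonical parameter $\theta$ when $\theta_1=\dots=\theta_n=\theta$ (i.e. $\boldsymbol\beta=\mathbf 0$). The indefinite integral $\tilde d$ is any fixed antiderivative of $\sqrt{d''}$. PIC (pivotal information criterion): $\phi\left(l_n(\boldsymbol\theta;\mathcal D)\right)+\lambda\,C(\boldsymbol\beta)$ with $\boldsymbol\theta=g(\beta_0\mathbf 1+X\boldsymbol\beta)$ ($g$ componentwise), where $C(\boldsymbol\beta)=\sum_{i=1}^p\rho(\beta_i)$ with $\rho:\mathbb R\to[0,\infty)$ even, nondecreasing on $\mathbb R^+$, and $\lim_{\epsilon\to0^+}C(\epsilon\boldsymbol\beta)/\epsilon=\|\boldsymbol\beta\|_1$. The zero-thresholding function of the composite loss $L(\boldsymbol\beta,\beta_0;\mathcal D)=\phi(l_n(g(\beta_0\mathbf 1+X\boldsymbol\beta);\mathcal D))$ is $\lambda_0(\phi\circ l_n\circ g,\mathcal D)=\|\nabla_{\boldsymbol\beta}L(\mathbf 0,\hat\beta_0;\mathcal D)\|_\infty$. For $\mathbf Y_0$ generated from the model with $\boldsymbol\beta=\mathbf 0$ and intercept $\beta_0$, put $\Lambda_n=\lambda_0(\phi\circ l_n\circ g,(X,\mathbf Y_0))$. Asymptotically pivotal: the asymptotic distribution of $\Lambda_n$ does not depend on the nuisance parameter $\beta_0$,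 i.e. there are distribution functions $G_n$ not depending on $\beta_0$ (they may depend on $X^{(n)}$) such that, for every $\beta_0$, $\sup_{t\in\mathbb R}|\mathbb P_{\beta_0}(\Lambda_n\le t)-G_n(t)|\to0$ as $n\to\infty$. *)

theory Defs
  imports "HOL-Probability.Probability" "HOL-Library.Landau_Symbols"
begin

text \<open>
  A sample of size \<open>n\<close> is a function on the index set \<open>{..<n}\<close>, and a vector with
  \<open>p\<close> entries is a function \<open>nat \<Rightarrow> real\<close> of which only the entries \<open>j < p\<close> are used;
  all indices start at 0.  The design matrix for sample size \<open>n\<close> is \<open>x i j\<close>, with
  observations \<open>i < n\<close> and covariates \<open>j < p\<close>.
\<close>

definition expfam_density ::
  "(real \<Rightarrow> real) \<Rightarrow> (real \<Rightarrow> real) \<Rightarrow> (real \<Rightarrow> real) \<Rightarrow> real \<Rightarrow> real \<Rightarrow> real" where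
  "expfam_density T d b \<theta> y = exp (\<theta> * T y - d \<theta> + b y)"

text \<open>
  Densities are taken with respect to a dominating measure \<open>\<nu>\<close> on the real line, so that
  discrete and continuous responses are both covered.  Since \<open>b\<close> is finite, \<open>\<nu>\<close> is to be
  thought of as restricted to the common support of the family.
\<close>

definition exponential_family ::
  "real measure \<Rightarrow> real set \<Rightarrow> (real \<Rightarrow> real) \<Rightarrow> (real \<Rightarrow> real) \<Rightarrow> (real \<Rightarrow> real) \<Rightarrow> bool" where
  "exponential_family \<nu> \<Theta> T d b \<longleftrightarrow>
     open \<Theta> \<and> is_interval \<Theta> \<and>
     sets \<nu> = sets borel \<and> T \<in> borel_measurable borel \<and> b \<in> borel_measurable borel \<and>
     (\<forall>\<theta>\<in>\<Theta>. prob_space (density \<nu> (expfam_density T d b \<theta>)))"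

definition C_k_on :: "nat \<Rightarrow> (real \<Rightarrow> real) \<Rightarrow> real set \<Rightarrow> bool" where
  "C_k_on k f S \<longleftrightarrow>
     (\<forall>m<k. \<forall>s\<in>S. (deriv ^^ m) f differentiable (at s)) \<and> continuous_on S ((deriv ^^ k) f)"

definition lin_pred :: "nat \<Rightarrow> (nat \<Rightarrow> nat \<Rightarrow> real) \<Rightarrow> real \<Rightarrow> (nat \<Rightarrow> real) \<Rightarrow> nat \<Rightarrow> real" where
  "lin_pred p x \<beta>\<^sub>0 \<beta> i = \<beta>\<^sub>0 + (\<Sum>j<p. x i j * \<beta> j)"

text \<open>Joint law of the independent responses.\<close>

definition glm_law ::
  "real measure \<Rightarrow> (real \<Rightarrow> real) \<Rightarrow> (real \<Rightarrow> real) \<Rightarrow> (real \<Rightarrow> real) \<Rightarrow> (real \<Rightarrow> real) \<Rightarrow>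
   nat \<Rightarrow> nat \<Rightarrow> (nat \<Rightarrow> nat \<Rightarrow> real) \<Rightarrow> real \<Rightarrow> (nat \<Rightarrow> real) \<Rightarrow> (nat \<Rightarrow> real) measure" where
  "glm_law \<nu> T d b g n p x \<beta>\<^sub>0 \<beta> =
     PiM {..<n} (\<lambda>i. density \<nu> (expfam_density T d b (g (lin_pred p x \<beta>\<^sub>0 \<beta> i))))"

definition avg_nll ::
  "(real \<Rightarrow> real) \<Rightarrow> (real \<Rightarrow> real) \<Rightarrow> (real \<Rightarrow> real) \<Rightarrow> nat \<Rightarrow> (nat \<Rightarrow> real) \<Rightarrow> (nat \<Rightarrow> real) \<Rightarrow> real" where
  "avg_nll T d b n \<theta> y = - (\<Sum>i<n. ln (expfam_density T d b (\<theta> i) (y i))) / real n"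

text \<open>
  A measurable choice of the maximum likelihood estimator of a common canonical parameter.
  For some samples no maximizer need exist (e.g. identical Bernoulli responses); there the
  estimator may take any value in \<open>\<Theta>\<close>.
\<close>

definition common_mle ::
  "real measure \<Rightarrow> real set \<Rightarrow> (real \<Rightarrow> real) \<Rightarrow> (real \<Rightarrow> real) \<Rightarrow> (real \<Rightarrow> real) \<Rightarrow>
   nat \<Rightarrow> ((nat \<Rightarrow> real) \<Rightarrow> real) \<Rightarrow> bool" where
  "common_mle \<nu> \<Theta> T d b n est \<longleftrightarrow>
     est \<in> borel_measurable (PiM {..<n} (\<lambda>_. \<nu>)) \<and>
     (\<forall>y\<in>space (PiM {..<n} (\<lambda>_. \<nu>)).
        est y \<in> \<Theta> \<and>
        ((\<exists>\<theta>. is_arg_min (\<lambda>\<theta>. avg_nll T d b n (\<lambda>_. \<theta>) y) (\<lambda>\<theta>. \<theta> \<in> \<Theta>) \<theta>) \<longrightarrow>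
         is_arg_min (\<lambda>\<theta>. avg_nll T d b n (\<lambda>_. \<theta>) y) (\<lambda>\<theta>. \<theta> \<in> \<Theta>) (est y)))"

text \<open>
  \<open>P \<beta>\<^sub>0 n\<close> is the law of the sample of size \<open>n\<close> under the parameter \<open>\<beta>\<^sub>0\<close>, and \<open>E\<close> is the
  set of admissible parameters.
\<close>

definition consistent ::
  "real set \<Rightarrow> (real \<Rightarrow> nat \<Rightarrow> 'a measure) \<Rightarrow> (nat \<Rightarrow> 'a \<Rightarrow> real) \<Rightarrow> bool" where
  "consistent E P est \<longleftrightarrow>
     (\<forall>\<beta>\<^sub>0\<in>E. \<forall>\<epsilon>>0.
        (\<lambda>n. measure (P \<beta>\<^sub>0 n) {y \<in> space (P \<beta>\<^sub>0 n). \<bar>est n y - \<beta>\<^sub>0\<bar> > \<epsilon>}) \<longlonglongrightarrow> 0)"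

definition asymptotically_pivotal ::
  "real set \<Rightarrow> (real \<Rightarrow> nat \<Rightarrow> 'a measure) \<Rightarrow> (nat \<Rightarrow> 'a \<Rightarrow> real) \<Rightarrow> bool" where
  "asymptotically_pivotal E P \<Lambda> \<longleftrightarrow>
     (\<exists>\<mu> :: nat \<Rightarrow> real measure.
        (\<forall>n. real_distribution (\<mu> n)) \<and>
        (\<forall>\<beta>\<^sub>0\<in>E.
          (\<lambda>n. SUP t. \<bar>measure (P \<beta>\<^sub>0 n) {y \<in> space (P \<beta>\<^sub>0 n). \<Lambda> n y \<le> t} - cdf (\<mu> n) t\<bar>)
            \<longlonglongrightarrow> 0))"

definition composite_loss ::
  "(real \<Rightarrow> real) \<Rightarrow> ((nat \<Rightarrow> real) \<Rightarrow> 'a \<Rightarrow> real) \<Rightarrow> (real \<Rightarrow> real) \<Rightarrow>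
   nat \<Rightarrow> (nat \<Rightarrow> nat \<Rightarrow> real) \<Rightarrow> (nat \<Rightarrow> real) \<Rightarrow> real \<Rightarrow> 'a \<Rightarrow> real" where
  "composite_loss \<phi> l g p x \<beta> \<beta>\<^sub>0 y = \<phi> (l (\<lambda>i. g (lin_pred p x \<beta>\<^sub>0 \<beta> i)) y)"

definition partial_deriv :: "nat \<Rightarrow> ((nat \<Rightarrow> real) \<Rightarrow> real) \<Rightarrow> (nat \<Rightarrow> real) \<Rightarrow> real" where
  "partial_deriv j F z = deriv (\<lambda>t. F (z(j := t))) (z j)"

definition sup_norm :: "nat \<Rightarrow> (nat \<Rightarrow> real) \<Rightarrow> real" where
  "sup_norm p v = Max ((\<lambda>j. \<bar>v j\<bar>) ` {..<p})"

text \<open>The zero-thresholding function, where \<open>\<beta>\<^sub>0hat\<close> is the intercept fitted at \<open>\<beta> = 0\<close>.\<close>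

definition zero_threshold ::
  "(real \<Rightarrow> real) \<Rightarrow> ((nat \<Rightarrow> real) \<Rightarrow> 'a \<Rightarrow> real) \<Rightarrow> (real \<Rightarrow> real) \<Rightarrow>
   nat \<Rightarrow> (nat \<Rightarrow> nat \<Rightarrow> real) \<Rightarrow> real \<Rightarrow> 'a \<Rightarrow> real" where
  "zero_threshold \<phi> l g p x \<beta>\<^sub>0hat y =
     sup_norm p (\<lambda>j. partial_deriv j (\<lambda>\<beta>. composite_loss \<phi> l g p x \<beta> \<beta>\<^sub>0hat y) (\<lambda>_. 0))"

definition standardized_design :: "nat \<Rightarrow> nat \<Rightarrow> (nat \<Rightarrow> nat \<Rightarrow> real) \<Rightarrow> real \<Rightarrow> bool" where
  "standardized_design n p x B \<longleftrightarrow>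
     p \<ge> 1 \<and>
     (\<forall>i<n. \<forall>j<p. \<bar>x i j\<bar> \<le> B) \<and>
     (\<forall>j<p. (\<Sum>i<n. x i j) = 0) \<and>
     (\<forall>j<p. (\<Sum>i<n. (x i j)\<^sup>2) = real n)"

end

theory Submission
  imports Defs "HOL-Real_Asymp.Real_Asymp"
begin

text \<open>
  Under the null model the score in coordinate \<open>j\<close> is, because the columns of \<open>X\<close> are centred and
  \<open>g' = 1 / sqrt d''\<close>, equal to \<open>-(\<sigma> / \<sigma>hat) / n\<close> times \<open>\<Sum>i. x\<^sub>i\<^sub>j z\<^sub>i\<close> with standardized errors \<open>z\<^sub>i\<close> whose
  exponential moments are finite.  The reference law replaces the errors by standard normal ones and
  \<open>\<sigma> / \<sigma>hat\<close> by 1.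

  The Gaussian comparison is a smoothed Lindeberg argument.  The indicator of \<open>max > t\<close> becomes
  \<open>logistic (\<kappa> * (lse - t))\<close>, where \<open>lse\<close> is the log-sum-exp soft maximum at inverse temperature \<open>\<beta>\<close>.  Its third
  derivative along a row \<open>v\<close> is at most \<open>4 \<kappa> \<beta>\<^sup>2\<close> times the Gibbs average of \<open>|v|^3\<close>, and Gibbs averages are
  stable under small perturbations.  Replacing at each step the error whose Gibbs weight is smallest
  costs only a harmonic sum, since the weights of all rows add up to at most the largest entry.
  Anti-concentration of the Gaussian maximum comes from Stein's identity applied to the same smooth
  functional.  Finally the likelihood equation \<open>d' \<theta>hat = mean of T\<close> and Chebyshev's inequality give
  \<open>|\<sigma> / \<sigma>hat - 1| = O(n powr (-1/3))\<close> with high probability, which is absorbed by anti-concentration.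
\<close>

section \<open>Soft maxima and their derivatives\<close>

text \<open>Two scales are involved: 1 / \<kappa> is the width of the smoothed indicator, 1 /
  \<beta> the temperature. With L = 1 + ln (2 p) they are \<kappa> = sqrt L n^s and \<beta> = L
  \<kappa>. Then the bias ln (2 p) / \<beta> of the soft maximum is below one width, and the
  anti-concentration error, of order sqrt L / \<kappa> per width, tends to 0. The Lindeberg error
  \<kappa> \<beta>^2 B / sqrt n equals B L^(7/2) n^(3 s - 1/2), which is where the seventh power of
  the logarithm in the growth condition is spent. The obstacle in the replacement is that the cost
  of exchanging a coordinate is a Gibbs weight averaged under a hybrid law, which depends on the
  coordinates already exchanged. The costs have a bounded total only when all of them refer to the
  same law, so along a fixed order they cannot be added up. Taking the cheapest coordinate each time
  uses the bound for the current law alone, and the resulting factor ln n is negligible against a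
  power of n. An error in the fitted scale acts on the threshold as a factor, so it is harmless only
  at moderate levels; higher levels are left to a tail bound.\<close>

definition logistic :: "real \<Rightarrow> real" where "logistic x = 1 / (1 + exp (- x))"

lemma logistic_pos: "0 < logistic x" and logistic_less_1: "logistic x < 1"
  by (auto simp: logistic_def add_pos_pos)

lemma logistic_mono: "x \<le> y \<Longrightarrow> logistic x \<le> logistic y"
  unfolding logistic_def by (intro divide_left_mono) (auto intro!: add_pos_pos mult_pos_pos)

lemma DERIV_logistic [derivative_intros]:
  assumes "(f has_real_derivative D) (at x within S)"
  shows "((\<lambda>x. logistic (f x)) has_real_derivative
    logistic (f x) * (1 - logistic (f x)) * D) (at x within S)"
proof -
  have nz: "1 + exp (- y) \<noteq> 0" for y :: real
    by (metis add_pos_pos exp_gt_zero less_irrefl zero_less_one)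
  show ?thesis
    unfolding logistic_def using nz[of "f x"]
    by (auto intro!: derivative_eq_intros assms simp: field_simps power2_eq_square)
qed

text \<open>Over a unit interval the logarithm of the logistic slope changes by at most 1, so the
  increment is at most e - 1 <= 2 times the slope at \<open>x\<close>. Thus a bound for the expected
  slope at single thresholds, as in \<open>anti_concentration\<close>, becomes a Lipschitz bound in
  the threshold.\<close>

lemma logistic_step:
  "logistic x - logistic (x - 1) \<le> 2 * (logistic x * (1 - logistic x))"
proof -
  define q where "q = exp (- x)"
  have q: "q > 0" by (simp add: q_def)
  have e: "1 < exp (1::real)" "exp (1::real) \<le> 3" using exp_le by auto
  have "exp (- (x - 1)) = q * exp 1" by (simp add: q_def exp_add[symmetric])
  then have "logistic x - logistic (x - 1) = 1 / (1 + q) - 1 / (1 + q * exp 1)"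
    by (simp add: logistic_def q_def)
  also have "\<dots> = q * (exp 1 - 1) / ((1 + q) * (1 + q * exp 1))"
    using q add_pos_pos[OF zero_less_one mult_pos_pos[OF q exp_gt_zero[of 1]]]
    by (simp add: divide_simps algebra_simps)
  also have "\<dots> \<le> q * 2 / ((1 + q) * (1 + q))"
  proof (intro frac_le mult_left_mono)
    show "1 + q \<le> 1 + q * exp 1" using q e by simp
  qed (use q e in auto)
  also have "\<dots> = 2 * (logistic x * (1 - logistic x))"
    using q by (simp add: logistic_def q_def[symmetric] divide_simps)
  finally show ?thesis .
qed

lemma one_minus_logistic_le: "1 - logistic x \<le> exp (- x)"
proof -
  have p: "1 + exp (- x) > 0" by (simp add: add_pos_pos)
  then show ?thesis unfolding logistic_def by (simp add: divide_simps algebra_simps)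
qed

lemma logistic_le_exp: "logistic x \<le> exp x"
proof -
  have "exp x * (1 + exp (- x)) = exp x + 1" by (simp add: algebra_simps exp_add[symmetric])
  then show ?thesis unfolding logistic_def
    by (subst pos_divide_le_eq) (auto simp: add_pos_pos)
qed

text \<open>The softmax expectation. It is the directional derivative of \<open>lse\<close>, so
  derivatives of the soft maximum become moments of a probability vector.\<close>

definition gibbs :: "real \<Rightarrow> 'j set \<Rightarrow> ('j \<Rightarrow> real) \<Rightarrow> ('j \<Rightarrow> real) \<Rightarrow> real" where
  "gibbs \<beta> J u q = (\<Sum>j\<in>J. exp (\<beta> * u j) * q j) / (\<Sum>j\<in>J. exp (\<beta> * u j))"

definition lse :: "real \<Rightarrow> 'j set \<Rightarrow> ('j \<Rightarrow> real) \<Rightarrow> real" where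
  "lse \<beta> J u = ln (\<Sum>j\<in>J. exp (\<beta> * u j)) / \<beta>"

locale soft_max =
  fixes J :: "'j set" and \<beta> :: real
  assumes fin: "finite J" and ne: "J \<noteq> {}" and \<beta>_pos: "\<beta> > 0"
begin

lemma Z_pos: "(\<Sum>j\<in>J. exp (\<beta> * u j)) > 0"
  using fin ne by (intro sum_pos) auto

lemma gibbs_mono: "(\<And>j. j \<in> J \<Longrightarrow> q j \<le> q' j) \<Longrightarrow> gibbs \<beta> J u q \<le> gibbs \<beta> J u q'"
  unfolding gibbs_def using Z_pos[of u] by (intro divide_right_mono sum_mono) auto

lemma gibbs_const: "gibbs \<beta> J u (\<lambda>_. c) = c"
  unfolding gibbs_def using Z_pos[of u] by (simp add: sum_distrib_right[symmetric])

lemma gibbs_nonneg: "(\<And>j. j \<in> J \<Longrightarrow> 0 \<le> q j) \<Longrightarrow> 0 \<le> gibbs \<beta> J u q"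
  using gibbs_mono[of "\<lambda>_. 0" q u] by (simp add: gibbs_const)

lemma gibbs_cmult: "gibbs \<beta> J u (\<lambda>j. c * q j) = c * gibbs \<beta> J u q"
  unfolding gibbs_def by (simp add: sum_distrib_left algebra_simps)

lemma gibbs_sum: "gibbs \<beta> J u (\<lambda>j. \<Sum>i\<in>I. q i j) = (\<Sum>i\<in>I. gibbs \<beta> J u (q i))"
  unfolding gibbs_def
  by (simp only: sum_distrib_left sum_divide_distrib[symmetric]) (simp only: sum.swap[of _ J])

lemma gibbs_add: "gibbs \<beta> J u (\<lambda>j. q j + q' j) = gibbs \<beta> J u q + gibbs \<beta> J u q'"
  unfolding gibbs_def by (simp add: distrib_left sum.distrib add_divide_distrib)

lemma gibbs_abs_le: "\<bar>gibbs \<beta> J u q\<bar> \<le> gibbs \<beta> J u (\<lambda>j. \<bar>q j\<bar>)"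
proof -
  have "gibbs \<beta> J u q \<le> gibbs \<beta> J u (\<lambda>j. \<bar>q j\<bar>)" by (rule gibbs_mono) auto
  moreover have "gibbs \<beta> J u (\<lambda>j. - 1 * q j) \<le> gibbs \<beta> J u (\<lambda>j. \<bar>q j\<bar>)" by (rule gibbs_mono) auto
  ultimately show ?thesis unfolding gibbs_cmult by auto
qed

lemma gibbs_bound: "(\<And>j. j \<in> J \<Longrightarrow> \<bar>q j\<bar> \<le> c) \<Longrightarrow> \<bar>gibbs \<beta> J u q\<bar> \<le> c"
  using gibbs_abs_le[of u q] gibbs_mono[of "\<lambda>j. \<bar>q j\<bar>" "\<lambda>_. c" u] by (simp add: gibbs_const)

text \<open>Numerator and normalizer each change by a factor of at most exp (\<beta> c), whence the
  2 in the exponent; the sign of \<open>q\<close> makes the weightwise comparison valid in the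
  numerator.\<close>

lemma gibbs_shift:
  assumes "\<And>j. j \<in> J \<Longrightarrow> \<bar>u j - u' j\<bar> \<le> c" and "\<And>j. j \<in> J \<Longrightarrow> 0 \<le> q j"
  shows "gibbs \<beta> J u q \<le> exp (2 * \<beta> * c) * gibbs \<beta> J u' q"
proof -
  have e: "exp (\<beta> * u j) \<le> exp (\<beta> * c) * exp (\<beta> * u' j)"
          "exp (\<beta> * u' j) \<le> exp (\<beta> * c) * exp (\<beta> * u j)" if "j \<in> J" for j
  proof -
    have "\<beta> * (u j - u' j) \<le> \<beta> * c" "\<beta> * (u' j - u j) \<le> \<beta> * c"
      using assms(1)[OF that] \<beta>_pos by (auto intro!: mult_left_mono)
    then show "exp (\<beta> * u j) \<le> exp (\<beta> * c) * exp (\<beta> * u' j)"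
          "exp (\<beta> * u' j) \<le> exp (\<beta> * c) * exp (\<beta> * u j)"
      by (auto simp: exp_add[symmetric] algebra_simps)
  qed
  have num: "(\<Sum>j\<in>J. exp (\<beta> * u j) * q j) \<le> exp (\<beta> * c) * (\<Sum>j\<in>J. exp (\<beta> * u' j) * q j)"
    unfolding sum_distrib_left using e(1) assms(2)
    by (intro sum_mono) (auto simp: mult.assoc[symmetric] intro!: mult_right_mono)
  have den: "(\<Sum>j\<in>J. exp (\<beta> * u' j)) / exp (\<beta> * c) \<le> (\<Sum>j\<in>J. exp (\<beta> * u j))"
    using sum_mono[of J "\<lambda>j. exp (\<beta> * u' j)" "\<lambda>j. exp (\<beta> * c) * exp (\<beta> * u j)"] e(2)
    by (simp add: sum_distrib_left[symmetric] pos_divide_le_eq mult.commute)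
  have "gibbs \<beta> J u q \<le> (exp (\<beta> * c) * (\<Sum>j\<in>J. exp (\<beta> * u' j) * q j)) /
      ((\<Sum>j\<in>J. exp (\<beta> * u' j)) / exp (\<beta> * c))"
    unfolding gibbs_def using Z_pos[of u'] Z_pos[of u] assms(2) num den
    by (intro frac_le) (auto intro!: mult_nonneg_nonneg sum_nonneg)
  also have "\<dots> = exp (2 * \<beta> * c) * gibbs \<beta> J u' q"
    unfolding gibbs_def by (simp add: exp_add[symmetric])
  finally show ?thesis .
qed

text \<open>Two independent draws from the same weights: a product of averages is an average over
  pairs, to which pointwise inequalities between \<open>q j\<close> and \<open>r k\<close>
  apply.\<close>

lemma gibbs_prod: "gibbs \<beta> J u q * gibbs \<beta> J u r = gibbs \<beta> J u (\<lambda>j. gibbs \<beta> J u (\<lambda>k. q j * r k))"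
proof -
  have "gibbs \<beta> J u (\<lambda>j. gibbs \<beta> J u (\<lambda>k. q j * r k)) = gibbs \<beta> J u (\<lambda>j. gibbs \<beta> J u r * q j)"
    by (simp add: gibbs_cmult mult.commute)
  also have "\<dots> = gibbs \<beta> J u r * gibbs \<beta> J u q" by (rule gibbs_cmult)
  finally show ?thesis by simp
qed

lemma young3: "(x::real) * y\<^sup>2 \<le> (x^3 + 2 * y^3) / 3" if "x \<ge> 0" "y \<ge> 0"
proof -
  have "0 \<le> (x + 2 * y) * (x - y)\<^sup>2" using that by simp
  then show ?thesis by (simp add: power2_eq_square power3_eq_cube algebra_simps)
qed

text \<open>\<open>young3\<close> on a pair of independent draws splits |v_j| v_k^2 into cubes with
  weights 1/3 and 2/3, which recombine to one third absolute moment.\<close>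

lemma gibbs_m1m2:
  "\<bar>gibbs \<beta> J u v * gibbs \<beta> J u (\<lambda>j. v j ^ 2)\<bar> \<le> gibbs \<beta> J u (\<lambda>j. \<bar>v j\<bar> ^ 3)"
proof -
  let ?A = "gibbs \<beta> J u (\<lambda>j. \<bar>v j\<bar> ^ 3)"
  have "\<bar>gibbs \<beta> J u v * gibbs \<beta> J u (\<lambda>j. v j ^ 2)\<bar> \<le> gibbs \<beta> J u (\<lambda>j. \<bar>v j\<bar>) * gibbs \<beta> J u (\<lambda>j. v j ^ 2)"
    unfolding abs_mult using gibbs_nonneg[of "\<lambda>j. v j ^ 2" u] gibbs_abs_le[of u v]
    by (auto intro!: mult_mono)
  also have "\<dots> = gibbs \<beta> J u (\<lambda>j. gibbs \<beta> J u (\<lambda>k. \<bar>v j\<bar> * \<bar>v k\<bar> ^ 2))"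
    by (simp add: gibbs_prod)
  also have "\<dots> \<le> gibbs \<beta> J u (\<lambda>j. gibbs \<beta> J u (\<lambda>k. (1/3) * \<bar>v j\<bar> ^ 3 + (2/3) * \<bar>v k\<bar> ^ 3))"
    using young3[of "\<bar>v _\<bar>" "\<bar>v _\<bar>"] by (intro gibbs_mono) (auto simp: field_simps)
  also have "\<dots> = ?A"
    by (simp only: gibbs_add gibbs_cmult gibbs_const)
  finally show ?thesis .
qed

lemma gibbs_m1_sq: "(gibbs \<beta> J u v)\<^sup>2 \<le> gibbs \<beta> J u (\<lambda>j. v j ^ 2)"
proof -
  let ?m = "gibbs \<beta> J u v"
  have "0 \<le> gibbs \<beta> J u (\<lambda>j. (v j - ?m)\<^sup>2)" by (rule gibbs_nonneg) auto
  also have "\<dots> = gibbs \<beta> J u (\<lambda>j. v j ^ 2 + ((- 2 * ?m) * v j + ?m\<^sup>2))"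
    by (simp add: power2_diff algebra_simps)
  also have "\<dots> = gibbs \<beta> J u (\<lambda>j. v j ^ 2) - ?m\<^sup>2"
    by (simp only: gibbs_add gibbs_cmult gibbs_const) (simp add: power2_eq_square)
  finally show ?thesis by simp
qed

lemma gibbs_m1_cube: "\<bar>gibbs \<beta> J u v\<bar> ^ 3 \<le> gibbs \<beta> J u (\<lambda>j. \<bar>v j\<bar> ^ 3)"
proof -
  have "\<bar>gibbs \<beta> J u v\<bar> ^ 3 = \<bar>gibbs \<beta> J u v\<bar> * (gibbs \<beta> J u v)\<^sup>2"
    by (simp add: power3_eq_cube power2_eq_square)
  also have "\<dots> \<le> \<bar>gibbs \<beta> J u v\<bar> * gibbs \<beta> J u (\<lambda>j. v j ^ 2)"
    by (intro mult_left_mono gibbs_m1_sq) auto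
  also have "\<dots> \<le> gibbs \<beta> J u (\<lambda>j. \<bar>v j\<bar> ^ 3)"
    using gibbs_m1m2[of u v] gibbs_nonneg[of "\<lambda>j. v j ^ 2" u] by (simp add: abs_mult)
  finally show ?thesis .
qed

text \<open>Moving along \<open>v\<close> tilts the weights, so the derivative is \<beta> times the
  Gibbs covariance of \<open>q\<close> and \<open>v\<close>. Applied to powers of \<open>v\<close>,
  it keeps all higher derivatives of \<open>lse\<close> within the moments of
  \<open>v\<close>.\<close>

lemma DERIV_gibbs:
  "((\<lambda>w. gibbs \<beta> J (\<lambda>j. u j + w * v j) q) has_real_derivative
    \<beta> * (gibbs \<beta> J (\<lambda>j. u j + w * v j) (\<lambda>j. q j * v j)
       - gibbs \<beta> J (\<lambda>j. u j + w * v j) q * gibbs \<beta> J (\<lambda>j. u j + w * v j) v)) (at w)"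
  (is "(_ has_real_derivative ?D) _")
proof -
  let ?e = "\<lambda>w j. exp (\<beta> * (u j + w * v j))"
  let ?Z = "\<Sum>j\<in>J. ?e w j"
  have Z: "?Z > 0" by (rule Z_pos)
  have s: "((\<lambda>w. \<Sum>j\<in>J. ?e w j * q j) has_real_derivative (\<Sum>j\<in>J. \<beta> * (?e w j * (q j * v j)))) (at w)" for q
    by (rule DERIV_sum) (auto intro!: derivative_eq_intros simp: algebra_simps)
  have s0: "((\<lambda>w. \<Sum>j\<in>J. ?e w j) has_real_derivative (\<Sum>j\<in>J. \<beta> * (?e w j * v j))) (at w)"
    using s[of "\<lambda>_. 1"] by simp
  have "((\<lambda>w. (\<Sum>j\<in>J. ?e w j * q j) / (\<Sum>j\<in>J. ?e w j)) has_real_derivative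
     ((\<Sum>j\<in>J. \<beta> * (?e w j * (q j * v j))) * ?Z - (\<Sum>j\<in>J. ?e w j * q j) * (\<Sum>j\<in>J. \<beta> * (?e w j * v j))) / (?Z * ?Z)) (at w)"
    using Z by (intro DERIV_divide s s0) auto
  moreover have "((\<Sum>j\<in>J. \<beta> * (?e w j * (q j * v j))) * ?Z - (\<Sum>j\<in>J. ?e w j * q j) * (\<Sum>j\<in>J. \<beta> * (?e w j * v j))) / (?Z * ?Z) = ?D"
    unfolding gibbs_def using Z by (simp add: sum_distrib_left[symmetric] divide_simps) (simp add: algebra_simps)
  ultimately show ?thesis unfolding gibbs_def by simp
qed

lemma DERIV_lse:
  "((\<lambda>w. lse \<beta> J (\<lambda>j. u j + w * v j)) has_real_derivative gibbs \<beta> J (\<lambda>j. u j + w * v j) v) (at w)"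
proof -
  let ?e = "\<lambda>w j. exp (\<beta> * (u j + w * v j))"
  have s0: "((\<lambda>w. \<Sum>j\<in>J. ?e w j) has_real_derivative (\<Sum>j\<in>J. \<beta> * (?e w j * v j))) (at w)"
    by (rule DERIV_sum) (auto intro!: derivative_eq_intros simp: algebra_simps)
  have "((\<lambda>w. lse \<beta> J (\<lambda>j. u j + w * v j)) has_real_derivative
      (inverse (\<Sum>j\<in>J. ?e w j) * (\<Sum>j\<in>J. \<beta> * (?e w j * v j))) / \<beta>) (at w)"
    unfolding lse_def by (intro DERIV_cdivide DERIV_chain2[OF DERIV_ln s0] Z_pos)
  then show ?thesis
  proof (rule DERIV_cong)
    show "inverse (\<Sum>j\<in>J. ?e w j) * (\<Sum>j\<in>J. \<beta> * (?e w j * v j)) / \<beta> = gibbs \<beta> J (\<lambda>j. u j + w * v j) v"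
      using \<beta>_pos Z_pos[of "\<lambda>j. u j + w * v j"]
      by (simp add: gibbs_def sum_distrib_left[symmetric] divide_simps)
  qed
qed

lemma lse_ge: "j \<in> J \<Longrightarrow> u j \<le> lse \<beta> J u"
proof -
  assume j: "j \<in> J"
  have "exp (\<beta> * u j) \<le> (\<Sum>j\<in>J. exp (\<beta> * u j))"
    using j fin by (intro member_le_sum) auto
  then have "\<beta> * u j \<le> ln (\<Sum>j\<in>J. exp (\<beta> * u j))"
    using Z_pos[of u] by (subst ln_ge_iff) auto
  then show ?thesis using \<beta>_pos by (simp add: lse_def field_simps)
qed

lemma lse_le: "(\<And>j. j \<in> J \<Longrightarrow> u j \<le> c) \<Longrightarrow> lse \<beta> J u \<le> c + ln (card J) / \<beta>"
proof -
  assume c: "\<And>j. j \<in> J \<Longrightarrow> u j \<le> c"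
  have "(\<Sum>j\<in>J. exp (\<beta> * u j)) \<le> of_nat (card J) * exp (\<beta> * c)"
    using c \<beta>_pos by (intro sum_bounded_above) auto
  then have "ln (\<Sum>j\<in>J. exp (\<beta> * u j)) \<le> ln (card J * exp (\<beta> * c))"
    using Z_pos[of u] by simp
  also have "\<dots> = ln (card J) + \<beta> * c" 
    using fin ne by (subst ln_mult) (auto simp: card_gt_0_iff)
  finally show ?thesis using \<beta>_pos by (simp add: lse_def field_simps)
qed

end

section \<open>Three derivatives of the smoothed indicator\<close>

definition smooth_step :: "real \<Rightarrow> real \<Rightarrow> real \<Rightarrow> 'j set \<Rightarrow> ('j \<Rightarrow> real) \<Rightarrow> real" where
  "smooth_step \<kappa> t \<beta> J u = logistic (\<kappa> * (lse \<beta> J u - t))"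

context soft_max
begin

context
  fixes \<kappa> t :: real and u v :: "'j \<Rightarrow> real"
  assumes \<kappa>: "0 \<le> \<kappa>" "\<kappa> \<le> \<beta>"
begin

text \<open>\<open>h1\<close>, \<open>h2\<close>, \<open>h3\<close> are the successive derivatives
  of \<open>y\<close>: the chain rule combines the derivatives of the logistic function with the
  first three Gibbs cumulants of \<open>v\<close>, the k-th of which enters with the factor
  \<beta>^(k-1).\<close>

private abbreviation "m k w \<equiv> gibbs \<beta> J (\<lambda>j. u j + w * v j) (\<lambda>j. v j ^ k)"
private abbreviation "m1 w \<equiv> gibbs \<beta> J (\<lambda>j. u j + w * v j) v"
private abbreviation "y w \<equiv> smooth_step \<kappa> t \<beta> J (\<lambda>j. u j + w * v j)"
private abbreviation "h1 w \<equiv> \<kappa> * (y w * (1 - y w)) * m1 w"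
private abbreviation "h2 w \<equiv> \<kappa> * (y w * (1 - y w)) * (\<kappa> * (1 - 2 * y w) * (m1 w)\<^sup>2 + \<beta> * (m 2 w - (m1 w)\<^sup>2))"
private abbreviation "h3 w \<equiv> \<kappa> * (y w * (1 - y w)) *
   (\<kappa>\<^sup>2 * ((1 - 2 * y w)\<^sup>2 - 2 * (y w * (1 - y w))) * (m1 w)^3
    + 3 * \<kappa> * \<beta> * (1 - 2 * y w) * (m1 w * m 2 w - (m1 w)^3)
    + \<beta>\<^sup>2 * (m 3 w - 3 * (m1 w * m 2 w) + 2 * (m1 w)^3))"

lemma DERIV_smooth_step:
  "((\<lambda>w. smooth_step \<kappa> t \<beta> J (\<lambda>j. u j + w * v j)) has_real_derivative h1 w) (at w)"
  unfolding smooth_step_def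
  by (rule derivative_eq_intros DERIV_lse refl)+ (simp add: algebra_simps)

private lemma DERIV_m1: "(m1 has_real_derivative \<beta> * (m 2 w - (m1 w)\<^sup>2)) (at w)"
  using DERIV_gibbs[of u v v w] by (simp add: power2_eq_square)

private lemma DERIV_m2: "(m 2 has_real_derivative \<beta> * (m 3 w - m1 w * m 2 w)) (at w)"
  using DERIV_gibbs[of u v "\<lambda>j. v j ^ 2" w] by (simp add: power2_eq_square power3_eq_cube mult_ac)

private lemma DERIV_h1: "((\<lambda>w. h1 w) has_real_derivative h2 w) (at w)"
  by (rule derivative_eq_intros DERIV_m1 DERIV_smooth_step refl)+ (simp add: power2_eq_square algebra_simps)

private lemma DERIV_h2: "((\<lambda>w. h2 w) has_real_derivative h3 w) (at w)"
  by (rule derivative_eq_intros DERIV_m1 DERIV_m2 DERIV_smooth_step refl)+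
    (simp add: power2_eq_square power3_eq_cube algebra_simps)

text \<open>Every product of moments is at most the third absolute moment. Since \<kappa> <=
  \<beta>, the three summands in the bracket contribute 1 + 6 + 6 = 13 times \<beta>^2; with y (1 -
  y) <= 1/4 this gives 13/4, rounded up to 4.\<close>

private lemma h3_bound: "\<bar>h3 w\<bar> \<le> 4 * \<kappa> * \<beta>\<^sup>2 * gibbs \<beta> J (\<lambda>j. u j + w * v j) (\<lambda>j. \<bar>v j\<bar> ^ 3)"
proof -
  define A where "A = gibbs \<beta> J (\<lambda>j. u j + w * v j) (\<lambda>j. \<bar>v j\<bar> ^ 3)"
  define Y where "Y = y w"
  have Y: "0 < Y" "Y < 1" using logistic_pos logistic_less_1 by (auto simp: Y_def smooth_step_def)
  have A0: "0 \<le> A" unfolding A_def by (rule gibbs_nonneg) auto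
  have a1: "\<bar>(m1 w)^3\<bar> \<le> A" using gibbs_m1_cube unfolding A_def power_abs .
  have a2: "\<bar>m1 w * m 2 w\<bar> \<le> A" using gibbs_m1m2 unfolding A_def .
  have a3: "\<bar>m 3 w\<bar> \<le> A" using gibbs_abs_le[of _ "\<lambda>j. v j ^ 3"] unfolding A_def power_abs .
  have v: "0 \<le> Y * (1 - Y)" "Y * (1 - Y) \<le> 1/4" 
    using Y zero_le_power2[of "Y - 1/2"] by (auto simp: power2_eq_square algebra_simps)
  have c1: "\<bar>(1 - 2 * Y)\<^sup>2 - 2 * (Y * (1 - Y))\<bar> \<le> 1"
    using v by (auto simp: power2_eq_square algebra_simps abs_le_iff)
  have c2: "\<bar>1 - 2 * Y\<bar> \<le> 1" using Y by auto
  have t1: "\<bar>\<kappa>\<^sup>2 * ((1 - 2 * Y)\<^sup>2 - 2 * (Y * (1 - Y))) * (m1 w)^3\<bar> \<le> \<beta>\<^sup>2 * 1 * A"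
    unfolding abs_mult using \<kappa> a1 c1 A0 by (intro mult_mono) (auto simp: power_mono)
  have k: "\<kappa> * \<beta> \<le> \<beta>\<^sup>2" using \<kappa> \<beta>_pos by (simp add: power2_eq_square)
  have t2: "\<bar>3 * \<kappa> * \<beta> * (1 - 2 * Y) * (m1 w * m 2 w - (m1 w)^3)\<bar> \<le> (3 * \<beta>\<^sup>2) * 1 * (2 * A)"
    unfolding abs_mult[of "_ * (1 - 2 * Y)"] abs_mult[of _ "1 - 2 * Y"]
    using \<kappa> a1 a2 c2 A0 k \<beta>_pos abs_triangle_ineq4[of "m1 w * m 2 w" "(m1 w)^3"]
    by (intro mult_mono) (auto simp: mult.assoc abs_mult[of 3] abs_mult[of \<kappa>])
  have t3: "\<bar>\<beta>\<^sup>2 * (m 3 w - 3 * (m1 w * m 2 w) + 2 * (m1 w)^3)\<bar> \<le> \<beta>\<^sup>2 * (6 * A)"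
    unfolding abs_mult[of "\<beta>\<^sup>2"] using a1 a2 a3 by (intro mult_mono) auto
  have "\<bar>h3 w\<bar> = \<kappa> * (Y * (1 - Y)) * \<bar>\<kappa>\<^sup>2 * ((1 - 2 * Y)\<^sup>2 - 2 * (Y * (1 - Y))) * (m1 w)^3
    + 3 * \<kappa> * \<beta> * (1 - 2 * Y) * (m1 w * m 2 w - (m1 w)^3)
    + \<beta>\<^sup>2 * (m 3 w - 3 * (m1 w * m 2 w) + 2 * (m1 w)^3)\<bar>"
    unfolding Y_def[symmetric] using \<kappa> v(1) by (simp only: abs_mult[of "\<kappa> * (Y * (1 - Y))"] abs_of_nonneg mult_nonneg_nonneg)
  also have "\<dots> \<le> \<kappa> * (1/4) * (13 * \<beta>\<^sup>2 * A)"
    using t1 t2 t3 \<kappa> v by (intro mult_mono) (auto simp: algebra_simps)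
  also have "\<dots> \<le> 4 * \<kappa> * \<beta>\<^sup>2 * A" using \<kappa> A0 by (auto simp: algebra_simps intro!: mult_nonneg_nonneg)
  finally show ?thesis unfolding A_def .
qed

text \<open>The coefficients are fixed before \<open>w\<close>, so that laws with equal first two
  moments integrate the quadratic part to the same value. Taylor's formula has the Gibbs average at
  an intermediate point; \<open>gibbs_shift\<close> brings it back to \<open>u\<close> at a price
  exponential in |w|, which is why the noise needs exponential moments.\<close>

lemma smooth_step_taylor:
  assumes "\<And>j. j \<in> J \<Longrightarrow> \<bar>v j\<bar> \<le> \<eta>"
  obtains c1 c2 where
    "\<And>w. \<bar>smooth_step \<kappa> t \<beta> J (\<lambda>j. u j + w * v j) - (smooth_step \<kappa> t \<beta> J u + c1 * w + c2 * w\<^sup>2)\<bar>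
       \<le> \<kappa> * \<beta>\<^sup>2 * gibbs \<beta> J u (\<lambda>j. \<bar>v j\<bar> ^ 3) * (\<bar>w\<bar> ^ 3 * exp (2 * \<beta> * \<eta> * \<bar>w\<bar>))"
proof
  fix w :: real
  define diff where "diff k = (if k = (0::nat) then (\<lambda>w. y w) else if k = 1 then (\<lambda>w. h1 w) else if k = 2 then (\<lambda>w. h2 w) else (\<lambda>w. h3 w))" for k
  let ?A = "gibbs \<beta> J u (\<lambda>j. \<bar>v j\<bar> ^ 3)"
  have "\<forall>k x. k < 3 \<and> \<bar>x\<bar> \<le> \<bar>w\<bar> \<longrightarrow> (diff k has_real_derivative diff (Suc k) x) (at x)"
  proof (intro allI impI, elim conjE)
    fix k :: nat and x assume "k < 3"
    then consider "k = 0" | "k = 1" | "k = 2" by linarith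
    then show "(diff k has_real_derivative diff (Suc k) x) (at x)"
      by cases (auto simp: diff_def DERIV_smooth_step DERIV_h1 DERIV_h2)
  qed
  from Maclaurin_bi_le[OF _ this, of "\<lambda>w. y w"] obtain \<xi> where
    \<xi>: "\<bar>\<xi>\<bar> \<le> \<bar>w\<bar>" "y w = (\<Sum>k<3. diff k 0 / fact k * w ^ k) + diff 3 \<xi> / fact 3 * w ^ 3"
    by (auto simp: diff_def)
  have eq: "y w - (y 0 + h1 0 * w + (h2 0 / 2) * w\<^sup>2) = h3 \<xi> / 6 * w^3"
    using \<xi>(2) by (simp add: diff_def eval_nat_numeral)
  have "gibbs \<beta> J (\<lambda>j. u j + \<xi> * v j) (\<lambda>j. \<bar>v j\<bar> ^ 3) \<le> exp (2 * \<beta> * (\<eta> * \<bar>w\<bar>)) * ?A"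
  proof (rule gibbs_shift)
    fix j assume "j \<in> J"
    then have "\<bar>\<xi>\<bar> * \<bar>v j\<bar> \<le> \<bar>w\<bar> * \<eta>" using assms \<xi> by (intro mult_mono) auto
    then show "\<bar>u j + \<xi> * v j - u j\<bar> \<le> \<eta> * \<bar>w\<bar>" by (simp add: abs_mult mult.commute)
  qed auto
  then have g: "\<bar>h3 \<xi>\<bar> \<le> 4 * \<kappa> * \<beta>\<^sup>2 * (exp (2 * \<beta> * \<eta> * \<bar>w\<bar>) * ?A)"
    using \<kappa> by (intro order_trans[OF h3_bound] mult_left_mono) (auto simp: mult.assoc)
  have "\<bar>h3 \<xi> / 6 * w^3\<bar> = \<bar>h3 \<xi>\<bar> * \<bar>w\<bar>^3 / 6" by (simp add: abs_mult power_abs)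
  also have "\<dots> \<le> (4 * \<kappa> * \<beta>\<^sup>2 * (exp (2 * \<beta> * \<eta> * \<bar>w\<bar>) * ?A)) * \<bar>w\<bar>^3 / 6"
    using g by (intro divide_right_mono mult_right_mono) auto
  \<comment> \<open>The constant 4 is enlarged to 3! = 6, so that the remainder ends up with
    constant 1.\<close>
  also have "\<dots> \<le> (6 * \<kappa> * \<beta>\<^sup>2 * (exp (2 * \<beta> * \<eta> * \<bar>w\<bar>) * ?A)) * \<bar>w\<bar>^3 / 6"
    using \<kappa> gibbs_nonneg[of "\<lambda>j. \<bar>v j\<bar> ^ 3" u] 
    by (intro divide_right_mono mult_right_mono) auto
  also have "\<dots> = \<kappa> * \<beta>\<^sup>2 * ?A * (\<bar>w\<bar> ^ 3 * exp (2 * \<beta> * \<eta> * \<bar>w\<bar>))" by (simp add: algebra_simps)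
  finally show "\<bar>y w - (smooth_step \<kappa> t \<beta> J u + h1 0 * w + (h2 0 / 2) * w\<^sup>2)\<bar>
       \<le> \<kappa> * \<beta>\<^sup>2 * ?A * (\<bar>w\<bar> ^ 3 * exp (2 * \<beta> * \<eta> * \<bar>w\<bar>))"
    unfolding eq[symmetric] by simp
qed

end
end

section \<open>Standardized noise, the normal law and greedy exchange\<close>

text \<open>From 1 + u <= exp u at u = s x / 3, cubed: a cubic factor costs only an arbitrarily
  small amount \<open>s\<close> of exponential rate.\<close>

lemma cube_exp_le:
  fixes x :: real
  assumes "s > 0" "x \<ge> 0"
  shows "x ^ 3 * exp (r * x) \<le> 27 / s ^ 3 * exp ((r + s) * x)"
proof -
  have "s * x / 3 \<le> exp (s * x / 3)" using exp_ge_add_one_self[of "s * x / 3"] by linarith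
  then have "(s * x / 3) ^ 3 \<le> exp (s * x / 3) ^ 3" using assms by (intro power_mono) auto
  also have "\<dots> = exp (s * x)" by (simp add: exp_of_nat_mult[symmetric])
  finally have "x ^ 3 \<le> 27 / s ^ 3 * exp (s * x)" using assms by (simp add: field_simps)
  then have "x ^ 3 * exp (r * x) \<le> (27 / s ^ 3 * exp (s * x)) * exp (r * x)" by (intro mult_right_mono) auto
  then show ?thesis by (simp add: exp_add algebra_simps)
qed

definition exp_cube_moment :: "real measure \<Rightarrow> real \<Rightarrow> real" where
  "exp_cube_moment \<rho> r = (\<integral>w. \<bar>w\<bar> ^ 3 * exp (r * \<bar>w\<bar>) \<partial>\<rho>)"

text \<open>The rate \<open>r\<close> pays for the factor exp (2 \<beta> \<eta> |w|) of
  \<open>smooth_step_taylor\<close>. It belongs to the noise law and stays fixed as the sample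
  grows, while 2 \<beta> \<eta> tends to 0 in the application.\<close>

locale std_noise = prob_space \<rho> for \<rho> :: "real measure" +
  fixes r :: real
  assumes sets_noise [measurable_cong, simp]: "sets \<rho> = sets borel"
    and r_nonneg: "0 \<le> r"
    and integrable_cube: "integrable \<rho> (\<lambda>w. \<bar>w\<bar> ^ 3 * exp (r * \<bar>w\<bar>))"
    and mean_0: "(\<integral>w. w \<partial>\<rho>) = 0" and var_1: "(\<integral>w. w\<^sup>2 \<partial>\<rho>) = 1"
begin

lemma power_le_cube_exp: "k \<le> 3 \<Longrightarrow> \<bar>w\<bar> ^ k \<le> 1 + \<bar>w\<bar> ^ 3 * exp (r * \<bar>w\<bar>)"
proof (cases "\<bar>w\<bar> \<le> 1")
  case True
  then have "\<bar>w\<bar> ^ k \<le> 1" by (intro power_le_one) auto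
  then show ?thesis by (simp add: add_increasing2)
next
  case False
  assume "k \<le> 3"
  then have "\<bar>w\<bar> ^ k \<le> \<bar>w\<bar> ^ 3 * 1" using False by (simp add: power_increasing)
  also have "\<dots> \<le> \<bar>w\<bar> ^ 3 * exp (r * \<bar>w\<bar>)" using r_nonneg by (intro mult_left_mono) auto
  finally show ?thesis by simp
qed

lemma integrable_power: "k \<le> 3 \<Longrightarrow> integrable \<rho> (\<lambda>w. w ^ k)"
  by (rule Bochner_Integration.integrable_bound[where f="\<lambda>w. 1 + \<bar>w\<bar> ^ 3 * exp (r * \<bar>w\<bar>)"])
    (use power_le_cube_exp integrable_cube in \<open>auto simp: power_abs[symmetric] add_nonneg_nonneg\<close>)

text \<open>Mean 0 removes \<open>c1\<close> and variance 1 turns \<open>c2 * w\<^sup>2\<close> into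
  \<open>c2\<close>. The value \<open>c0 + c2\<close> is thus common to all standardized laws, and
  two such laws differ only through their remainders.\<close>

lemma integral_quadratic_approx:
  assumes [measurable]: "f \<in> borel_measurable borel"
    and b: "\<And>w. \<bar>f w - (c0 + c1 * w + c2 * w\<^sup>2)\<bar> \<le> C * (\<bar>w\<bar> ^ 3 * exp (r * \<bar>w\<bar>))"
  shows "\<bar>(\<integral>w. f w \<partial>\<rho>) - (c0 + c2)\<bar> \<le> C * exp_cube_moment \<rho> r"
proof -
  let ?q = "\<lambda>w. c0 + c1 * w + c2 * w\<^sup>2"
  have q: "integrable \<rho> ?q" using integrable_power[of 1] integrable_power[of 2] by auto
  have d: "integrable \<rho> (\<lambda>w. f w - ?q w)"
    by (rule Bochner_Integration.integrable_bound[where f="\<lambda>w. C * (\<bar>w\<bar> ^ 3 * exp (r * \<bar>w\<bar>))"])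
      (use integrable_cube order_trans[OF b abs_ge_self] in auto)
  have "(\<integral>w. f w \<partial>\<rho>) = (\<integral>w. (f w - ?q w) + ?q w \<partial>\<rho>)" by simp
  also have "\<dots> = (\<integral>w. f w - ?q w \<partial>\<rho>) + (\<integral>w. ?q w \<partial>\<rho>)"
    by (rule Bochner_Integration.integral_add[OF d q])
  also have "(\<integral>w. ?q w \<partial>\<rho>) = c0 + c2"
    using integrable_power[of 1] integrable_power[of 2] by (simp add: mean_0 var_1 prob_space)
  finally have "\<bar>(\<integral>w. f w \<partial>\<rho>) - (c0 + c2)\<bar> \<le> (\<integral>w. \<bar>f w - ?q w\<bar> \<partial>\<rho>)"
    using integral_abs_bound[of \<rho> "\<lambda>w. f w - ?q w"] by simp
  also have "\<dots> \<le> (\<integral>w. C * (\<bar>w\<bar> ^ 3 * exp (r * \<bar>w\<bar>)) \<partial>\<rho>)"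
    using d integrable_cube b by (intro integral_mono) auto
  finally show ?thesis by (simp add: exp_cube_moment_def)
qed

end

section \<open>The standard normal law and Stein's identity\<close>

abbreviation std_normal :: "real measure" where
  "std_normal \<equiv> density lborel std_normal_density"

interpretation std_normal: prob_space std_normal
  by (rule prob_space_normal_density) simp

lemma std_normal_mgf: "has_bochner_integral std_normal (\<lambda>w. exp (s * w)) (exp (s\<^sup>2 / 2))"
proof -
  have eq: "std_normal_density w * exp (s * w) = exp (s\<^sup>2 / 2) * normal_density s 1 w" for w
  proof -
    have "- w\<^sup>2 / 2 + s * w = s\<^sup>2 / 2 + - (w - s)\<^sup>2 / 2" by (simp add: power2_eq_square field_simps)
    then have "exp (- w\<^sup>2 / 2) * exp (s * w) = exp (s\<^sup>2 / 2) * exp (- (w - s)\<^sup>2 / 2)"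
      by (simp only: exp_add[symmetric])
    then show ?thesis unfolding normal_density_def by simp
  qed
  have "has_bochner_integral lborel (\<lambda>w. std_normal_density w *\<^sub>R exp (s * w)) (exp (s\<^sup>2 / 2) * 1)"
    unfolding real_scaleR_def eq 
    by (rule has_bochner_integral_mult_right) (simp add: has_bochner_integral_iff)
  then show ?thesis by (subst has_bochner_integral_density) auto
qed

lemma std_noise_normal: "0 \<le> r \<Longrightarrow> std_noise std_normal r"
proof unfold_locales
  assume r: "0 \<le> r"
  show "integrable std_normal (\<lambda>w. \<bar>w\<bar> ^ 3 * exp (r * \<bar>w\<bar>))"
  proof (rule Bochner_Integration.integrable_bound[where f="\<lambda>w. 27 * (exp ((r + 1) * w) + exp (- (r + 1) * w))"])
    show "AE w in std_normal. norm (\<bar>w\<bar> ^ 3 * exp (r * \<bar>w\<bar>)) \<le> norm (27 * (exp ((r + 1) * w) + exp (- (r + 1) * w)))"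
    proof (rule AE_I2)
      fix w :: real
      have "exp ((r + 1) * \<bar>w\<bar>) \<le> exp ((r + 1) * w) + exp (- (r + 1) * w)"
        by (cases "w \<ge> 0") (auto simp: algebra_simps)
      with cube_exp_le[of 1 "\<bar>w\<bar>" r] show "norm (\<bar>w\<bar> ^ 3 * exp (r * \<bar>w\<bar>)) \<le> norm (27 * (exp ((r + 1) * w) + exp (- (r + 1) * w)))"
        by (simp add: abs_mult)
    qed
    have "integrable std_normal (\<lambda>w. exp (s * w))" for s
      using std_normal_mgf by (simp add: has_bochner_integral_iff)
    then show "integrable std_normal (\<lambda>w. 27 * (exp ((r + 1) * w) + exp (- (r + 1) * w)))"
      by (intro integrable_mult_right Bochner_Integration.integrable_add)
  qed simp
  show "(\<integral>w. w \<partial>std_normal) = 0" using integral_std_normal_moment_odd[of 0]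
    by (subst integral_density) auto
  show "(\<integral>w. w\<^sup>2 \<partial>std_normal) = 1" using integral_std_normal_moment_even[of 1]
    by (subst integral_density) (auto simp: fact_numeral)
qed auto

text \<open>Integration by parts: the density \<phi> satisfies \<phi>' = - w \<phi>, so the
  difference of the two integrands is the derivative of \<phi> h, whose limits at both ends are 0
  because \<open>h\<close> is bounded.\<close>

lemma std_normal_stein:
  assumes h: "\<And>w. (h has_real_derivative h' w) (at w)" and h': "continuous_on UNIV h'"
    and b: "\<And>w. \<bar>h w\<bar> \<le> c" "\<And>w. \<bar>h' w\<bar> \<le> c'"
  shows "(\<integral>w. w * h w \<partial>std_normal) = (\<integral>w. h' w \<partial>std_normal)"
proof -
  interpret std_noise std_normal 0 by (rule std_noise_normal) simp
  have hc: "continuous_on UNIV h" by (rule DERIV_continuous_on[OF has_field_derivative_at_within[OF h]])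
  have [measurable]: "h \<in> borel_measurable borel" "h' \<in> borel_measurable borel"
    by (rule borel_measurable_continuous_onI[OF hc] borel_measurable_continuous_onI[OF h'])+
  let ?\<phi> = std_normal_density
  let ?f = "\<lambda>w. ?\<phi> w * h' w - ?\<phi> w * (w * h w)"
  have i1: "integrable std_normal (\<lambda>w. w * h w)"
  proof (rule Bochner_Integration.integrable_bound[where f="\<lambda>w. \<bar>w\<bar> * \<bar>c\<bar>"])
    show "AE w in std_normal. norm (w * h w) \<le> norm (\<bar>w\<bar> * \<bar>c\<bar>)"
      unfolding real_norm_def abs_mult abs_abs
      by (intro AE_I2 mult_left_mono order_trans[OF b(1) abs_ge_self]) simp
    show "integrable std_normal (\<lambda>w. \<bar>w\<bar> * \<bar>c\<bar>)"
      using integrable_power[of 1] by simp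
  qed measurable
  have i2: "integrable std_normal h'"
    by (rule std_normal.integrable_const_bound[where B=c']) (simp_all add: b(2))
  have \<phi>: "(?\<phi> has_real_derivative - w * ?\<phi> w) (at w)" for w
  proof -
    define c where "c = 1 / sqrt (2 * pi)"
    have "?\<phi> = (\<lambda>w. c * exp (- w\<^sup>2 / 2))" by (simp add: fun_eq_iff std_normal_density_def c_def)
    then show ?thesis by (auto intro!: derivative_eq_intros)
  qed
  have lim: "(?\<phi> \<longlongrightarrow> 0) at_top" "(?\<phi> \<longlongrightarrow> 0) at_bot"
    unfolding std_normal_density_def by real_asymp+
  have lim0: "((\<lambda>w. ?\<phi> w * h w) \<longlongrightarrow> 0) F" if "(?\<phi> \<longlongrightarrow> 0) F" for F
  proof (rule Lim_null_comparison)
    show "((\<lambda>w. ?\<phi> w * c) \<longlongrightarrow> 0) F" using tendsto_mult_left_zero[OF that] .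
    show "\<forall>\<^sub>F w in F. norm (?\<phi> w * h w) \<le> ?\<phi> w * c"
      by (rule always_eventually) (auto simp: abs_mult intro!: mult_left_mono b(1))
  qed
  have int: "integrable lborel (\<lambda>w. ?\<phi> w * (w * h w))" "integrable lborel (\<lambda>w. ?\<phi> w * h' w)"
    using i1 i2 by (auto simp: integrable_density)
  have "(LBINT w=-\<infinity>..\<infinity>. ?f w) = 0 - 0"
  proof (rule interval_integral_FTC_integrable[where F="\<lambda>w. ?\<phi> w * h w"])
    show "((\<lambda>w. ?\<phi> w * h w) has_vector_derivative ?f w) (at w)" for w
      unfolding has_real_derivative_iff_has_vector_derivative[symmetric]
      by (auto intro!: derivative_eq_intros \<phi> h simp: algebra_simps)
    show "isCont ?f w" for w
      using hc h' by (intro continuous_intros) (auto simp: continuous_on_eq_continuous_at normal_density_def)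
    show "set_integrable lborel (einterval (-\<infinity>) \<infinity>) ?f"
      using int by (simp add: set_integrable_def)
  qed (use lim lim0 in \<open>auto simp: ereal_tendsto_simps\<close>)
  then have "(\<integral>w. ?f w \<partial>lborel) = 0"
    by (simp add: interval_lebesgue_integral_def set_lebesgue_integral_def)
  then show ?thesis
    using int by (simp add: integral_density)
qed

text \<open>With m + 1 elements missing from \<open>A\<close>, averaging the budget \<eta> yields
  one whose cost is at most \<eta> / (m + 1); inserting it leaves m. The order is adaptive because
  \<open>Q i A\<close> changes with \<open>A\<close>, and no relation between costs at different
  sets is assumed.\<close>

lemma greedy_exchange:
  fixes \<Phi> :: "'i set \<Rightarrow> real" and Q :: "'i \<Rightarrow> 'i set \<Rightarrow> real"
  assumes "finite I" "K \<ge> 0" "\<eta> \<ge> 0"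
    and step: "\<And>A i. A \<subseteq> I \<Longrightarrow> i \<in> I - A \<Longrightarrow> \<bar>\<Phi> (insert i A) - \<Phi> A\<bar> \<le> K * Q i A"
    and sum: "\<And>A. A \<subseteq> I \<Longrightarrow> (\<Sum>i\<in>I - A. Q i A) \<le> \<eta>"
    and "A \<subseteq> I"
  shows "\<bar>\<Phi> I - \<Phi> A\<bar> \<le> K * \<eta> * harm (card (I - A))"
  using \<open>A \<subseteq> I\<close>
proof (induction "card (I - A)" arbitrary: A)
  case 0
  then have "A = I" using \<open>finite I\<close> by auto
  then show ?case by (simp add: harm_def)
next
  case (Suc m)
  have fin: "finite (I - A)" using \<open>finite I\<close> by simp
  have "\<exists>i\<in>I - A. Q i A \<le> \<eta> / (m + 1)"
  proof (rule ccontr)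
    assume "\<not> ?thesis"
    moreover have "I - A \<noteq> {}" using Suc(2) by (metis card.empty nat.distinct(1))
    ultimately have "(\<Sum>i\<in>I - A. \<eta> / (m + 1)) < (\<Sum>i\<in>I - A. Q i A)"
      using Suc(2) fin by (intro sum_strict_mono) (auto simp: not_le)
    then show False using sum[OF Suc(3)] Suc(2)[symmetric] by simp
  qed
  then obtain i where i: "i \<in> I - A" "Q i A \<le> \<eta> / (m + 1)" by auto
  have card: "card (I - insert i A) = m"
    using i fin Suc(2) by (metis Diff_insert card_Diff_singleton diff_Suc_1)
  have "\<bar>\<Phi> I - \<Phi> A\<bar> \<le> \<bar>\<Phi> I - \<Phi> (insert i A)\<bar> + \<bar>\<Phi> (insert i A) - \<Phi> A\<bar>" by simp
  also have "\<dots> \<le> K * \<eta> * harm m + K * (\<eta> / (m + 1))"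
  proof (intro add_mono)
    show "\<bar>\<Phi> I - \<Phi> (insert i A)\<bar> \<le> K * \<eta> * harm m"
      using Suc(1)[of "insert i A"] card i Suc(3) by auto
    show "\<bar>\<Phi> (insert i A) - \<Phi> A\<bar> \<le> K * (\<eta> / (m + 1))"
      by (rule order_trans[OF step[OF Suc(3) i(1)] mult_left_mono[OF i(2) \<open>K \<ge> 0\<close>]])
  qed
  also have "\<dots> = K * \<eta> * harm (Suc m)"
    by (simp add: harm_Suc field_simps)
  finally show ?case using Suc(2) by simp
qed

lemma harm_le: "n > 0 \<Longrightarrow> harm n \<le> 1 + ln (real n)"
proof (induction n rule: nat_induct_non_zero)
  case (Suc n)
  have "ln (real n / real (Suc n)) \<le> real n / real (Suc n) - 1" using Suc(1) by (intro ln_le_minus_one) auto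
  then have "ln (real n) - ln (real (Suc n)) \<le> - inverse (real (Suc n))"
    using Suc(1) by (subst (asm) ln_div) (auto simp: field_simps)
  then show ?case using Suc by (simp add: harm_Suc)
qed (simp add: harm_def)

section \<open>Lindeberg replacement for soft maxima\<close>

context
  fixes M :: "nat \<Rightarrow> real measure"
  assumes prob: "\<And>k. prob_space (M k)" and sets_M: "\<And>k. sets (M k) = sets borel"
begin

interpretation M: product_prob_space M
  by (rule product_prob_spaceI) (rule prob)

lemma measurable_PiM_borel_iff:
  "f \<in> borel_measurable (PiM I M) \<longleftrightarrow> f \<in> borel_measurable (PiM I (\<lambda>_. borel))"
  using sets_M by (intro arg_cong[where f="\<lambda>A. f \<in> A"] measurable_cong_sets sets_PiM_cong) auto

lemma integral_PiM_split:
  assumes f: "integrable (PiM {..<n} M) (f :: _ \<Rightarrow> real)" and i: "i < n"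
  shows "(\<integral>z. f z \<partial>PiM {..<n} M) = (\<integral>x. (\<integral>w. f (x(i := w)) \<partial>M i) \<partial>PiM ({..<n} - {i}) M)"
proof -
  have eq: "insert i ({..<n} - {i}) = {..<n}" using i by auto
  show ?thesis
    using M.product_integral_insert[of "{..<n} - {i}" i f] f unfolding eq by simp
qed

lemma integrable_PiM_split:
  assumes f [measurable]: "(f :: _ \<Rightarrow> real) \<in> borel_measurable (PiM {..<n} M)" and i: "i < n"
    and b: "\<And>z. \<bar>f z\<bar> \<le> c"
  shows "integrable (PiM ({..<n} - {i}) M) (\<lambda>x. \<integral>w. f (x(i := w)) \<partial>M i)"
proof -
  interpret P: prob_space "PiM ({..<n} - {i}) M" by (intro prob_space_PiM prob)
  have eq: "insert i ({..<n} - {i}) = {..<n}" using i by auto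
  have upd: "(\<lambda>(x, y). x(i := y)) \<in> measurable (PiM ({..<n} - {i}) M \<Otimes>\<^sub>M M i) (PiM {..<n} M)"
    using measurable_add_dim[of i "{..<n} - {i}" M] unfolding eq .
  have "(\<lambda>(x, w). f (x(i := w))) \<in> borel_measurable (PiM ({..<n} - {i}) M \<Otimes>\<^sub>M M i)"
    using measurable_comp[OF upd f] by (simp add: comp_def case_prod_beta')
  then have [measurable]: "case_prod (\<lambda>x w. f (x(i := w))) \<in> borel_measurable (PiM ({..<n} - {i}) M \<Otimes>\<^sub>M M i)"
    by simp
  have m: "(\<lambda>x. \<integral>w. f (x(i := w)) \<partial>M i) \<in> borel_measurable (PiM ({..<n} - {i}) M)"
    by measurable
  have c0: "0 \<le> c" using b[of undefined] by simp
  have "\<bar>\<integral>w. f (x(i := w)) \<partial>M i\<bar> \<le> c" for x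
  proof -
    have "\<bar>\<integral>w. f (x(i := w)) \<partial>M i\<bar> \<le> (\<integral>w. \<bar>f (x(i := w))\<bar> \<partial>M i)" by (rule integral_abs_bound)
    also have "\<dots> \<le> (\<integral>w. c \<partial>M i)" using b c0 by (intro Bochner_Integration.integral_mono') auto
    finally show ?thesis by (simp add: prob_space.prob_space[OF prob])
  qed
  then show ?thesis using m by (intro P.integrable_const_bound[where B=c]) auto
qed

end

text \<open>The rows \<open>a j\<close> have Euclidean norm 1, so each linear form has variance 1
  under standardized noise. In the application \<eta> is B / sqrt n, and \<kappa> <= \<beta> serves
  both the third-derivative bound and anti-concentration.\<close>

locale soft_max_design = soft_max J \<beta> for J :: "'j set" and \<beta> :: real +
  fixes a :: "'j \<Rightarrow> nat \<Rightarrow> real" and n :: nat and \<kappa> \<eta> :: real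
  assumes \<kappa>: "0 < \<kappa>" "\<kappa> \<le> \<beta>" and \<eta>: "0 \<le> \<eta>"
    and entries: "\<And>j i. j \<in> J \<Longrightarrow> i < n \<Longrightarrow> \<bar>a j i\<bar> \<le> \<eta>"
    and unit: "\<And>j. j \<in> J \<Longrightarrow> (\<Sum>i<n. (a j i)\<^sup>2) = 1"
begin

definition lin :: "(nat \<Rightarrow> real) \<Rightarrow> 'j \<Rightarrow> real" where
  "lin z j = (\<Sum>i<n. a j i * z i)"

lemma lin_upd: "i < n \<Longrightarrow> lin (z(i := w)) = (\<lambda>j. lin (z(i := 0)) j + w * a j i)"
proof
  fix j assume i: "i < n"
  have "lin (z(i := w)) j = a j i * w + (\<Sum>k\<in>{..<n} - {i}. a j k * z k)" for w
    using i by (simp add: lin_def sum.remove[of "{..<n}" i])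
  from this[of w] this[of 0] show "lin (z(i := w)) j = lin (z(i := 0)) j + w * a j i" by simp
qed

lemma measurable_lin [measurable]: "(\<lambda>z. lin z j) \<in> borel_measurable (PiM {..<n} (\<lambda>_. borel))"
  unfolding lin_def by measurable

lemma measurable_gibbs_lin [measurable]:
  "(\<lambda>z. gibbs \<beta> J (lin z) q) \<in> borel_measurable (PiM {..<n} (\<lambda>_. borel))"
  unfolding gibbs_def by measurable

abbreviation step :: "real \<Rightarrow> (nat \<Rightarrow> real) \<Rightarrow> real" where
  "step t z \<equiv> smooth_step \<kappa> t \<beta> J (lin z)"

lemma measurable_step [measurable]: "step t \<in> borel_measurable (PiM {..<n} (\<lambda>_. borel))"
  unfolding smooth_step_def logistic_def lse_def by measurable

lemma step_bounds: "0 < step t z" "step t z < 1"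
  by (simp_all add: smooth_step_def logistic_pos logistic_less_1)

lemma abs_step_le: "\<bar>step t z\<bar> \<le> 1"
  using step_bounds[of t z] by simp

lemma gibbs_cube_abs_le:
  assumes "i < n"
  shows "\<bar>gibbs \<beta> J u (\<lambda>j. \<bar>a j i\<bar> ^ 3)\<bar> \<le> \<eta> ^ 3"
  using assms entries by (intro gibbs_bound) (auto intro!: power_mono)

text \<open>|a|^3 <= \<eta> a^2 and the rows have norm 1, so every index \<open>j\<close> satisfies
  the bound before averaging. Being pointwise in \<open>u\<close>, it survives integration against
  any hybrid law and is the budget handed to \<open>greedy_exchange\<close>.\<close>

lemma sum_gibbs_cube_le: "(\<Sum>i<n. gibbs \<beta> J u (\<lambda>j. \<bar>a j i\<bar> ^ 3)) \<le> \<eta>"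
proof -
  have "(\<Sum>i<n. \<bar>a j i\<bar> ^ 3) \<le> \<eta>" if "j \<in> J" for j
  proof -
    have "(\<Sum>i<n. \<bar>a j i\<bar> ^ 3) \<le> (\<Sum>i<n. \<eta> * (a j i)\<^sup>2)"
    proof (rule sum_mono)
      fix i assume "i \<in> {..<n}"
      then have "\<bar>a j i\<bar> * (a j i)\<^sup>2 \<le> \<eta> * (a j i)\<^sup>2"
        using entries[OF that] by (intro mult_right_mono) auto
      then show "\<bar>a j i\<bar> ^ 3 \<le> \<eta> * (a j i)\<^sup>2" by (simp add: power3_eq_cube power2_eq_square mult_ac)
    qed
    then show ?thesis using unit[OF that] by (simp add: sum_distrib_left[symmetric])
  qed
  then have "gibbs \<beta> J u (\<lambda>j. \<Sum>i<n. \<bar>a j i\<bar> ^ 3) \<le> gibbs \<beta> J u (\<lambda>_. \<eta>)" by (intro gibbs_mono)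
  then show ?thesis by (simp add: gibbs_sum gibbs_const)
qed

text \<open>The set \<open>A\<close> holds the coordinates already exchanged. A coordinate about to
  be exchanged is therefore still normal, which fixes the law in the cost bound of
  \<open>swap_coordinate\<close>.\<close>

definition hybrid :: "real measure \<Rightarrow> nat set \<Rightarrow> nat \<Rightarrow> real measure" where
  "hybrid \<rho> A i = (if i \<in> A then \<rho> else std_normal)"

context
  fixes \<rho> :: "real measure" and r :: real
  assumes noise: "std_noise \<rho> r" and small: "2 * \<beta> * \<eta> \<le> r"
begin

interpretation \<rho>: std_noise \<rho> r by (rule noise)

private lemma hybrid: "prob_space (hybrid \<rho> A k)" "sets (hybrid \<rho> A k) = sets borel"
  by (auto simp: hybrid_def \<rho>.prob_space_axioms std_normal.prob_space_axioms)

private abbreviation "damping \<equiv> (\<integral>w. exp (- (r * \<bar>w\<bar>)) \<partial>std_normal)"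

private lemma damping_integrable: "integrable std_normal (\<lambda>w. exp (- (r * \<bar>w\<bar>)))"
  by (rule std_normal.integrable_const_bound[where B=1]) (use \<rho>.r_nonneg in auto)

lemma damping_pos: "damping > 0"
proof -
  have "0 \<le> damping" by (rule integral_nonneg_AE) simp
  moreover have "damping \<noteq> 0"
  proof
    assume "damping = 0"
    then have "AE w in std_normal. exp (- (r * \<bar>w\<bar>)) = 0"
      using damping_integrable by (subst (asm) integral_nonneg_eq_0_iff_AE) auto
    then have "AE w in std_normal. False" by simp
    then show False by simp
  qed
  ultimately show ?thesis by linarith
qed

private definition "swap_const = \<kappa> * \<beta>\<^sup>2 * (exp_cube_moment \<rho> r + exp_cube_moment std_normal r) / damping"

text \<open>The quadratic Taylor parts agree under both laws, so only remainders are left. They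
  carry the Gibbs weight with coordinate \<open>i\<close> set to 0; \<open>gibbs_shift\<close>
  bounds this weight times \<open>damping\<close> by its mean over a normal coordinate. The cost
  thereby becomes an expectation under the current hybrid law, the form in which costs can be summed
  over \<open>i\<close>.\<close>

lemma swap_coordinate:
  fixes x :: "nat \<Rightarrow> real"
  assumes i: "i < n"
  shows "\<bar>(\<integral>w. step t (x(i := w)) \<partial>\<rho>) - (\<integral>w. step t (x(i := w)) \<partial>std_normal)\<bar>
    \<le> swap_const * (\<integral>w. gibbs \<beta> J (lin (x(i := w))) (\<lambda>j. \<bar>a j i\<bar> ^ 3) \<partial>std_normal)"
proof -
  interpret N: std_noise std_normal r by (rule std_noise_normal[OF \<rho>.r_nonneg])
  define u where "u = lin (x(i := 0))"
  define G where "G = gibbs \<beta> J u (\<lambda>j. \<bar>a j i\<bar> ^ 3)"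
  let ?f = "\<lambda>w. smooth_step \<kappa> t \<beta> J (\<lambda>j. u j + w * a j i)"
  let ?g = "\<lambda>w. gibbs \<beta> J (\<lambda>j. u j + w * a j i) (\<lambda>j. \<bar>a j i\<bar> ^ 3)"
  have G0: "0 \<le> G" unfolding G_def by (rule gibbs_nonneg) auto
  have \<kappa>': "0 \<le> \<kappa>" using \<kappa> by simp
  obtain c1 c2 where c: "\<And>w. \<bar>?f w - (smooth_step \<kappa> t \<beta> J u + c1 * w + c2 * w\<^sup>2)\<bar>
       \<le> \<kappa> * \<beta>\<^sup>2 * G * (\<bar>w\<bar> ^ 3 * exp (2 * \<beta> * \<eta> * \<bar>w\<bar>))"
    using smooth_step_taylor[OF \<kappa>' \<kappa>(2), where v="\<lambda>j. a j i" and u=u and t=t and \<eta>=\<eta>] entries i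
    unfolding G_def by blast
  have c': "\<bar>?f w - (smooth_step \<kappa> t \<beta> J u + c1 * w + c2 * w\<^sup>2)\<bar>
       \<le> \<kappa> * \<beta>\<^sup>2 * G * (\<bar>w\<bar> ^ 3 * exp (r * \<bar>w\<bar>))" for w
    using small G0 \<kappa> by (intro order_trans[OF c] mult_left_mono) (auto intro!: mult_right_mono)
  have [measurable]: "?f \<in> borel_measurable borel"
    unfolding smooth_step_def logistic_def lse_def by measurable
  have [measurable]: "?g \<in> borel_measurable borel"
    unfolding gibbs_def by measurable
  have "\<bar>(\<integral>w. ?f w \<partial>\<rho>) - (\<integral>w. ?f w \<partial>std_normal)\<bar>
      \<le> \<kappa> * \<beta>\<^sup>2 * G * exp_cube_moment \<rho> r + \<kappa> * \<beta>\<^sup>2 * G * exp_cube_moment std_normal r"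
    using \<rho>.integral_quadratic_approx[OF _ c'] N.integral_quadratic_approx[OF _ c'] by force
  also have "\<dots> = swap_const * (G * damping)"
    using damping_pos by (simp add: swap_const_def field_simps)
  also have "\<dots> \<le> swap_const * (\<integral>w. ?g w \<partial>std_normal)"
  proof (rule mult_left_mono)
    have "G * damping = (\<integral>w. G * exp (- (r * \<bar>w\<bar>)) \<partial>std_normal)" by simp
    also have "\<dots> \<le> (\<integral>w. ?g w \<partial>std_normal)"
    proof (rule integral_mono)
      show "integrable std_normal (\<lambda>w. G * exp (- (r * \<bar>w\<bar>)))" using damping_integrable by simp
      show "integrable std_normal ?g"
        by (rule std_normal.integrable_const_bound[where B="\<eta>^3"]) (use gibbs_cube_abs_le[OF i] in auto)
      fix w :: real
      have "G \<le> exp (2 * \<beta> * (\<eta> * \<bar>w\<bar>)) * ?g w" unfolding G_def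
        using entries i by (intro gibbs_shift) (auto simp: abs_mult mult.commute[of \<eta>] intro!: mult_left_mono)
      also have "\<dots> \<le> exp (r * \<bar>w\<bar>) * ?g w"
        using mult_right_mono[OF small, of "\<bar>w\<bar>"] by (intro mult_right_mono gibbs_nonneg) (auto simp: mult.assoc)
      finally show "G * exp (- (r * \<bar>w\<bar>)) \<le> ?g w" by (simp add: exp_minus field_simps)
    qed
    finally show "G * damping \<le> (\<integral>w. ?g w \<partial>std_normal)" .
    show "0 \<le> swap_const"
      unfolding swap_const_def exp_cube_moment_def using \<kappa> damping_pos by (auto intro!: divide_nonneg_pos mult_nonneg_nonneg)
  qed
  finally show ?thesis unfolding u_def lin_upd[OF i, symmetric] .
qed

text \<open>The laws of the coordinates other than \<open>i\<close> coincide before and after the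
  exchange, so \<open>swap_coordinate\<close> can be integrated over them.\<close>

private lemma hybrid_exchange:
  assumes i: "i \<in> {..<n} - A"
  shows "\<bar>(\<integral>z. step t z \<partial>PiM {..<n} (hybrid \<rho> (insert i A))) - (\<integral>z. step t z \<partial>PiM {..<n} (hybrid \<rho> A))\<bar>
    \<le> swap_const * (\<integral>z. gibbs \<beta> J (lin z) (\<lambda>j. \<bar>a j i\<bar> ^ 3) \<partial>PiM {..<n} (hybrid \<rho> A))"
proof -
  let ?I = "{..<n} - {i}"
  let ?g = "\<lambda>z. gibbs \<beta> J (lin z) (\<lambda>j. \<bar>a j i\<bar> ^ 3)"
  have i': "i < n" using i by simp
  have m: "f \<in> borel_measurable (PiM {..<n} (hybrid \<rho> B))" if "f \<in> borel_measurable (PiM {..<n} (\<lambda>_. borel))"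
    for f :: "_ \<Rightarrow> real" and B
    by (rule iffD2[OF measurable_PiM_borel_iff[OF hybrid] that])
  have int: "integrable (PiM {..<n} (hybrid \<rho> B)) f" 
    if "f \<in> borel_measurable (PiM {..<n} (\<lambda>_. borel))" "\<And>z. \<bar>f z\<bar> \<le> c" for f :: "_ \<Rightarrow> real" and B c
  proof -
    interpret P: prob_space "PiM {..<n} (hybrid \<rho> B)" by (intro prob_space_PiM hybrid)
    show ?thesis using that(2) by (intro P.integrable_const_bound[where B=c] m that(1)) auto
  qed
  have PiM_eq: "PiM ?I (hybrid \<rho> (insert i A)) = PiM ?I (hybrid \<rho> A)"
    by (intro PiM_cong) (auto simp: hybrid_def)
  have hi: "hybrid \<rho> A i = std_normal" "hybrid \<rho> (insert i A) i = \<rho>"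
    using i by (auto simp: hybrid_def)
  note int_step = int[OF measurable_step abs_step_le]
  note int_g = int[OF measurable_gibbs_lin gibbs_cube_abs_le[OF i']]
  have 1: "integrable (PiM ?I (hybrid \<rho> A)) (\<lambda>x. \<integral>w. step t (x(i := w)) \<partial>\<rho>)"
    using integrable_PiM_split[of "hybrid \<rho> (insert i A)", OF hybrid m[OF measurable_step] i' abs_step_le]
    unfolding PiM_eq hi .
  have 2: "integrable (PiM ?I (hybrid \<rho> A)) (\<lambda>x. \<integral>w. step t (x(i := w)) \<partial>std_normal)"
    using integrable_PiM_split[of "hybrid \<rho> A", OF hybrid m[OF measurable_step] i' abs_step_le]
    unfolding hi .
  have 3: "integrable (PiM ?I (hybrid \<rho> A)) (\<lambda>x. \<integral>w. ?g (x(i := w)) \<partial>std_normal)"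
    using integrable_PiM_split[of "hybrid \<rho> A", OF hybrid m[OF measurable_gibbs_lin] i' gibbs_cube_abs_le[OF i']]
    unfolding hi .
  have "(\<integral>z. step t z \<partial>PiM {..<n} (hybrid \<rho> (insert i A))) - (\<integral>z. step t z \<partial>PiM {..<n} (hybrid \<rho> A))
    = (\<integral>x. (\<integral>w. step t (x(i := w)) \<partial>\<rho>) \<partial>PiM ?I (hybrid \<rho> A))
    - (\<integral>x. (\<integral>w. step t (x(i := w)) \<partial>std_normal) \<partial>PiM ?I (hybrid \<rho> A))"
    using integral_PiM_split[of "hybrid \<rho> A", OF hybrid int_step i']
      integral_PiM_split[of "hybrid \<rho> (insert i A)", OF hybrid int_step i']
    unfolding hi PiM_eq by (simp only:)
  also have "\<dots> = (\<integral>x. (\<integral>w. step t (x(i := w)) \<partial>\<rho>) - (\<integral>w. step t (x(i := w)) \<partial>std_normal) \<partial>PiM ?I (hybrid \<rho> A))"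
    by (rule Bochner_Integration.integral_diff[symmetric, OF 1 2])
  finally have "\<bar>(\<integral>z. step t z \<partial>PiM {..<n} (hybrid \<rho> (insert i A))) - (\<integral>z. step t z \<partial>PiM {..<n} (hybrid \<rho> A))\<bar>
    = \<bar>\<integral>x. (\<integral>w. step t (x(i := w)) \<partial>\<rho>) - (\<integral>w. step t (x(i := w)) \<partial>std_normal) \<partial>PiM ?I (hybrid \<rho> A)\<bar>"
    by (rule arg_cong)
  also have "\<dots> \<le> (\<integral>x. \<bar>(\<integral>w. step t (x(i := w)) \<partial>\<rho>) - (\<integral>w. step t (x(i := w)) \<partial>std_normal)\<bar> \<partial>PiM ?I (hybrid \<rho> A))"
    by (rule integral_abs_bound)
  also have "\<dots> \<le> (\<integral>x. swap_const * (\<integral>w. ?g (x(i := w)) \<partial>std_normal) \<partial>PiM ?I (hybrid \<rho> A))"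
    by (rule integral_mono[OF integrable_abs[OF Bochner_Integration.integrable_diff[OF 1 2]]
        integrable_mult_right[OF 3] swap_coordinate[OF i']])
  also have "\<dots> = swap_const * (\<integral>z. ?g z \<partial>PiM {..<n} (hybrid \<rho> A))"
    using integral_PiM_split[of "hybrid \<rho> A", OF hybrid int_g i']
    unfolding hi by (simp only: integral_mult_right_zero)
  finally show ?thesis .
qed

text \<open>The quotient in front depends on the noise law and \<open>r\<close> only, not on the
  sample size, the index set or the design; hence \<beta>, \<kappa> and \<eta> may vary with
  n.\<close>

theorem lindeberg_soft_max:
  "\<bar>(\<integral>z. step t z \<partial>PiM {..<n} (\<lambda>_. \<rho>)) - (\<integral>z. step t z \<partial>PiM {..<n} (\<lambda>_. std_normal))\<bar>
   \<le> (exp_cube_moment \<rho> r + exp_cube_moment std_normal r) / (\<integral>w. exp (- (r * \<bar>w\<bar>)) \<partial>std_normal)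
     * (\<kappa> * \<beta>\<^sup>2 * \<eta> * harm n)"
proof -
  let ?\<Phi> = "\<lambda>A. \<integral>z. step t z \<partial>PiM {..<n} (hybrid \<rho> A)"
  let ?Q = "\<lambda>i A. \<integral>z. gibbs \<beta> J (lin z) (\<lambda>j. \<bar>a j i\<bar> ^ 3) \<partial>PiM {..<n} (hybrid \<rho> A)"
  have "\<bar>?\<Phi> {..<n} - ?\<Phi> {}\<bar> \<le> swap_const * \<eta> * harm (card ({..<n} - {}))"
  proof (rule greedy_exchange[where Q="?Q"])
    show "0 \<le> swap_const"
      unfolding swap_const_def exp_cube_moment_def using \<kappa> damping_pos by (auto intro!: divide_nonneg_pos mult_nonneg_nonneg)
  next
    fix A assume A: "A \<subseteq> {..<n}"
    interpret P: prob_space "PiM {..<n} (hybrid \<rho> A)" by (intro prob_space_PiM hybrid)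
    have int: "integrable (PiM {..<n} (hybrid \<rho> A)) (\<lambda>z. gibbs \<beta> J (lin z) (\<lambda>j. \<bar>a j i\<bar> ^ 3))" if "i < n" for i
      using gibbs_cube_abs_le[OF that]
      by (intro P.integrable_const_bound[where B="\<eta>^3"]
          iffD2[OF measurable_PiM_borel_iff[OF hybrid] measurable_gibbs_lin]) auto
    have "(\<Sum>i\<in>{..<n} - A. ?Q i A) \<le> (\<Sum>i<n. ?Q i A)"
      using A by (intro sum_mono2) (auto intro!: integral_nonneg_AE gibbs_nonneg)
    also have "\<dots> = (\<integral>z. (\<Sum>i<n. gibbs \<beta> J (lin z) (\<lambda>j. \<bar>a j i\<bar> ^ 3)) \<partial>PiM {..<n} (hybrid \<rho> A))"
      using int by (intro Bochner_Integration.integral_sum[symmetric]) auto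
    also have "\<dots> \<le> (\<integral>z. \<eta> \<partial>PiM {..<n} (hybrid \<rho> A))"
      using int sum_gibbs_cube_le by (intro integral_mono) auto
    finally show "(\<Sum>i\<in>{..<n} - A. ?Q i A) \<le> \<eta>" by (simp add: P.prob_space)
  qed (use \<eta> hybrid_exchange in auto)
  moreover have "PiM {..<n} (hybrid \<rho> {..<n}) = PiM {..<n} (\<lambda>_. \<rho>)" "hybrid \<rho> {} = (\<lambda>_. std_normal)"
    by (auto intro!: PiM_cong simp: hybrid_def fun_eq_iff)
  ultimately show ?thesis by (simp add: swap_const_def algebra_simps)
qed

end
end

section \<open>Anti-concentration and Gaussian comparison of maxima\<close>

context soft_max_design
begin

abbreviation gauss :: "(nat \<Rightarrow> real) measure" where
  "gauss \<equiv> PiM {..<n} (\<lambda>_. std_normal)"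

interpretation gauss: prob_space gauss
  by (intro prob_space_PiM std_normal.prob_space_axioms)

lemma measurable_gauss [measurable_cong]: "sets gauss = sets (PiM {..<n} (\<lambda>_. borel :: real measure))"
  by (intro sets_PiM_cong) auto

lemma measurable_gauss_step [measurable]: "step t \<in> borel_measurable gauss"
  unfolding measurable_cong_sets[OF measurable_gauss refl] by measurable

lemma measurable_gauss_gibbs [measurable]: "(\<lambda>z. gibbs \<beta> J (lin z) q) \<in> borel_measurable gauss"
  unfolding measurable_cong_sets[OF measurable_gauss refl] by measurable

lemma measurable_gauss_component [measurable]: "i < n \<Longrightarrow> (\<lambda>z. z i) \<in> borel_measurable gauss"
  unfolding measurable_cong_sets[OF measurable_gauss refl] by (intro measurable_component_singleton) simp

lemma integrable_gauss_component:
  assumes "i < n" "integrable std_normal f"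
  shows "integrable gauss (\<lambda>z. f (z i) :: real)"
proof -
  have "integrable (distr gauss std_normal (\<lambda>z. z i)) f"
    using distr_PiM_component[of "{..<n}" "\<lambda>_. std_normal" i] std_normal.prob_space_axioms assms by simp
  moreover have "(\<lambda>z. z i) \<in> measurable gauss std_normal"
    using assms(1) by (intro measurable_component_singleton) simp
  ultimately show ?thesis by (subst (asm) integrable_distr_eq) (use assms in auto)
qed

abbreviation col_mean :: "nat \<Rightarrow> (nat \<Rightarrow> real) \<Rightarrow> real" where
  "col_mean i z \<equiv> gibbs \<beta> J (lin z) (\<lambda>j. a j i)"

abbreviation col_sq :: "nat \<Rightarrow> (nat \<Rightarrow> real) \<Rightarrow> real" where
  "col_sq i z \<equiv> gibbs \<beta> J (lin z) (\<lambda>j. (a j i)\<^sup>2)"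

text \<open>Stein's identity in coordinate \<open>i\<close> with the others frozen, for the smoothed
  indicator times the partial derivative \<open>col_mean i\<close> of the soft maximum.
  Differentiating the first factor gives the \<kappa> term, the second the Gibbs variance of the
  column.\<close>

lemma stein_column:
  assumes i: "i < n"
  shows "(\<integral>z. z i * (step t z * col_mean i z) \<partial>gauss)
    = (\<integral>z. \<kappa> * (step t z * (1 - step t z)) * (col_mean i z)\<^sup>2
          + \<beta> * (step t z * (col_sq i z - (col_mean i z)\<^sup>2)) \<partial>gauss)"
    (is "_ = (\<integral>z. ?d z \<partial>gauss)")
    and "integrable gauss (\<lambda>z. z i * (step t z * col_mean i z))"
    and "integrable gauss (\<lambda>z. \<kappa> * (step t z * (1 - step t z)) * (col_mean i z)\<^sup>2
          + \<beta> * (step t z * (col_sq i z - (col_mean i z)\<^sup>2)))"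
proof -
  have \<kappa>0: "0 \<le> \<kappa>" using \<kappa> by simp
  note prob_sets = std_normal.prob_space_axioms sets_density[of lborel "\<lambda>x. ennreal (std_normal_density x)", unfolded sets_lborel]
  have m: "\<bar>gibbs \<beta> J u (\<lambda>j. a j i)\<bar> \<le> \<eta>" for u
    using entries i by (intro gibbs_bound) auto
  have q: "\<bar>gibbs \<beta> J u (\<lambda>j. (a j i)\<^sup>2)\<bar> \<le> \<eta>\<^sup>2" for u
    using entries i power_mono[of "\<bar>a _ i\<bar>" \<eta> 2] by (intro gibbs_bound) auto
  have m2: "(gibbs \<beta> J u (\<lambda>j. a j i))\<^sup>2 \<le> \<eta>\<^sup>2" for u
    using power_mono[OF m[of u], of 2] by simp
  have hb: "\<bar>y * g\<bar> \<le> \<eta>" if "0 < y" "y < 1" "\<bar>g\<bar> \<le> \<eta>" for y g :: real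
    using that mult_mono[of y 1 "\<bar>g\<bar>" \<eta>] by (simp add: abs_mult)
  have db: "\<bar>\<kappa> * (y * (1 - y)) * g\<^sup>2 + \<beta> * (y * (g2 - g\<^sup>2))\<bar> \<le> \<kappa> * \<eta>\<^sup>2 + \<beta> * (2 * \<eta>\<^sup>2)"
    if y: "0 < y" "y < 1" and g: "g\<^sup>2 \<le> \<eta>\<^sup>2" "\<bar>g2\<bar> \<le> \<eta>\<^sup>2" for y g g2 :: real
  proof (rule order_trans[OF abs_triangle_ineq add_mono])
    have "\<bar>\<kappa> * (y * (1 - y)) * g\<^sup>2\<bar> = \<kappa> * ((y * (1 - y)) * g\<^sup>2)" using y \<kappa> by (simp add: abs_mult)
    also have "\<dots> \<le> \<kappa> * (1 * \<eta>\<^sup>2)" using y g \<kappa> mult_mono[of y 1 "1 - y" 1] 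
      by (intro mult_left_mono mult_mono) auto
    finally show "\<bar>\<kappa> * (y * (1 - y)) * g\<^sup>2\<bar> \<le> \<kappa> * \<eta>\<^sup>2" by simp
    have g3: "\<bar>g2 - g\<^sup>2\<bar> \<le> 2 * \<eta>\<^sup>2" using g zero_le_power2[of g] by linarith
    have "\<bar>\<beta> * (y * (g2 - g\<^sup>2))\<bar> = \<beta> * (y * \<bar>g2 - g\<^sup>2\<bar>)" using y \<beta>_pos by (simp add: abs_mult)
    also have "\<dots> \<le> \<beta> * (1 * (2 * \<eta>\<^sup>2))"
      using y g3 \<beta>_pos by (intro mult_left_mono mult_mono) auto
    finally show "\<bar>\<beta> * (y * (g2 - g\<^sup>2))\<bar> \<le> \<beta> * (2 * \<eta>\<^sup>2)" by simp
  qed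
  show int1: "integrable gauss (\<lambda>z. z i * (step t z * col_mean i z))"
  proof (rule Bochner_Integration.integrable_bound[where f="\<lambda>z. \<bar>z i\<bar> * \<eta>"])
    interpret N: std_noise std_normal 0 by (rule std_noise_normal) simp
    show "integrable gauss (\<lambda>z. \<bar>z i\<bar> * \<eta>)"
      using integrable_gauss_component[OF i, of "\<lambda>w. w"] N.integrable_power[of 1] by simp
    show "AE z in gauss. norm (z i * (step t z * col_mean i z)) \<le> norm (\<bar>z i\<bar> * \<eta>)"
      unfolding real_norm_def abs_mult[of "_ i"] using hb[OF step_bounds m] \<eta>
      by (intro AE_I2) (auto simp: abs_mult intro!: mult_left_mono)
    show "(\<lambda>z. z i * (step t z * col_mean i z)) \<in> borel_measurable gauss"
      using i by measurable
  qed
  show int2: "integrable gauss ?d"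
  proof (rule gauss.integrable_const_bound[where B="\<kappa> * \<eta>\<^sup>2 + \<beta> * (2 * \<eta>\<^sup>2)"])
    show "AE z in gauss. norm (?d z) \<le> \<kappa> * \<eta>\<^sup>2 + \<beta> * (2 * \<eta>\<^sup>2)"
      unfolding real_norm_def by (intro AE_I2 db step_bounds m2 q)
  qed measurable
  have "(\<integral>w. (x(i := w)) i * (step t (x(i := w)) * col_mean i (x(i := w))) \<partial>std_normal)
      = (\<integral>w. ?d (x(i := w)) \<partial>std_normal)" for x :: "nat \<Rightarrow> real"
  proof -
    define u where "u = lin (x(i := 0))"
    let ?y = "\<lambda>w. smooth_step \<kappa> t \<beta> J (\<lambda>j. u j + w * a j i)"
    let ?g = "\<lambda>q w. gibbs \<beta> J (\<lambda>j. u j + w * a j i) q"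
    let ?m = "?g (\<lambda>j. a j i)"
    let ?s = "?g (\<lambda>j. (a j i)\<^sup>2)"
    have y: "0 < ?y w" "?y w < 1" for w
      by (simp_all add: smooth_step_def logistic_pos logistic_less_1)
    have dy: "(?y has_real_derivative \<kappa> * (?y w * (1 - ?y w)) * ?m w) (at w)" for w
      by (rule DERIV_smooth_step[OF \<kappa>0 \<kappa>(2)])
    have dg: "(?g q has_real_derivative \<beta> * (?g (\<lambda>j. q j * a j i) w - ?g q w * ?m w)) (at w)" for q w
      by (rule DERIV_gibbs)
    have cy: "continuous_on UNIV ?y" by (rule DERIV_continuous_on[OF has_field_derivative_at_within[OF dy]])
    have cg: "continuous_on UNIV (?g q)" for q by (rule DERIV_continuous_on[OF has_field_derivative_at_within[OF dg]])
    have "(\<integral>w. w * (?y w * ?m w) \<partial>std_normal) =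
       (\<integral>w. \<kappa> * (?y w * (1 - ?y w)) * (?m w)\<^sup>2 + \<beta> * (?y w * (?s w - (?m w)\<^sup>2)) \<partial>std_normal)"
    proof (rule std_normal_stein)
      show "((\<lambda>w. ?y w * ?m w) has_real_derivative \<kappa> * (?y w * (1 - ?y w)) * (?m w)\<^sup>2 + \<beta> * (?y w * (?s w - (?m w)\<^sup>2))) (at w)" for w
        by (rule DERIV_cong[OF DERIV_mult[OF dy dg]]) (simp add: power2_eq_square algebra_simps)
      show "continuous_on UNIV (\<lambda>w. \<kappa> * (?y w * (1 - ?y w)) * (?m w)\<^sup>2 + \<beta> * (?y w * (?s w - (?m w)\<^sup>2)))"
        by (intro continuous_intros cy cg)
      show "\<bar>?y w * ?m w\<bar> \<le> \<eta>" for w by (rule hb[OF y m])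
      show "\<bar>\<kappa> * (?y w * (1 - ?y w)) * (?m w)\<^sup>2 + \<beta> * (?y w * (?s w - (?m w)\<^sup>2))\<bar> \<le> \<kappa> * \<eta>\<^sup>2 + \<beta> * (2 * \<eta>\<^sup>2)" for w
        by (rule db[OF y m2 q])
    qed
    then show ?thesis unfolding u_def lin_upd[OF i, symmetric] fun_upd_same .
  qed
  note inner = this
  note A = integral_PiM_split[of "\<lambda>_. std_normal", OF prob_sets int1 i]
  note B = integral_PiM_split[of "\<lambda>_. std_normal", OF prob_sets int2 i]
  show "(\<integral>z. z i * (step t z * col_mean i z) \<partial>gauss) = (\<integral>z. ?d z \<partial>gauss)"
    by (rule trans[OF A trans[OF Bochner_Integration.integral_cong[OF refl inner] B[symmetric]]])
qed

text \<open>The bound \<open>s * x \<le> l - 1 + exp (s * x - l)\<close> turns the exponential moments into a bound for the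
  maximum that needs no concavity argument.\<close>

definition max_bound :: "(nat \<Rightarrow> real) \<Rightarrow> real" where
  "max_bound z = (let L = 1 + ln (card J); s = sqrt L; l = L + s\<^sup>2 / 2
     in (l - 1 + exp (- l) * (\<Sum>j\<in>J. exp (s * lin z j))) / s)"

abbreviation max_scale :: real where
  "max_scale \<equiv> 3 / 2 * sqrt (1 + ln (card J))"

lemma card_J: "1 \<le> real (card J)" "0 \<le> ln (real (card J))"
proof -
  have "0 < card J" using fin ne by (simp add: card_gt_0_iff)
  then show "1 \<le> real (card J)" by linarith
  then show "0 \<le> ln (real (card J))" by simp
qed

lemma lin_le_max_bound: "j \<in> J \<Longrightarrow> lin z j \<le> max_bound z"
proof -
  define L s l where "L = 1 + ln (card J)" and "s = sqrt L" and "l = L + s\<^sup>2 / 2"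
  assume j: "j \<in> J"
  have s: "s > 0" using card_J(2) unfolding s_def L_def real_sqrt_gt_0_iff by linarith
  have "s * lin z j \<le> l - 1 + exp (s * lin z j - l)"
    using exp_ge_add_one_self[of "s * lin z j - l"] by linarith
  also have "exp (s * lin z j - l) = exp (- l) * exp (s * lin z j)" by (simp add: exp_add[symmetric])
  also have "\<dots> \<le> exp (- l) * (\<Sum>j\<in>J. exp (s * lin z j))"
    using j fin by (intro mult_left_mono member_le_sum) auto
  finally have "lin z j * s \<le> l - 1 + exp (- l) * (\<Sum>j\<in>J. exp (s * lin z j))" by (simp add: mult.commute)
  then show ?thesis
    unfolding max_bound_def Let_def L_def[symmetric] s_def[symmetric] l_def[symmetric] pos_le_divide_eq[OF s] .
qed

lemma max_bound_nonneg: "0 \<le> max_bound z"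
  using card_J by (auto simp: max_bound_def Let_def intro!: divide_nonneg_nonneg add_nonneg_nonneg mult_nonneg_nonneg sum_nonneg)

lemma gauss_lin_mgf:
  assumes j: "j \<in> J"
  shows "has_bochner_integral gauss (\<lambda>z. exp (s * lin z j)) (exp (s\<^sup>2 / 2))"
proof -
  interpret N: product_prob_space "\<lambda>_::nat. std_normal"
    by (rule product_prob_spaceI) (rule std_normal.prob_space_axioms)
  have eq: "exp (s * lin z j) = (\<Prod>i<n. exp ((s * a j i) * z i))" for z
    by (simp add: lin_def exp_sum[symmetric] sum_distrib_left mult.assoc)
  have int: "integrable std_normal (\<lambda>w. exp (c * w))" "(\<integral>w. exp (c * w) \<partial>std_normal) = exp (c\<^sup>2 / 2)" for c
    using std_normal_mgf[of c] by (auto simp: has_bochner_integral_iff)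
  have "(\<Prod>i<n. exp ((s * a j i)\<^sup>2 / 2)) = exp (\<Sum>i<n. s\<^sup>2 / 2 * (a j i)\<^sup>2)"
    by (simp add: exp_sum power_mult_distrib mult.commute)
  also have "\<dots> = exp (s\<^sup>2 / 2)" by (simp add: sum_distrib_left[symmetric] sum_divide_distrib[symmetric] unit[OF j])
  finally show ?thesis unfolding eq has_bochner_integral_iff
    using N.product_integrable_prod[of "{..<n}" "\<lambda>i w. exp ((s * a j i) * w)"]
      N.product_integral_prod[of "{..<n}" "\<lambda>i w. exp ((s * a j i) * w)"] int by simp
qed

lemma integral_max_bound: "integrable gauss max_bound" "(\<integral>z. max_bound z \<partial>gauss) \<le> max_scale"
proof -
  define L s l where "L = 1 + ln (card J)" and "s = sqrt L" and "l = L + s\<^sup>2 / 2"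
  have L: "L \<ge> 1" using card_J by (simp add: L_def)
  have s: "s > 0" "s\<^sup>2 = L" using L by (auto simp: s_def)
  have mb: "max_bound = (\<lambda>z. (l - 1 + exp (- l) * (\<Sum>j\<in>J. exp (s * lin z j))) / s)"
    unfolding fun_eq_iff max_bound_def Let_def L_def[symmetric] s_def[symmetric] l_def[symmetric] by simp
  have S: "has_bochner_integral gauss (\<lambda>z. \<Sum>j\<in>J. exp (s * lin z j)) (\<Sum>j\<in>J. exp (s\<^sup>2 / 2))"
    by (intro has_bochner_integral_sum gauss_lin_mgf)
  show "integrable gauss max_bound" using S unfolding mb by (auto simp: has_bochner_integral_iff)
  have "(\<integral>z. max_bound z \<partial>gauss) = (l - 1 + exp (- l) * (\<Sum>j\<in>J. exp (s\<^sup>2 / 2))) / s"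
    using S unfolding mb by (simp add: has_bochner_integral_iff gauss.prob_space)
  \<comment> \<open>\<open>l\<close> is chosen to make this expected sum exactly exp (-1), which the
    term - 1 in \<open>max_bound\<close> compensates. The quotient l / s is then s + s / 2, the
    origin of the 3 / 2 in \<open>max_scale\<close>.\<close>
  also have "exp (- l) * (\<Sum>j\<in>J. exp (s\<^sup>2 / 2)) = exp (ln (card J)) * exp (s\<^sup>2 / 2 - l)"
    using card_J by (simp add: exp_add[symmetric] mult_ac)
  also have "\<dots> = exp (- 1)" by (simp only: exp_add[symmetric]) (simp add: l_def L_def)
  also have "(l - 1 + exp (- 1)) / s \<le> l / s" using s by (intro divide_right_mono) auto
  also have "\<dots> = 3 / 2 * s" using s by (simp add: l_def power2_eq_square field_simps)
  finally show "(\<integral>z. max_bound z \<partial>gauss) \<le> max_scale" by (simp add: s_def L_def)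
qed

lemma integrable_step_var: "integrable gauss (\<lambda>z. step t z * (1 - step t z))"
proof (rule gauss.integrable_const_bound[where B=1])
  show "AE z in gauss. norm (step t z * (1 - step t z)) \<le> 1"
    using step_bounds mult_mono[of "step t _" 1 "1 - step t _" 1] by (intro AE_I2) (auto simp: abs_mult less_imp_le)
qed measurable

text \<open>Stein's identity in each coordinate, summed over the coordinates; the hypothesis \<open>\<kappa> \<le> \<beta>\<close> lets the
  second-order term of the soft maximum absorb the deficit \<open>1 - (\<Sum>i<n. (col_mean i z)\<^sup>2)\<close>.\<close>

theorem anti_concentration:
  "\<kappa> * (\<integral>z. step t z * (1 - step t z) \<partial>gauss) \<le> max_scale"
proof -
  let ?V = "\<lambda>z. \<Sum>i<n. (col_mean i z)\<^sup>2"
  let ?d = "\<lambda>i z. \<kappa> * (step t z * (1 - step t z)) * (col_mean i z)\<^sup>2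
          + \<beta> * (step t z * (col_sq i z - (col_mean i z)\<^sup>2))"
  have sq: "(\<Sum>i<n. col_sq i z) = 1" for z
  proof -
    have "(\<Sum>i<n. col_sq i z) = gibbs \<beta> J (lin z) (\<lambda>j. \<Sum>i<n. (a j i)\<^sup>2)" by (simp add: gibbs_sum)
    also have "\<dots> = gibbs \<beta> J (lin z) (\<lambda>j. 1)"
      unfolding gibbs_def using unit by (intro arg_cong2[where f="(/)"] sum.cong) auto
    finally show ?thesis by (simp add: gibbs_const)
  qed
  have V: "?V z \<le> 1" for z
    unfolding sq[of z, symmetric] by (intro sum_mono gibbs_m1_sq)
  have sum_d: "(\<Sum>i<n. ?d i z) = \<kappa> * (step t z * (1 - step t z)) * ?V z + \<beta> * (step t z * (1 - ?V z))" for z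
    unfolding sq[of z, symmetric] by (simp add: sum.distrib sum_distrib_left sum_subtractf right_diff_distrib)
  have low: "\<kappa> * (step t z * (1 - step t z)) \<le> (\<Sum>i<n. ?d i z)" for z
  proof -
    let ?y = "step t z"
    have "\<kappa> * (?y * (1 - ?y)) \<le> \<beta> * (?y * 1)"
      using step_bounds[of t z] \<kappa> by (intro mult_mono) (auto simp: less_imp_le)
    then have "\<kappa> * (?y * (1 - ?y)) * (1 - ?V z) \<le> \<beta> * (?y * 1) * (1 - ?V z)"
      using V[of z] by (intro mult_right_mono) auto
    then show ?thesis unfolding sum_d by (simp add: algebra_simps)
  qed
  have up: "(\<Sum>i<n. z i * (step t z * col_mean i z)) \<le> max_bound z" for z
  proof -
    \<comment> \<open>Pairing \<open>z\<close> with the gradient of the soft maximum returns the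
      Gibbs average of the linear forms themselves, which cannot exceed their maximum.\<close>
    have "(\<Sum>i<n. z i * col_mean i z) = (\<Sum>i<n. gibbs \<beta> J (lin z) (\<lambda>j. a j i * z i))"
      by (simp add: gibbs_cmult mult.commute[of "a _ _"])
    also have "\<dots> = gibbs \<beta> J (lin z) (lin z)"
      unfolding gibbs_sum[symmetric] lin_def ..
    also have "\<dots> \<le> max_bound z"
      using gibbs_mono[of "lin z" "\<lambda>_. max_bound z"] lin_le_max_bound by (simp add: gibbs_const)
    finally have "step t z * (\<Sum>i<n. z i * col_mean i z) \<le> step t z * max_bound z"
      using step_bounds[of t z] by (intro mult_left_mono) auto
    also have "\<dots> \<le> 1 * max_bound z"
      using step_bounds[of t z] max_bound_nonneg by (intro mult_right_mono) auto
    finally show ?thesis by (simp add: sum_distrib_left mult_ac)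
  qed
  have "\<kappa> * (\<integral>z. step t z * (1 - step t z) \<partial>gauss) = (\<integral>z. \<kappa> * (step t z * (1 - step t z)) \<partial>gauss)" by simp
  also have "\<dots> \<le> (\<integral>z. (\<Sum>i<n. ?d i z) \<partial>gauss)"
    using stein_column(3) integrable_step_var low by (intro integral_mono) auto
  also have "\<dots> = (\<Sum>i<n. (\<integral>z. ?d i z \<partial>gauss))"
    using stein_column(3) by (intro Bochner_Integration.integral_sum) auto
  also have "\<dots> = (\<Sum>i<n. (\<integral>z. z i * (step t z * col_mean i z) \<partial>gauss))"
    using stein_column(1) by (intro sum.cong) auto
  also have "\<dots> = (\<integral>z. (\<Sum>i<n. z i * (step t z * col_mean i z)) \<partial>gauss)"
    using stein_column(2) by (intro Bochner_Integration.integral_sum[symmetric]) auto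
  also have "\<dots> \<le> (\<integral>z. max_bound z \<partial>gauss)"
    using stein_column(2) integral_max_bound(1) up by (intro integral_mono Bochner_Integration.integrable_sum) auto
  also have "\<dots> \<le> max_scale" by (rule integral_max_bound)
  finally show ?thesis .
qed

text \<open>The carrier \<open>extensional {..<n}\<close> is the space of every product measure that
  occurs, so one set serves as an event under all of them. The inequality is strict because the
  complement has to be an event of the form "at most t", as in a distribution function.\<close>

definition exceed :: "real \<Rightarrow> (nat \<Rightarrow> real) set" where
  "exceed t = {z \<in> extensional {..<n}. \<exists>j\<in>J. t < lin z j}"

context
  fixes \<rho> :: "real measure"
  assumes \<rho>: "prob_space \<rho>" "sets \<rho> = sets borel"
begin

interpretation P: prob_space "PiM {..<n} (\<lambda>_. \<rho>)"
  by (intro prob_space_PiM \<rho>)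

private lemma sets_P [measurable_cong]: "sets (PiM {..<n} (\<lambda>_. \<rho>)) = sets (PiM {..<n} (\<lambda>_. borel :: real measure))"
  using \<rho> by (intro sets_PiM_cong) auto

private lemma space_P: "space (PiM {..<n} (\<lambda>_. \<rho>)) = extensional {..<n}"
  using sets_eq_imp_space_eq[OF \<rho>(2)] by (simp add: space_PiM PiE_UNIV_domain PiE_def)

lemma sets_exceed [measurable]: "exceed t \<in> sets (PiM {..<n} (\<lambda>_. \<rho>))"
proof -
  have "{z \<in> space (PiM {..<n} (\<lambda>_. \<rho>)). \<exists>j\<in>J. t < lin z j} \<in> sets (PiM {..<n} (\<lambda>_. \<rho>))"
    using fin by measurable
  then show ?thesis by (simp add: exceed_def space_P)
qed

private lemma integrable_step: "integrable (PiM {..<n} (\<lambda>_. \<rho>)) (step t)"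
  by (rule P.integrable_const_bound[where B=1]) (use abs_step_le in auto)

text \<open>The soft maximum dominates the maximum, so lowering the threshold by m widths puts the
  logistic argument above m on the event, where the smoothed indicator is at least 1 - exp
  (-m).\<close>

lemma exceed_le_step:
  "measure (PiM {..<n} (\<lambda>_. \<rho>)) (exceed t) \<le> (\<integral>z. step (t - real m / \<kappa>) z \<partial>PiM {..<n} (\<lambda>_. \<rho>)) + exp (- real m)"
proof -
  have "measure (PiM {..<n} (\<lambda>_. \<rho>)) (exceed t) = (\<integral>z. indicator (exceed t) z \<partial>PiM {..<n} (\<lambda>_. \<rho>))" by simp
  also have "\<dots> \<le> (\<integral>z. step (t - real m / \<kappa>) z + exp (- real m) \<partial>PiM {..<n} (\<lambda>_. \<rho>))"
  proof (rule integral_mono)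
    fix z
    show "(indicator (exceed t) z :: real) \<le> step (t - real m / \<kappa>) z + exp (- real m)"
    proof (cases "z \<in> exceed t")
      case True
      then obtain j where j: "j \<in> J" "t < lin z j" by (auto simp: exceed_def)
      have "real m \<le> \<kappa> * (lse \<beta> J (lin z) - t) + m" using \<kappa> j lse_ge[OF j(1), of "lin z"] by simp
      also have "\<dots> = \<kappa> * (lse \<beta> J (lin z) - (t - real m / \<kappa>))" using \<kappa> by (simp add: field_simps)
      finally have "logistic (real m) \<le> step (t - real m / \<kappa>) z" unfolding smooth_step_def by (rule logistic_mono)
      then show ?thesis using one_minus_logistic_le[of "real m"] True by simp
    qed (use step_bounds(1)[of _ z] in \<open>simp add: add_nonneg_nonneg less_imp_le\<close>)
  qed (use integrable_step in \<open>auto simp: P.emeasure_eq_measure\<close>)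
  also have "\<dots> = (\<integral>z. step (t - real m / \<kappa>) z \<partial>PiM {..<n} (\<lambda>_. \<rho>)) + exp (- real m)"
    using integrable_step by (simp add: P.prob_space)
  finally show ?thesis .
qed

text \<open>The extra width in m + 1 pays for the bias of the soft maximum: ln (card J) / \<beta> is
  at most 1 / \<kappa> by the hypothesis \<open>card\<close>.\<close>

lemma step_le_exceed:
  assumes card: "ln (card J) \<le> \<beta> / \<kappa>"
  shows "(\<integral>z. step (t + (real m + 1) / \<kappa>) z \<partial>PiM {..<n} (\<lambda>_. \<rho>)) \<le> measure (PiM {..<n} (\<lambda>_. \<rho>)) (exceed t) + exp (- real m)"
proof -
  have "(\<integral>z. step (t + (real m + 1) / \<kappa>) z \<partial>PiM {..<n} (\<lambda>_. \<rho>)) \<le> (\<integral>z. indicator (exceed t) z + exp (- real m) \<partial>PiM {..<n} (\<lambda>_. \<rho>))"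
  proof (rule integral_mono)
    fix z assume z: "z \<in> space (PiM {..<n} (\<lambda>_. \<rho>))"
    show "step (t + (real m + 1) / \<kappa>) z \<le> (indicator (exceed t) z :: real) + exp (- real m)"
    proof (cases "z \<in> exceed t")
      case True
      then show ?thesis using step_bounds(2)[of "t + (real m + 1) / \<kappa>" z] by (simp add: add_increasing2 less_imp_le)
    next
      case False
      then have "\<And>j. j \<in> J \<Longrightarrow> lin z j \<le> t" using z by (auto simp: exceed_def space_P)
      then have "lse \<beta> J (lin z) \<le> t + ln (card J) / \<beta>" by (rule lse_le)
      also have "ln (card J) / \<beta> \<le> (\<beta> / \<kappa>) / \<beta>" using card \<beta>_pos by (intro divide_right_mono) auto
      finally have "\<kappa> * (lse \<beta> J (lin z) - t) \<le> \<kappa> * (1 / \<kappa>)" using \<kappa> \<beta>_pos by (intro mult_left_mono) auto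
      moreover have "\<kappa> * (lse \<beta> J (lin z) - (t + (real m + 1) / \<kappa>)) = \<kappa> * (lse \<beta> J (lin z) - t) - (real m + 1)"
        using \<kappa> by (simp add: algebra_simps add_divide_distrib)
      ultimately have "\<kappa> * (lse \<beta> J (lin z) - (t + (real m + 1) / \<kappa>)) \<le> - real m" using \<kappa> by simp
      then have "step (t + (real m + 1) / \<kappa>) z \<le> logistic (- real m)" unfolding smooth_step_def by (rule logistic_mono)
      then show ?thesis using logistic_le_exp[of "- real m"] False by simp
    qed
  qed (use integrable_step in \<open>auto simp: P.emeasure_eq_measure\<close>)
  also have "\<dots> = measure (PiM {..<n} (\<lambda>_. \<rho>)) (exceed t) + exp (- real m)"
    by (subst Bochner_Integration.integral_add) (auto simp: P.prob_space P.emeasure_eq_measure)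
  finally show ?thesis .
qed

end

lemma step_antimono: "t \<le> t' \<Longrightarrow> step t' z \<le> step t z"
  unfolding smooth_step_def using \<kappa> by (intro logistic_mono mult_left_mono) auto

lemma integrable_gauss_step: "integrable gauss (step t)"
  using abs_step_le by (intro gauss.integrable_const_bound[where B=1] measurable_gauss_step) auto

text \<open>Moving the threshold by one width costs at most twice the expected logistic slope, by
  \<open>logistic_step\<close>, and \<open>anti_concentration\<close> bounds that slope uniformly in
  the threshold.\<close>

lemma gauss_step_lipschitz:
  "(\<integral>z. step t z \<partial>gauss) - (\<integral>z. step (t + real k / \<kappa>) z \<partial>gauss) \<le> 2 * real k * max_scale / \<kappa>"
proof (induction k)
  case (Suc k)
  let ?t = "t + real k / \<kappa>"
  have "step ?t z - step (t + real (Suc k) / \<kappa>) z \<le> 2 * (step ?t z * (1 - step ?t z))" for z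
  proof -
    have "\<kappa> * (lse \<beta> J (lin z) - (t + real (Suc k) / \<kappa>)) = \<kappa> * (lse \<beta> J (lin z) - ?t) - 1"
      using \<kappa> by (simp add: field_simps)
    then show ?thesis unfolding smooth_step_def using logistic_step by simp
  qed
  then have "(\<integral>z. step ?t z - step (t + real (Suc k) / \<kappa>) z \<partial>gauss) \<le> (\<integral>z. 2 * (step ?t z * (1 - step ?t z)) \<partial>gauss)"
    using integrable_gauss_step integrable_step_var by (intro integral_mono) auto
  also have "\<dots> \<le> 2 * (max_scale / \<kappa>)"
    unfolding integral_mult_right_zero
    using anti_concentration[of ?t] \<kappa> by (intro mult_left_mono) (simp_all add: pos_le_divide_eq mult.commute)
  finally have "(\<integral>z. step ?t z \<partial>gauss) - (\<integral>z. step (t + real (Suc k) / \<kappa>) z \<partial>gauss) \<le> 2 * (max_scale / \<kappa>)"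
    using integrable_gauss_step by simp
  moreover have "2 * real (Suc k) * max_scale / \<kappa> = 2 * real k * max_scale / \<kappa> + 2 * (max_scale / \<kappa>)"
    by (simp add: add_divide_distrib algebra_simps)
  ultimately show ?case using Suc by linarith
qed simp

theorem gauss_exceed_tail:
  assumes "t > 0"
  shows "measure gauss (exceed t) \<le> max_scale / t"
proof -
  have "measure gauss (exceed t) = (\<integral>z. indicator (exceed t) z \<partial>gauss)" 
    using sets_exceed[of std_normal] std_normal.prob_space_axioms by simp
  also have "\<dots> \<le> (\<integral>z. max_bound z / t \<partial>gauss)"
  proof (rule integral_mono)
    fix z
    show "(indicator (exceed t) z :: real) \<le> max_bound z / t"
    proof (cases "z \<in> exceed t")
      case True
      then obtain j where "j \<in> J" "t < lin z j" by (auto simp: exceed_def)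
      then show ?thesis using lin_le_max_bound[of j z] assms True by simp
    qed (use max_bound_nonneg assms in auto)
  qed (use integral_max_bound sets_exceed[of std_normal] std_normal.prob_space_axioms in
      \<open>auto simp: gauss.emeasure_eq_measure\<close>)
  also have "\<dots> \<le> max_scale / t"
    using divide_right_mono[OF integral_max_bound(2), of t] assms by simp
  finally show ?thesis .
qed

text \<open>The chain is sharp, smoothed, exchanged, smoothed, sharp. Its thresholds spread over
  \<delta> plus m widths on one side and m + 1 on the other, and \<open>k\<close> counts this spread
  in widths for \<open>gauss_step_lipschitz\<close>. For \<delta> >= 0 the exceedance on the right
  is the rarer one; this room later absorbs the error in the fitted scale.\<close>

theorem max_comparison:
  fixes \<rho> :: "real measure"
  defines "P \<equiv> PiM {..<n} (\<lambda>_. \<rho>)"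
  assumes noise: "std_noise \<rho> r" and small: "2 * \<beta> * \<eta> \<le> r" and card: "ln (card J) \<le> \<beta> / \<kappa>"
    and k: "\<kappa> * \<delta> + 2 * real m + 1 \<le> real k"
  defines "err \<equiv> (exp_cube_moment \<rho> r + exp_cube_moment std_normal r) / (\<integral>w. exp (- (r * \<bar>w\<bar>)) \<partial>std_normal)
     * (\<kappa> * \<beta>\<^sup>2 * \<eta> * harm n) + 2 * exp (- real m) + 2 * real k * max_scale / \<kappa>"
  shows "measure P (exceed t) \<le> measure gauss (exceed (t + \<delta>)) + err"
    and "measure gauss (exceed t) \<le> measure P (exceed (t + \<delta>)) + err"
proof -
  interpret \<rho>: std_noise \<rho> r by (rule noise)
  let ?s = "t + \<delta> + (real m + 1) / \<kappa>"
  have "(\<kappa> * \<delta> + 2 * real m + 1) / \<kappa> \<le> real k / \<kappa>" using k \<kappa> by (intro divide_right_mono) auto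
  then have k': "?s \<le> t - real m / \<kappa> + real k / \<kappa>" using \<kappa> by (simp add: field_simps)
  have anti: "(\<integral>z. step (t - real m / \<kappa> + real k / \<kappa>) z \<partial>gauss) \<le> (\<integral>z. step ?s z \<partial>gauss)"
    using integrable_gauss_step step_antimono[OF k'] by (intro integral_mono) auto
  note lind = lindeberg_soft_max[OF noise small]
  note lip = gauss_step_lipschitz[of "t - real m / \<kappa>" k]
  note \<rho>_facts = \<rho>.prob_space_axioms \<rho>.sets_noise
  note N_facts = std_normal.prob_space_axioms sets_density[of lborel "\<lambda>x. ennreal (std_normal_density x)", unfolded sets_lborel]
  show "measure P (exceed t) \<le> measure gauss (exceed (t + \<delta>)) + err"
    using exceed_le_step[OF \<rho>_facts, of t m] lind[of "t - real m / \<kappa>"] lip anti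
      step_le_exceed[OF N_facts card, of "t + \<delta>" m]
    unfolding P_def err_def by linarith
  show "measure gauss (exceed t) \<le> measure P (exceed (t + \<delta>)) + err"
    using exceed_le_step[OF N_facts, of t m] lind[of ?s] lip anti
      step_le_exceed[OF \<rho>_facts card, of "t + \<delta>" m]
    unfolding P_def err_def by linarith
qed

end

section \<open>Moments of exponential families\<close>

text \<open>Expanding the exponential pointwise, with a remainder that is integrable because half of
  the rate \<open>r\<close> is kept for the cube, replaces differentiation under the integral
  sign.\<close>

lemma (in prob_space) mgf_cubic_approx:
  fixes X :: "'a \<Rightarrow> real"
  assumes [measurable]: "X \<in> borel_measurable M" and r: "r > 0"
    and int: "integrable M (\<lambda>x. exp (r * \<bar>X x\<bar>))"
  shows "integrable M (\<lambda>x. \<bar>X x\<bar> ^ 3 * exp (r / 2 * \<bar>X x\<bar>))"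
    and "integrable M X" and "integrable M (\<lambda>x. (X x)\<^sup>2)"
    and "\<bar>s\<bar> \<le> r / 2 \<Longrightarrow>
      \<bar>expectation (\<lambda>x. exp (s * X x)) - (1 + expectation X * s + expectation (\<lambda>x. (X x)\<^sup>2) / 2 * s\<^sup>2)\<bar>
      \<le> expectation (\<lambda>x. \<bar>X x\<bar> ^ 3 * exp (r / 2 * \<bar>X x\<bar>)) * \<bar>s\<bar> ^ 3"
proof -
  have half: "r / 2 + r / 2 = r" by simp
  have cube: "\<bar>X x\<bar> ^ 3 * exp (r / 2 * \<bar>X x\<bar>) \<le> 27 / (r / 2) ^ 3 * exp (r * \<bar>X x\<bar>)" for x
    using cube_exp_le[of "r / 2" "\<bar>X x\<bar>" "r / 2"] r unfolding half by simp
  show int3: "integrable M (\<lambda>x. \<bar>X x\<bar> ^ 3 * exp (r / 2 * \<bar>X x\<bar>))"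
  proof (rule Bochner_Integration.integrable_bound)
    show "integrable M (\<lambda>x. 27 / (r / 2) ^ 3 * exp (r * \<bar>X x\<bar>))" using int by simp
    show "AE x in M. norm (\<bar>X x\<bar> ^ 3 * exp (r / 2 * \<bar>X x\<bar>)) \<le> norm (27 / (r / 2) ^ 3 * exp (r * \<bar>X x\<bar>))"
      using order_trans[OF cube abs_ge_self] by (intro AE_I2) (simp add: abs_mult)
  qed measurable
  have le: "\<bar>X x ^ k\<bar> \<le> 1 + \<bar>X x\<bar> ^ 3 * exp (r / 2 * \<bar>X x\<bar>)" if "k \<le> 3" for k x
  proof (cases "\<bar>X x\<bar> \<le> 1")
    case True
    then have "\<bar>X x\<bar> ^ k \<le> 1" by (intro power_le_one) auto
    then show ?thesis by (simp add: add_increasing2 power_abs)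
  next
    case False
    then have "\<bar>X x\<bar> ^ k \<le> \<bar>X x\<bar> ^ 3 * 1" using that by (simp add: power_increasing)
    also have "\<dots> \<le> \<bar>X x\<bar> ^ 3 * exp (r / 2 * \<bar>X x\<bar>)" using r by (intro mult_left_mono) auto
    finally show ?thesis by (simp add: power_abs)
  qed
  have pow: "integrable M (\<lambda>x. X x ^ k)" if "k \<le> 3" for k
  proof (rule Bochner_Integration.integrable_bound)
    show "integrable M (\<lambda>x. 1 + \<bar>X x\<bar> ^ 3 * exp (r / 2 * \<bar>X x\<bar>))" using int3 by simp
    show "AE x in M. norm (X x ^ k) \<le> norm (1 + \<bar>X x\<bar> ^ 3 * exp (r / 2 * \<bar>X x\<bar>))"
      using order_trans[OF le[OF that] abs_ge_self] by (intro AE_I2) simp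
  qed measurable
  show 1: "integrable M X" using pow[of 1] by simp
  show 2: "integrable M (\<lambda>x. (X x)\<^sup>2)" using pow[of 2] by simp
  assume s: "\<bar>s\<bar> \<le> r / 2"
  let ?q = "\<lambda>x. 1 + X x * s + (X x)\<^sup>2 / 2 * s\<^sup>2"
  have q: "integrable M ?q" using 1 2 by simp
  have e: "integrable M (\<lambda>x. exp (s * X x))"
  proof (rule Bochner_Integration.integrable_bound[OF int])
    show "AE x in M. norm (exp (s * X x)) \<le> norm (exp (r * \<bar>X x\<bar>))"
    proof (rule AE_I2)
      fix x
      have "s * X x \<le> \<bar>s\<bar> * \<bar>X x\<bar>" by (metis abs_ge_self abs_mult)
      also have "\<dots> \<le> r * \<bar>X x\<bar>" using s r by (intro mult_right_mono) auto
      finally show "norm (exp (s * X x)) \<le> norm (exp (r * \<bar>X x\<bar>))" by simp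
    qed
  qed measurable
  have pt: "\<bar>exp (s * X x) - ?q x\<bar> \<le> \<bar>X x\<bar> ^ 3 * exp (r / 2 * \<bar>X x\<bar>) * \<bar>s\<bar> ^ 3" for x
  proof -
    obtain t where t: "\<bar>t\<bar> \<le> \<bar>s * X x\<bar>"
      "exp (s * X x) = (\<Sum>m<3. (s * X x) ^ m / fact m) + exp t / fact 3 * (s * X x) ^ 3"
      using Maclaurin_exp_le by blast
    have "\<bar>s * X x\<bar> \<le> r / 2 * \<bar>X x\<bar>" unfolding abs_mult using s by (intro mult_right_mono) auto
    then have et: "exp t \<le> exp (r / 2 * \<bar>X x\<bar>)" using t(1) by simp
    have "exp (s * X x) - ?q x = exp t / 6 * (s * X x) ^ 3"
      using t(2) by (simp add: eval_nat_numeral algebra_simps)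
    then have "\<bar>exp (s * X x) - ?q x\<bar> = \<bar>exp t / 6 * (s * X x) ^ 3\<bar>" by (rule arg_cong)
    also have "\<dots> = exp t / 6 * \<bar>s * X x\<bar> ^ 3" unfolding abs_mult[of "exp t / 6"] power_abs by simp
    also have "\<dots> \<le> exp (r / 2 * \<bar>X x\<bar>) * \<bar>s * X x\<bar> ^ 3"
      using et exp_gt_zero[of t] by (intro mult_right_mono) (linarith, simp)
    also have "\<dots> = \<bar>X x\<bar> ^ 3 * exp (r / 2 * \<bar>X x\<bar>) * \<bar>s\<bar> ^ 3" by (simp add: abs_mult power_mult_distrib)
    finally show ?thesis .
  qed
  have "\<bar>expectation (\<lambda>x. exp (s * X x)) - expectation ?q\<bar> = \<bar>expectation (\<lambda>x. exp (s * X x) - ?q x)\<bar>"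
    using e q by simp
  also have "\<dots> \<le> expectation (\<lambda>x. \<bar>exp (s * X x) - ?q x\<bar>)" by (rule integral_abs_bound)
  also have "\<dots> \<le> expectation (\<lambda>x. \<bar>X x\<bar> ^ 3 * exp (r / 2 * \<bar>X x\<bar>) * \<bar>s\<bar> ^ 3)"
    using e q int3 pt by (intro integral_mono) auto
  also have "\<dots> = expectation (\<lambda>x. \<bar>X x\<bar> ^ 3 * exp (r / 2 * \<bar>X x\<bar>)) * \<bar>s\<bar> ^ 3" by simp
  also have "expectation ?q = 1 + expectation X * s + expectation (\<lambda>x. (X x)\<^sup>2) / 2 * s\<^sup>2"
    using 1 2 by (simp add: prob_space)
  finally show "\<bar>expectation (\<lambda>x. exp (s * X x)) - (1 + expectation X * s + expectation (\<lambda>x. (X x)\<^sup>2) / 2 * s\<^sup>2)\<bar>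
      \<le> expectation (\<lambda>x. \<bar>X x\<bar> ^ 3 * exp (r / 2 * \<bar>X x\<bar>)) * \<bar>s\<bar> ^ 3" .
qed

text \<open>Compares two expansions along a positive sequence tending to 0 inside the interval:
  difference quotients determine \<open>c1\<close>, and the Lagrange form of the second-order
  remainder together with continuity of \<open>f2\<close> determines \<open>c2\<close>.\<close>

lemma taylor_coefficients_unique:
  fixes f f1 f2 :: "real \<Rightarrow> real"
  assumes h: "h > 0"
    and f1: "\<And>s. \<bar>s\<bar> < h \<Longrightarrow> (f has_real_derivative f1 s) (at s)"
    and f2: "\<And>s. \<bar>s\<bar> < h \<Longrightarrow> (f1 has_real_derivative f2 s) (at s)"
    and cont: "isCont f2 0"
    and approx: "\<And>s. \<bar>s\<bar> < h \<Longrightarrow> \<bar>f s - (c0 + c1 * s + c2 * s\<^sup>2)\<bar> \<le> K * \<bar>s\<bar> ^ 3"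
  shows "c1 = f1 0" and "2 * c2 = f2 0"
proof -
  define s where "s n = h / (real n + 2)" for n
  have s: "0 < s n" "\<bar>s n\<bar> < h" for n
  proof -
    show pos: "0 < s n" using h by (simp add: s_def)
    have "h * 1 < h * (real n + 2)" using h by (intro mult_strict_left_mono) auto
    then show "\<bar>s n\<bar> < h" using pos h by (simp add: s_def pos_divide_less_eq)
  qed
  have lim: "s \<longlonglongrightarrow> 0" unfolding s_def by real_asymp
  have f0: "f 0 = c0" using approx[of 0] h by simp
  have "(\<lambda>n. (f (s n) - c0) / s n) \<longlonglongrightarrow> f1 0"
    using f1[of 0] h lim s f0 unfolding has_field_derivative_iff tendsto_at_iff_sequentially
    by (auto simp: comp_def less_le)
  moreover have "(\<lambda>n. (f (s n) - c0) / s n) \<longlonglongrightarrow> c1"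
  proof -
    have "(\<lambda>n. (f (s n) - c0) / s n - c1) \<longlonglongrightarrow> 0"
    proof (rule Lim_null_comparison)
      show "(\<lambda>n. \<bar>c2\<bar> * s n + K * (s n)\<^sup>2) \<longlonglongrightarrow> 0"
        using tendsto_add[OF tendsto_mult[OF tendsto_const lim] tendsto_mult[OF tendsto_const tendsto_power[OF lim]], of "\<bar>c2\<bar>" K 2] by simp
      show "\<forall>\<^sub>F n in sequentially. norm ((f (s n) - c0) / s n - c1) \<le> \<bar>c2\<bar> * s n + K * (s n)\<^sup>2"
      proof (rule always_eventually, rule allI)
        fix n
        have "\<bar>f (s n) - c0 - c1 * s n\<bar> \<le> \<bar>c2 * (s n)\<^sup>2\<bar> + \<bar>f (s n) - (c0 + c1 * s n + c2 * (s n)\<^sup>2)\<bar>" by linarith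
        also have "\<dots> \<le> \<bar>c2\<bar> * (s n)\<^sup>2 + K * \<bar>s n\<bar> ^ 3"
          using approx[OF s(2)] by (auto simp: abs_mult)
        finally have "\<bar>f (s n) - c0 - c1 * s n\<bar> / s n \<le> (\<bar>c2\<bar> * (s n)\<^sup>2 + K * \<bar>s n\<bar> ^ 3) / s n"
          using s(1)[of n] by (intro divide_right_mono) auto
        moreover have "\<bar>f (s n) - c0 - c1 * s n\<bar> / s n = \<bar>(f (s n) - c0) / s n - c1\<bar>"
          using s(1)[of n] by (subst abs_div_pos) (auto simp: diff_divide_distrib)
        ultimately show "norm ((f (s n) - c0) / s n - c1) \<le> \<bar>c2\<bar> * s n + K * (s n)\<^sup>2"
          using s(1)[of n] by (simp add: field_simps power2_eq_square power3_eq_cube)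
      qed
    qed
    then show ?thesis using LIM_zero_iff by blast
  qed
  ultimately show c1: "c1 = f1 0" using LIMSEQ_unique by blast
  have "\<exists>\<xi>. \<bar>\<xi>\<bar> \<le> s n \<and> f (s n) = f 0 + f1 0 * s n + f2 \<xi> / 2 * (s n)\<^sup>2" for n
  proof -
    let ?d = "\<lambda>k. if k = (0::nat) then f else if k = 1 then f1 else f2"
    have "\<forall>m t. m < 2 \<and> \<bar>t\<bar> \<le> \<bar>s n\<bar> \<longrightarrow> (?d m has_real_derivative ?d (Suc m) t) (at t)"
    proof (intro allI impI)
      fix m :: nat and t assume *: "m < 2 \<and> \<bar>t\<bar> \<le> \<bar>s n\<bar>"
      then have "m = 0 \<or> m = 1" "\<bar>t\<bar> < h" using s(2)[of n] by auto
      then show "(?d m has_real_derivative ?d (Suc m) t) (at t)" using f1 f2 by auto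
    qed
    from Maclaurin_bi_le[OF _ this, of f] show ?thesis
      using s(1)[of n] by (auto simp: eval_nat_numeral)
  qed
  then obtain \<xi> where \<xi>: "\<And>n. \<bar>\<xi> n\<bar> \<le> s n" "\<And>n. f (s n) = f 0 + f1 0 * s n + f2 (\<xi> n) / 2 * (s n)\<^sup>2"
    by metis
  have "\<xi> \<longlonglongrightarrow> 0" by (rule Lim_null_comparison[OF _ lim]) (use \<xi>(1) in auto)
  then have "(\<lambda>n. f2 (\<xi> n)) \<longlonglongrightarrow> f2 0" using isCont_tendsto_compose[OF cont] by blast
  moreover have "(\<lambda>n. f2 (\<xi> n)) \<longlonglongrightarrow> 2 * c2"
  proof -
    have "(\<lambda>n. f2 (\<xi> n) - 2 * c2) \<longlonglongrightarrow> 0"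
    proof (rule Lim_null_comparison)
      show "(\<lambda>n. 2 * K * s n) \<longlonglongrightarrow> 0" using tendsto_mult[OF tendsto_const lim, of "2 * K"] by simp
      show "\<forall>\<^sub>F n in sequentially. norm (f2 (\<xi> n) - 2 * c2) \<le> 2 * K * s n"
      proof (rule always_eventually, rule allI)
        fix n
        have "\<bar>(f2 (\<xi> n) / 2 - c2) * (s n)\<^sup>2\<bar> \<le> K * \<bar>s n\<bar> ^ 3"
          using approx[OF s(2), of n] unfolding \<xi>(2) f0 c1 by (simp add: algebra_simps)
        then have "\<bar>f2 (\<xi> n) / 2 - c2\<bar> * (s n)\<^sup>2 \<le> (K * s n) * (s n)\<^sup>2"
          using s(1)[of n] by (simp add: abs_mult power2_eq_square power3_eq_cube mult_ac)
        then have "\<bar>f2 (\<xi> n) / 2 - c2\<bar> \<le> K * s n" using s(1)[of n] by simp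
        then show "norm (f2 (\<xi> n) - 2 * c2) \<le> 2 * K * s n" by (simp add: abs_le_iff)
      qed
    qed
    then show ?thesis using LIM_zero_iff by blast
  qed
  ultimately show "2 * c2 = f2 0" using LIMSEQ_unique by blast
qed

section \<open>Exponential families: moments as derivatives of the log-normalizer\<close>

locale smooth_exponential_family =
  fixes \<nu> :: "real measure" and \<Theta> :: "real set" and T d b :: "real \<Rightarrow> real"
  assumes family: "exponential_family \<nu> \<Theta> T d b" and smooth: "C_k_on 3 d \<Theta>"
begin

abbreviation law :: "real \<Rightarrow> real measure" where
  "law \<theta> \<equiv> density \<nu> (expfam_density T d b \<theta>)"

abbreviation d1 :: "real \<Rightarrow> real" where "d1 \<equiv> deriv d"
abbreviation d2 :: "real \<Rightarrow> real" where "d2 \<equiv> (deriv ^^ 2) d"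
abbreviation d3 :: "real \<Rightarrow> real" where "d3 \<equiv> (deriv ^^ 3) d"

lemma open_\<Theta>: "open \<Theta>" and interval_\<Theta>: "is_interval \<Theta>"
  and sets_\<nu> [measurable_cong, simp]: "sets \<nu> = sets borel"
  and T_measurable [measurable]: "T \<in> borel_measurable borel"
  and b_measurable [measurable]: "b \<in> borel_measurable borel"
  and prob_law: "\<theta> \<in> \<Theta> \<Longrightarrow> prob_space (law \<theta>)"
  using family by (auto simp: exponential_family_def)

lemma DERIV_d:
  assumes "\<theta> \<in> \<Theta>"
  shows "(d has_real_derivative d1 \<theta>) (at \<theta>)" "(d1 has_real_derivative d2 \<theta>) (at \<theta>)"
    "(d2 has_real_derivative d3 \<theta>) (at \<theta>)"
proof -
  have "((deriv ^^ m) d has_real_derivative (deriv ^^ Suc m) d \<theta>) (at \<theta>)" if "m < 3" for m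
    using smooth assms that
    by (auto simp: C_k_on_def DERIV_deriv_iff_real_differentiable)
  from this[of 0] this[of 1] this[of 2] show "(d has_real_derivative d1 \<theta>) (at \<theta>)" "(d1 has_real_derivative d2 \<theta>) (at \<theta>)"
    "(d2 has_real_derivative d3 \<theta>) (at \<theta>)" by (simp_all add: eval_nat_numeral)
qed

lemma continuous_d3: "continuous_on \<Theta> d3"
  using smooth by (simp add: C_k_on_def)

lemma expfam_density_measurable [measurable]: "expfam_density T d b \<theta> \<in> borel_measurable borel"
  unfolding expfam_density_def by measurable

lemma expfam_density_pos: "expfam_density T d b \<theta> y > 0"
  by (simp add: expfam_density_def)

lemma sets_law [simp, measurable_cong]: "sets (law \<theta>) = sets borel"
  by simp

lemma integrable_density_law:
  assumes "\<theta> \<in> \<Theta>"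
  shows "has_bochner_integral \<nu> (expfam_density T d b \<theta>) 1"
proof -
  interpret prob_space "law \<theta>" by (rule prob_law[OF assms])
  have "(\<integral>\<^sup>+ y. ennreal (expfam_density T d b \<theta> y) \<partial>\<nu>) = 1"
    using emeasure_space_1 sets_eq_imp_space_eq[OF sets_\<nu>] by (simp add: emeasure_density)
  then show ?thesis
    by (intro has_bochner_integral_nn_integral) (auto simp: expfam_density_pos less_imp_le)
qed

text \<open>Multiplying the density at \<theta> by exp (s T) yields, up to a ratio of normalizers,
  the density at \<theta> + s, whose integral is 1.\<close>

lemma law_mgf:
  assumes "\<theta> \<in> \<Theta>" "\<theta> + s \<in> \<Theta>"
  shows "has_bochner_integral (law \<theta>) (\<lambda>y. exp (s * T y)) (exp (d (\<theta> + s) - d \<theta>))"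
proof -
  have eq: "expfam_density T d b \<theta> y *\<^sub>R exp (s * T y) = exp (d (\<theta> + s) - d \<theta>) * expfam_density T d b (\<theta> + s) y" for y
    by (simp add: expfam_density_def exp_add[symmetric] algebra_simps)
  have "has_bochner_integral \<nu> (\<lambda>y. expfam_density T d b \<theta> y *\<^sub>R exp (s * T y)) (exp (d (\<theta> + s) - d \<theta>) * 1)"
    unfolding eq by (intro has_bochner_integral_mult_right integrable_density_law assms)
  then show ?thesis
    by (subst has_bochner_integral_density) (auto simp: expfam_density_pos less_imp_le)
qed

lemma ball_\<Theta>:
  assumes "\<theta> \<in> \<Theta>"
  obtains r where "r > 0" "\<And>s. \<bar>s\<bar> \<le> r \<Longrightarrow> \<theta> + s \<in> \<Theta>"
proof -
  obtain r where "r > 0" "cball \<theta> r \<subseteq> \<Theta>" using open_\<Theta> assms by (meson open_contains_cball)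
  then show ?thesis by (intro that[of r]) (auto simp: dist_real_def subset_iff)
qed

lemma exp_moment:
  assumes "\<theta> \<in> \<Theta>"
  obtains r where "r > 0" "\<And>s. \<bar>s\<bar> \<le> r \<Longrightarrow> \<theta> + s \<in> \<Theta>" "integrable (law \<theta>) (\<lambda>y. exp (r * \<bar>T y\<bar>))"
proof -
  obtain r where r: "r > 0" "\<And>s. \<bar>s\<bar> \<le> r \<Longrightarrow> \<theta> + s \<in> \<Theta>" using ball_\<Theta>[OF assms] by blast
  have "integrable (law \<theta>) (\<lambda>y. exp (r * T y) + exp (- r * T y))"
    using law_mgf[OF assms r(2)[of r]] law_mgf[OF assms r(2)[of "- r"]] r(1)
    by (intro Bochner_Integration.integrable_add) (auto simp: has_bochner_integral_iff)
  then have "integrable (law \<theta>) (\<lambda>y. exp (r * \<bar>T y\<bar>))"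
  proof (rule Bochner_Integration.integrable_bound)
    show "AE y in law \<theta>. norm (exp (r * \<bar>T y\<bar>)) \<le> norm (exp (r * T y) + exp (- r * T y))"
    proof (rule AE_I2)
      fix y
      show "norm (exp (r * \<bar>T y\<bar>)) \<le> norm (exp (r * T y) + exp (- r * T y))"
        by (cases "T y < 0") (simp_all add: abs_of_pos[OF add_pos_pos])
    qed
  qed measurable
  then show ?thesis using that r by blast
qed

text \<open>The moment generating function exp (d (\<theta> + s) - d \<theta>) has two quadratic
  expansions at s = 0, one from the derivatives of \<open>d\<close> and one from the moments of T;
  uniqueness of the coefficients identifies them.\<close>

lemma law_moments:
  assumes \<theta>: "\<theta> \<in> \<Theta>"
  shows "integrable (law \<theta>) T" "(\<integral>y. T y \<partial>law \<theta>) = d1 \<theta>"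
    "integrable (law \<theta>) (\<lambda>y. (T y)\<^sup>2)" "(\<integral>y. (T y)\<^sup>2 \<partial>law \<theta>) = d2 \<theta> + (d1 \<theta>)\<^sup>2"
proof -
  interpret L: prob_space "law \<theta>" by (rule prob_law[OF \<theta>])
  obtain r where r: "r > 0" "\<And>s. \<bar>s\<bar> \<le> r \<Longrightarrow> \<theta> + s \<in> \<Theta>"
    and int: "integrable (law \<theta>) (\<lambda>y. exp (r * \<bar>T y\<bar>))"
    using exp_moment[OF \<theta>] by blast
  have T: "T \<in> borel_measurable (law \<theta>)" by simp
  note cubic = L.mgf_cubic_approx[OF T r(1) int]
  show "integrable (law \<theta>) T" "integrable (law \<theta>) (\<lambda>y. (T y)\<^sup>2)" by (rule cubic)+
  let ?f = "\<lambda>s. exp (d (\<theta> + s) - d \<theta>)"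
  have in_\<Theta>: "\<theta> + s \<in> \<Theta>" if "\<bar>s\<bar> < r / 2" for s using that r by (intro r(2)) auto
  have sh: "((\<lambda>s. f (\<theta> + s)) has_real_derivative D) (at s)" if "(f has_real_derivative D) (at (\<theta> + s))" for f D s
    by (rule DERIV_cong[OF DERIV_chain2[where f=f and g="\<lambda>s. \<theta> + s", OF that]]) (auto intro!: derivative_eq_intros)
  have d: "((\<lambda>s. d (\<theta> + s)) has_real_derivative d1 (\<theta> + s)) (at s)"
    "((\<lambda>s. d1 (\<theta> + s)) has_real_derivative d2 (\<theta> + s)) (at s)"
    "((\<lambda>s. d2 (\<theta> + s)) has_real_derivative d3 (\<theta> + s)) (at s)" if "\<bar>s\<bar> < r / 2" for s
    by (rule sh[OF DERIV_d(1)[OF in_\<Theta>[OF that]]] sh[OF DERIV_d(2)[OF in_\<Theta>[OF that]]]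
        sh[OF DERIV_d(3)[OF in_\<Theta>[OF that]]])+
  have f1: "(?f has_real_derivative ?f s * d1 (\<theta> + s)) (at s)" if "\<bar>s\<bar> < r / 2" for s
    by (rule DERIV_cong[OF DERIV_chain2[where f=exp and g="\<lambda>s. d (\<theta> + s) - d \<theta>",
          OF DERIV_exp DERIV_diff[OF d(1)[OF that] DERIV_const]]]) simp
  have f2: "((\<lambda>s. ?f s * d1 (\<theta> + s)) has_real_derivative ?f s * (d2 (\<theta> + s) + (d1 (\<theta> + s))\<^sup>2)) (at s)" if "\<bar>s\<bar> < r / 2" for s
    by (rule DERIV_cong[OF DERIV_mult[OF f1[OF that] d(2)[OF that]]]) (simp add: power2_eq_square algebra_simps)
  have r2: "0 < r / 2" and z: "\<bar>0::real\<bar> < r / 2" using r by simp_all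
  have c: "isCont (\<lambda>s. ?f s * (d2 (\<theta> + s) + (d1 (\<theta> + s))\<^sup>2)) 0"
    by (intro isCont_mult isCont_add isCont_power DERIV_isCont[OF f1[OF z]]
        DERIV_isCont[OF d(2)[OF z]] DERIV_isCont[OF d(3)[OF z]])
  have a: "\<bar>?f s - (1 + L.expectation T * s + L.expectation (\<lambda>y. (T y)\<^sup>2) / 2 * s\<^sup>2)\<bar>
      \<le> L.expectation (\<lambda>y. \<bar>T y\<bar> ^ 3 * exp (r / 2 * \<bar>T y\<bar>)) * \<bar>s\<bar> ^ 3" if "\<bar>s\<bar> < r / 2" for s
    using cubic(4)[of s] law_mgf[OF \<theta> in_\<Theta>[OF that]] that by (simp add: has_bochner_integral_iff)
  note uniq = taylor_coefficients_unique[where f="?f" and ?f1.0="\<lambda>s. ?f s * d1 (\<theta> + s)"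
      and ?f2.0="\<lambda>s. ?f s * (d2 (\<theta> + s) + (d1 (\<theta> + s))\<^sup>2)" and h="r / 2" and ?c0.0=1
      and ?c1.0="L.expectation T" and ?c2.0="L.expectation (\<lambda>y. (T y)\<^sup>2) / 2", OF r2 f1 f2 c a]
  show "(\<integral>y. T y \<partial>law \<theta>) = d1 \<theta>" using uniq(1) by simp
  show "(\<integral>y. (T y)\<^sup>2 \<partial>law \<theta>) = d2 \<theta> + (d1 \<theta>)\<^sup>2" using uniq(2) by simp
qed

lemma law_variance:
  assumes \<theta>: "\<theta> \<in> \<Theta>"
  shows "integrable (law \<theta>) (\<lambda>y. (T y - c)\<^sup>2)" "(\<integral>y. (T y - d1 \<theta>)\<^sup>2 \<partial>law \<theta>) = d2 \<theta>"
proof -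
  interpret L: prob_space "law \<theta>" by (rule prob_law[OF \<theta>])
  have eq: "(T y - c)\<^sup>2 = (T y)\<^sup>2 - 2 * c * T y + c\<^sup>2" for y c by (simp add: power2_diff)
  show "integrable (law \<theta>) (\<lambda>y. (T y - c)\<^sup>2)" unfolding eq using law_moments[OF \<theta>] by simp
  show "(\<integral>y. (T y - d1 \<theta>)\<^sup>2 \<partial>law \<theta>) = d2 \<theta>"
    unfolding eq using law_moments[OF \<theta>] L.prob_space by (simp add: power2_eq_square)
qed

lemma d2_nonneg: "\<theta> \<in> \<Theta> \<Longrightarrow> 0 \<le> d2 \<theta>"
  unfolding law_variance(2)[symmetric] by (rule integral_nonneg_AE) simp

text \<open>Zero variance at one parameter makes T constant almost everywhere for \<nu>, since the
  densities are positive; T is then constant under every member of the family.\<close>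

lemma d2_eq_0_imp:
  assumes "\<theta>1 \<in> \<Theta>" "d2 \<theta>1 = 0" "\<theta> \<in> \<Theta>"
  shows "d2 \<theta> = 0"
proof -
  let ?m = "d1 \<theta>1"
  have "AE y in law \<theta>1. (T y - ?m)\<^sup>2 = 0"
    using integral_nonneg_eq_0_iff_AE[OF law_variance(1)[OF assms(1), of ?m]] law_variance(2)[OF assms(1)] assms(2)
    by simp
  then have "AE y in \<nu>. T y = ?m"
    by (subst (asm) AE_density) (auto simp: expfam_density_pos)
  then have AE: "AE y in law \<theta>. T y = ?m"
    by (subst AE_density) auto
  interpret L: prob_space "law \<theta>" by (rule prob_law[OF assms(3)])
  have "(\<integral>y. T y \<partial>law \<theta>) = (\<integral>y. ?m \<partial>law \<theta>)" using AE by (intro integral_cong_AE) auto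
  then have m: "d1 \<theta> = ?m" using law_moments(2)[OF assms(3)] L.prob_space by simp
  have "(\<integral>y. (T y - d1 \<theta>)\<^sup>2 \<partial>law \<theta>) = (\<integral>y. 0 \<partial>law \<theta>)" using AE m by (intro integral_cong_AE) auto
  then show ?thesis using law_variance(2)[OF assms(3)] by simp
qed

end

section \<open>The maximum likelihood scale and the score\<close>

context std_noise
begin

lemma PiM_sum_second_moment:
  "has_bochner_integral (PiM {..<n} (\<lambda>_. \<rho>)) (\<lambda>z. (\<Sum>i<n. z i)\<^sup>2) (real n)"
proof -
  interpret P: product_prob_space "\<lambda>_::nat. \<rho>"
    by (rule product_prob_spaceI) (rule prob_space_axioms)
  have ij: "has_bochner_integral (PiM {..<n} (\<lambda>_. \<rho>)) (\<lambda>z. z i * z j) (if i = j then 1 else 0)"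
    if "i < n" "j < n" for i j
  proof -
    \<comment> \<open>Writes z_i z_j as a product over all coordinates, so that independence applies
      at once; the factor is w^2, w or 1, and the case i = j needs no separate product.\<close>
    define f where "f k w = (if k = i then w else 1) * (if k = j then w else 1)" for k :: nat and w :: real
    have "f k = (if k = i \<and> k = j then (\<lambda>w. w\<^sup>2) else if k = i \<or> k = j then (\<lambda>w. w) else (\<lambda>w. 1))" for k
      by (auto simp: f_def fun_eq_iff power2_eq_square)
    then have f: "integrable \<rho> (f k)"
      "(\<integral>w. f k w \<partial>\<rho>) = (if k = i \<and> k = j then 1 else if k = i \<or> k = j then 0 else 1)" for k
      using integrable_power[of 1] integrable_power[of 2] by (simp_all add: mean_0 var_1 prob_space)
    have zz: "z i * z j = (\<Prod>k<n. f k (z k))" for z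
      using that by (simp add: f_def prod.distrib prod.delta)
    have "(\<Prod>k<n. \<integral>w. f k w \<partial>\<rho>) = (if i = j then 1 else 0)"
      using that unfolding f(2) by (auto intro!: prod.neutral simp: prod_zero_iff)
    then show ?thesis
      unfolding zz has_bochner_integral_iff
      using P.product_integrable_prod[of "{..<n}" f] P.product_integral_prod[of "{..<n}" f] f(1) by simp
  qed
  have "has_bochner_integral (PiM {..<n} (\<lambda>_. \<rho>)) (\<lambda>z. \<Sum>i<n. \<Sum>j<n. z i * z j) (\<Sum>i<n. \<Sum>j<n. if i = j then 1 else 0)"
    by (intro has_bochner_integral_sum ij) auto
  then show ?thesis by (simp add: power2_eq_square sum_product)
qed

lemma PiM_sum_chebyshev:
  assumes "c > 0"
  shows "measure (PiM {..<n} (\<lambda>_. \<rho>)) {z \<in> space (PiM {..<n} (\<lambda>_. \<rho>)). c < \<bar>\<Sum>i<n. z i\<bar>} \<le> real n / c\<^sup>2"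
proof -
  let ?P = "PiM {..<n} (\<lambda>_. \<rho>)"
  interpret P: prob_space ?P by (intro prob_space_PiM prob_space_axioms)
  note m = PiM_sum_second_moment[of n, unfolded has_bochner_integral_iff]
  have "measure ?P {z \<in> space ?P. c < \<bar>\<Sum>i<n. z i\<bar>} \<le> measure ?P {z \<in> space ?P. c\<^sup>2 \<le> (\<Sum>i<n. z i)\<^sup>2}"
  proof (rule P.finite_measure_mono)
    show "{z \<in> space ?P. c < \<bar>\<Sum>i<n. z i\<bar>} \<subseteq> {z \<in> space ?P. c\<^sup>2 \<le> (\<Sum>i<n. z i)\<^sup>2}"
      using assms by (auto simp: abs_le_square_iff[symmetric])
  qed (use m in measurable)
  also have "\<dots> \<le> (\<integral>z. (\<Sum>i<n. z i)\<^sup>2 \<partial>?P) / c\<^sup>2"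
    using m assms by (intro integral_Markov_inequality_measure[where A="{}"]) auto
  finally show ?thesis using m by simp
qed

end

lemma abs_sqrt_minus_1_le: "0 \<le> x \<Longrightarrow> \<bar>sqrt x - 1\<bar> \<le> \<bar>x - 1\<bar>"
proof -
  assume x: "0 \<le> x"
  then have "x - 1 = (sqrt x - 1) * (sqrt x + 1)" by (simp add: algebra_simps)
  then have "\<bar>x - 1\<bar> = \<bar>sqrt x - 1\<bar> * (sqrt x + 1)" using x by (simp only: abs_mult) simp
  also have "\<dots> \<ge> \<bar>sqrt x - 1\<bar> * 1" using x by (intro mult_left_mono) auto
  finally show ?thesis by simp
qed

text \<open>In the coordinate \<open>dt \<theta>\<close> each observation has Fisher information d''
  / (sqrt d'')^2 = 1. This variance-stabilizing parametrization is what frees the score from the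
  intercept.\<close>

locale vst_family = smooth_exponential_family +
  fixes dt :: "real \<Rightarrow> real"
  assumes antiderivative: "\<And>\<theta>. \<theta> \<in> \<Theta> \<Longrightarrow> (dt has_real_derivative sqrt (d2 \<theta>)) (at \<theta>)"
    and inj_dt: "inj_on dt \<Theta>"
begin

lemma segment_\<Theta>: "\<theta> \<in> \<Theta> \<Longrightarrow> \<theta>' \<in> \<Theta> \<Longrightarrow> \<theta> \<le> x \<Longrightarrow> x \<le> \<theta>' \<Longrightarrow> x \<in> \<Theta>"
  using mem_is_interval_1_I[OF interval_\<Theta>] by blast

text \<open>A degenerate statistic would make \<open>dt\<close> constant.\<close>

lemma d2_pos:
  assumes "\<theta> \<in> \<Theta>"
  shows "d2 \<theta> > 0"
proof (rule ccontr)
  assume "\<not> d2 \<theta> > 0"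
  then have z: "d2 x = 0" if "x \<in> \<Theta>" for x
    using d2_eq_0_imp[OF assms _ that] d2_nonneg[OF assms] by simp
  obtain r where r: "r > 0" "\<And>s. \<bar>s\<bar> \<le> r \<Longrightarrow> \<theta> + s \<in> \<Theta>" using ball_\<Theta>[OF assms] by blast
  have in_\<Theta>: "x \<in> \<Theta>" if "\<theta> \<le> x" "x \<le> \<theta> + r" for x using r(2)[of "x - \<theta>"] that by simp
  have "dt (\<theta> + r) = dt \<theta>"
  proof (rule DERIV_isconst_end[where f=dt and a=\<theta> and b="\<theta> + r"])
    show "continuous_on {\<theta>..\<theta> + r} dt"
      by (intro continuous_at_imp_continuous_on ballI DERIV_isCont[OF antiderivative] in_\<Theta>) auto
    show "(dt has_real_derivative 0) (at x)" if "\<theta> < x" "x < \<theta> + r" for x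
      using antiderivative[OF in_\<Theta>[of x]] z[OF in_\<Theta>[of x]] that by simp
  qed (use r in simp)
  then show False using inj_dt in_\<Theta>[of "\<theta> + r"] assms r(1) by (auto dest: inj_onD)
qed

lemma d1_strict_mono:
  assumes "\<theta> \<in> \<Theta>" "\<theta>' \<in> \<Theta>" "\<theta> < \<theta>'"
  shows "d1 \<theta> < d1 \<theta>'"
proof (rule DERIV_pos_imp_increasing[OF assms(3)])
  fix x assume "\<theta> \<le> x" "x \<le> \<theta>'"
  then have "x \<in> \<Theta>" using segment_\<Theta> assms by blast
  then show "\<exists>y. (d1 has_real_derivative y) (at x) \<and> 0 < y" using DERIV_d(2) d2_pos by blast
qed

lemma standardized_law:
  assumes \<theta>: "\<theta> \<in> \<Theta>"
  obtains r where "r > 0" "std_noise (distr (law \<theta>) borel (\<lambda>y. (T y - d1 \<theta>) / sqrt (d2 \<theta>))) r"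
proof -
  interpret L: prob_space "law \<theta>" by (rule prob_law[OF \<theta>])
  define \<sigma> where "\<sigma> = sqrt (d2 \<theta>)"
  have \<sigma>: "\<sigma> > 0" "\<sigma>\<^sup>2 = d2 \<theta>" using d2_pos[OF \<theta>] by (auto simp: \<sigma>_def)
  let ?Z = "\<lambda>y. (T y - d1 \<theta>) / \<sigma>"
  obtain r where r: "r > 0" "integrable (law \<theta>) (\<lambda>y. exp (r * \<bar>T y\<bar>))"
    using exp_moment[OF \<theta>] by blast
  have "integrable (law \<theta>) (\<lambda>y. exp (r * \<sigma> * \<bar>?Z y\<bar>))"
  proof (rule Bochner_Integration.integrable_bound)
    show "integrable (law \<theta>) (\<lambda>y. exp (r * \<bar>d1 \<theta>\<bar>) * exp (r * \<bar>T y\<bar>))" using r(2) by simp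
    show "AE y in law \<theta>. norm (exp (r * \<sigma> * \<bar>?Z y\<bar>)) \<le> norm (exp (r * \<bar>d1 \<theta>\<bar>) * exp (r * \<bar>T y\<bar>))"
    proof (rule AE_I2)
      fix y
      have "r * \<sigma> * \<bar>?Z y\<bar> = r * \<bar>T y - d1 \<theta>\<bar>" using \<sigma>(1) by (simp add: abs_divide)
      also have "\<dots> \<le> r * \<bar>d1 \<theta>\<bar> + r * \<bar>T y\<bar>"
        unfolding distrib_left[symmetric] using r(1) by (intro mult_left_mono) auto
      finally show "norm (exp (r * \<sigma> * \<bar>?Z y\<bar>)) \<le> norm (exp (r * \<bar>d1 \<theta>\<bar>) * exp (r * \<bar>T y\<bar>))"
        by (simp add: exp_add[symmetric])
    qed
  qed measurable
  then have cube: "integrable (law \<theta>) (\<lambda>y. \<bar>?Z y\<bar> ^ 3 * exp (r * \<sigma> / 2 * \<bar>?Z y\<bar>))"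
    using L.mgf_cubic_approx(1)[of ?Z "r * \<sigma>"] r(1) \<sigma>(1) by simp
  \<comment> \<open>Standardizing multiplies the exponential rate by \<sigma>, and the cubic factor
    uses up half of it.\<close>
  have "std_noise (distr (law \<theta>) borel ?Z) (r * \<sigma> / 2)"
  proof (rule std_noise.intro[OF L.prob_space_distr std_noise_axioms.intro])
    show "integrable (distr (law \<theta>) borel ?Z) (\<lambda>w. \<bar>w\<bar> ^ 3 * exp (r * \<sigma> / 2 * \<bar>w\<bar>))"
      using cube by (subst integrable_distr_eq) auto
    show "(\<integral>w. w \<partial>distr (law \<theta>) borel ?Z) = 0"
      using law_moments[OF \<theta>] L.prob_space by (subst integral_distr) auto
    have "(\<integral>y. (?Z y)\<^sup>2 \<partial>law \<theta>) = (\<integral>y. (T y - d1 \<theta>)\<^sup>2 / \<sigma>\<^sup>2 \<partial>law \<theta>)" by (simp add: power_divide)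
    also have "\<dots> = 1" using law_variance[OF \<theta>] \<sigma> d2_pos[OF \<theta>] by simp
    finally show "(\<integral>w. w\<^sup>2 \<partial>distr (law \<theta>) borel ?Z) = 1" by (subst integral_distr) auto
  qed (use r(1) \<sigma>(1) in auto)
  then show ?thesis using that[of "r * \<sigma> / 2"] r(1) \<sigma>(1) unfolding \<sigma>_def by simp
qed

section \<open>Likelihood equation, scale estimate and score\<close>

lemma avg_nll_const:
  "n \<ge> 1 \<Longrightarrow> avg_nll T d b n (\<lambda>_. \<theta>) y = d \<theta> - \<theta> * ((\<Sum>i<n. T (y i)) / n) - (\<Sum>i<n. b (y i)) / n"
  by (simp add: avg_nll_def expfam_density_def sum.distrib sum_subtractf sum_distrib_left[symmetric] field_simps)

text \<open>The derivative of the objective is \<open>d1\<close> minus the sample mean of T, and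
  \<open>d1\<close> is strictly increasing, so a root is the unique minimizer; the mean value
  theorem on either side of \<open>s\<close> makes the inequality strict.\<close>

lemma stationary_arg_min:
  assumes n: "n \<ge> 1" and s: "s \<in> \<Theta>" "d1 s = (\<Sum>i<n. T (y i)) / n" 
  shows "is_arg_min (\<lambda>\<theta>. avg_nll T d b n (\<lambda>_. \<theta>) y) (\<lambda>\<theta>. \<theta> \<in> \<Theta>) e \<longleftrightarrow> e = s"
proof -
  let ?k = "\<lambda>\<theta>. avg_nll T d b n (\<lambda>_. \<theta>) y"
  have dk: "(?k has_real_derivative d1 x - d1 s) (at x)" if "x \<in> \<Theta>" for x
    unfolding avg_nll_const[OF n] s(2)
    by (rule derivative_eq_intros DERIV_d(1)[OF that] refl)+ simp
  have less: "?k s < ?k \<theta>" if \<theta>: "\<theta> \<in> \<Theta>" "\<theta> \<noteq> s" for \<theta>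
  proof (cases "\<theta> < s")
    case True
    have "\<exists>z. \<theta> < z \<and> z < s \<and> ?k s - ?k \<theta> = (s - \<theta>) * (d1 z - d1 s)"
      using True segment_\<Theta>[OF \<theta>(1) s(1)] dk by (intro MVT2) auto
    then obtain z where z: "\<theta> < z" "z < s" "?k s - ?k \<theta> = (s - \<theta>) * (d1 z - d1 s)" by blast
    have "z \<in> \<Theta>" using segment_\<Theta>[OF \<theta>(1) s(1)] z by auto
    then have "(s - \<theta>) * (d1 z - d1 s) < 0" using d1_strict_mono[of z s] s(1) z by (intro mult_pos_neg) auto
    then show ?thesis using z(3) by linarith
  next
    case False
    then have "s < \<theta>" using \<theta>(2) by simp
    then have "\<exists>z. s < z \<and> z < \<theta> \<and> ?k \<theta> - ?k s = (\<theta> - s) * (d1 z - d1 s)"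
      using segment_\<Theta>[OF s(1) \<theta>(1)] dk by (intro MVT2) auto
    then obtain z where z: "s < z" "z < \<theta>" "?k \<theta> - ?k s = (\<theta> - s) * (d1 z - d1 s)" by blast
    have "z \<in> \<Theta>" using segment_\<Theta>[OF s(1) \<theta>(1)] z by auto
    then have "(\<theta> - s) * (d1 z - d1 s) > 0" using d1_strict_mono[of s z] s(1) z by (intro mult_pos_pos) auto
    then show ?thesis using z(3) by linarith
  qed
  show ?thesis unfolding is_arg_min_linorder using less s(1) by (metis less_imp_le linorder_not_less order_refl)
qed

text \<open>A deterministic statement. On a compact interval of radius h around \<theta>0,
  \<open>d2\<close> is at least c0 > 0, so \<open>d1\<close> grows at rate c0 and crosses the sample
  mean within \<tau> / c0 of \<theta>0, provided \<tau> <= c0 h. A minimizer therefore exists and is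
  unique, which pins down \<open>est\<close> whatever it may be on samples without a minimizer. A
  Lipschitz constant K of \<open>d2\<close> then gives C = K / c0^2.\<close>

lemma mle_scale_close:
  assumes \<theta>0: "\<theta>0 \<in> \<Theta>"
  obtains C \<delta> where "C \<ge> 0" "\<delta> > 0"
    "\<And>n y est \<tau>. n \<ge> 1 \<Longrightarrow> 0 \<le> \<tau> \<Longrightarrow> \<tau> \<le> \<delta> \<Longrightarrow> \<bar>(\<Sum>i<n. T (y i)) / n - d1 \<theta>0\<bar> \<le> \<tau> \<Longrightarrow>
      ((\<exists>\<theta>. is_arg_min (\<lambda>\<theta>. avg_nll T d b n (\<lambda>_. \<theta>) y) (\<lambda>\<theta>. \<theta> \<in> \<Theta>) \<theta>) \<longrightarrow>
         is_arg_min (\<lambda>\<theta>. avg_nll T d b n (\<lambda>_. \<theta>) y) (\<lambda>\<theta>. \<theta> \<in> \<Theta>) est) \<Longrightarrow>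
      \<bar>sqrt (d2 \<theta>0 / d2 est) - 1\<bar> \<le> C * \<tau>"
proof -
  obtain h where h: "h > 0" "\<And>s. \<bar>s\<bar> \<le> h \<Longrightarrow> \<theta>0 + s \<in> \<Theta>" using ball_\<Theta>[OF \<theta>0] by blast
  let ?I = "{\<theta>0 - h..\<theta>0 + h}"
  have I: "x \<in> \<Theta>" if "x \<in> ?I" for x using h(2)[of "x - \<theta>0"] that by auto
  have "continuous_on ?I d2" by (intro continuous_at_imp_continuous_on ballI DERIV_isCont[OF DERIV_d(3)] I)
  then obtain x0 where x0: "x0 \<in> ?I" "\<And>x. x \<in> ?I \<Longrightarrow> d2 x0 \<le> d2 x"
    using continuous_attains_inf[of ?I d2] h(1) by auto
  define c0 where "c0 = d2 x0"
  have c0: "c0 > 0" "\<And>x. x \<in> ?I \<Longrightarrow> c0 \<le> d2 x" using d2_pos[OF I[OF x0(1)]] x0 by (auto simp: c0_def)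
  have "continuous_on ?I (\<lambda>x. \<bar>d3 x\<bar>)"
    by (intro continuous_intros continuous_on_subset[OF continuous_d3]) (use I in auto)
  then obtain x1 where x1: "x1 \<in> ?I" "\<And>x. x \<in> ?I \<Longrightarrow> \<bar>d3 x\<bar> \<le> \<bar>d3 x1\<bar>"
    using continuous_attains_sup[of ?I "\<lambda>x. \<bar>d3 x\<bar>"] h(1) by auto
  define K where "K = \<bar>d3 x1\<bar>"
  have K: "K \<ge> 0" by (simp add: K_def)
  have lip: "\<bar>d2 x - d2 \<theta>0\<bar> \<le> K * \<bar>x - \<theta>0\<bar>" if "x \<in> ?I" for x
    using field_differentiable_bound[of ?I d2 d3 K x \<theta>0] x1 that h(1) DERIV_d(3)[OF I, THEN has_field_derivative_at_within]
    unfolding K_def by auto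
  show ?thesis
  proof (rule that[of "K / c0\<^sup>2" "c0 * h"])
    show "0 \<le> K / c0\<^sup>2" "0 < c0 * h" using K c0 h by auto
  next
    fix n y est \<tau>
    assume n: "n \<ge> 1" and \<tau>: "0 \<le> \<tau>" "\<tau> \<le> c0 * h" and mean: "\<bar>(\<Sum>i<n. T (y i)) / n - d1 \<theta>0\<bar> \<le> \<tau>"
      and est: "(\<exists>\<theta>. is_arg_min (\<lambda>\<theta>. avg_nll T d b n (\<lambda>_. \<theta>) y) (\<lambda>\<theta>. \<theta> \<in> \<Theta>) \<theta>) \<longrightarrow>
         is_arg_min (\<lambda>\<theta>. avg_nll T d b n (\<lambda>_. \<theta>) y) (\<lambda>\<theta>. \<theta> \<in> \<Theta>) est"
    define s where "s = \<tau> / c0"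
    have s: "0 \<le> s" "s \<le> h" "c0 * s = \<tau>" using \<tau> c0(1) by (auto simp: s_def field_simps)
    have incr: "c0 * (v - u) \<le> d1 v - d1 u" if "u \<in> ?I" "v \<in> ?I" "u \<le> v" for u v
    proof (cases "u = v")
      case False
      then have "\<exists>z. u < z \<and> z < v \<and> d1 v - d1 u = (v - u) * d2 z"
        using that DERIV_d(2)[OF I] by (intro MVT2) auto
      then obtain z where z: "u < z" "z < v" "d1 v - d1 u = (v - u) * d2 z" by blast
      have "(v - u) * c0 \<le> (v - u) * d2 z" using that z c0(2) by (intro mult_left_mono) auto
      then show ?thesis using z by (simp add: mult.commute)
    qed simp
    have "d1 (\<theta>0 - s) \<le> (\<Sum>i<n. T (y i)) / n" "(\<Sum>i<n. T (y i)) / n \<le> d1 (\<theta>0 + s)"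
      using incr[of "\<theta>0 - s" \<theta>0] incr[of \<theta>0 "\<theta>0 + s"] s mean by auto
    moreover have "continuous_on {\<theta>0 - s..\<theta>0 + s} d1"
      using s by (intro continuous_at_imp_continuous_on ballI DERIV_isCont[OF DERIV_d(2)] I) auto
    ultimately obtain e where e: "\<theta>0 - s \<le> e" "e \<le> \<theta>0 + s" "d1 e = (\<Sum>i<n. T (y i)) / n"
      using IVT'[of d1 "\<theta>0 - s" _ "\<theta>0 + s"] s by auto
    have eI: "e \<in> ?I" using e s by auto
    note min = stationary_arg_min[OF n I[OF eI] e(3)]
    have est_e: "est = e" using est unfolding min by blast
    have "\<bar>sqrt (d2 \<theta>0 / d2 e) - 1\<bar> \<le> \<bar>d2 \<theta>0 / d2 e - 1\<bar>"
      using d2_pos[OF \<theta>0] d2_pos[OF I[OF eI]] by (intro abs_sqrt_minus_1_le) auto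
    also have "\<dots> = \<bar>d2 e - d2 \<theta>0\<bar> / d2 e"
      using d2_pos[OF I[OF eI]] by (simp add: field_simps abs_minus_commute)
    also have "\<dots> \<le> (K * s) / c0"
    proof (intro frac_le)
      have "K * \<bar>e - \<theta>0\<bar> \<le> K * s" using e K by (intro mult_left_mono) auto
      then show "\<bar>d2 e - d2 \<theta>0\<bar> \<le> K * s" using lip[OF eI] by simp
    qed (use c0 eI K s in auto)
    also have "\<dots> = K / c0\<^sup>2 * \<tau>" by (simp add: s_def power2_eq_square)
    finally show "\<bar>sqrt (d2 \<theta>0 / d2 est) - 1\<bar> \<le> K / c0\<^sup>2 * \<tau>" unfolding est_e .
  qed
qed

context
  fixes g :: "real \<Rightarrow> real"
  assumes g: "g = the_inv_into \<Theta> dt"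
begin

lemma link_dt: "\<theta> \<in> \<Theta> \<Longrightarrow> g (dt \<theta>) = \<theta>"
  unfolding g by (rule the_inv_into_f_f[OF inj_dt])

lemma intercept_of_link: "\<theta> \<in> \<Theta> \<Longrightarrow> the_inv_into (dt ` \<Theta>) g \<theta> = dt \<theta>"
proof -
  assume \<theta>: "\<theta> \<in> \<Theta>"
  have "inj_on g (dt ` \<Theta>)" by (rule inj_onI) (auto simp: link_dt)
  then show ?thesis using the_inv_into_f_f[of g "dt ` \<Theta>" "dt \<theta>"] link_dt[OF \<theta>] \<theta> by simp
qed

lemma DERIV_link:
  assumes \<theta>: "\<theta> \<in> \<Theta>"
  shows "(g has_real_derivative inverse (sqrt (d2 \<theta>))) (at (dt \<theta>))"
proof -
  have "(g has_derivative (*) (inverse (sqrt (d2 \<theta>)))) (at (dt \<theta>))"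
  proof (rule has_derivative_inverse_strong[OF open_\<Theta> \<theta>])
    show "continuous_on \<Theta> dt" by (intro continuous_at_imp_continuous_on ballI DERIV_isCont[OF antiderivative])
    show "(dt has_derivative (*) (sqrt (d2 \<theta>))) (at \<theta>)"
      using antiderivative[OF \<theta>] by (simp add: has_field_derivative_def)
    show "(*) (sqrt (d2 \<theta>)) \<circ> (*) (inverse (sqrt (d2 \<theta>))) = id"
      using d2_pos[OF \<theta>] by (simp add: fun_eq_iff)
  qed (rule link_dt)
  then show ?thesis by (simp add: has_field_derivative_def)
qed

text \<open>The columns of the design sum to zero, which removes the \<open>d1\<close> term of the score.\<close>

lemma zero_threshold_eq:
  assumes \<theta>: "\<theta> \<in> \<Theta>" and centred: "\<And>j. j < p \<Longrightarrow> (\<Sum>i<n. x i j) = 0"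
  shows "zero_threshold id (avg_nll T d b n) g p x (the_inv_into (dt ` \<Theta>) g \<theta>) y
    = sup_norm p (\<lambda>j. (\<Sum>i<n. x i j * T (y i)) / (real n * sqrt (d2 \<theta>)))"
proof -
  let ?s = "inverse (sqrt (d2 \<theta>))"
  have pd: "\<bar>partial_deriv j (\<lambda>\<beta>. composite_loss id (avg_nll T d b n) g p x \<beta> (dt \<theta>) y) (\<lambda>_. 0)\<bar>
    = \<bar>(\<Sum>i<n. x i j * T (y i)) / (real n * sqrt (d2 \<theta>))\<bar>" if j: "j < p" for j
  proof -
    have lin: "lin_pred p x (dt \<theta>) ((\<lambda>_. 0)(j := t)) i = dt \<theta> + x i j * t" for i t
      using j by (simp add: lin_pred_def if_distrib[of "\<lambda>u. x i _ * u"] sum.delta cong: if_cong)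
    have dg: "((\<lambda>t. g (dt \<theta> + x i j * t)) has_real_derivative ?s * x i j) (at 0)" for i
      by (rule DERIV_chain2[where f=g and g="\<lambda>t. dt \<theta> + x i j * t"])
        (use DERIV_link[OF \<theta>] in \<open>auto intro!: derivative_eq_intros\<close>)
    have dd: "((\<lambda>t. d (g (dt \<theta> + x i j * t))) has_real_derivative d1 \<theta> * (?s * x i j)) (at 0)" for i
      by (rule DERIV_chain2[where f=d and g="\<lambda>t. g (dt \<theta> + x i j * t)", OF _ dg])
        (use DERIV_d(1)[OF \<theta>] link_dt[OF \<theta>] in simp)
    have "((\<lambda>t. - (\<Sum>i<n. g (dt \<theta> + x i j * t) * T (y i) - d (g (dt \<theta> + x i j * t)) + b (y i)) / real n)
      has_real_derivative - (\<Sum>i<n. ?s * x i j * T (y i) - d1 \<theta> * (?s * x i j)) / real n) (at 0)"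
      by (intro DERIV_cdivide DERIV_minus DERIV_sum) (auto intro!: derivative_eq_intros dg dd)
    moreover have "(\<Sum>i<n. ?s * x i j * T (y i) - d1 \<theta> * (?s * x i j)) = ?s * (\<Sum>i<n. x i j * T (y i)) - d1 \<theta> * ?s * (\<Sum>i<n. x i j)"
      by (simp add: sum_subtractf sum_distrib_left mult.assoc)
    ultimately have "((\<lambda>t. - (\<Sum>i<n. g (dt \<theta> + x i j * t) * T (y i) - d (g (dt \<theta> + x i j * t)) + b (y i)) / real n)
      has_real_derivative - (?s * (\<Sum>i<n. x i j * T (y i))) / real n) (at 0)" using centred[OF j] by simp
    then have "partial_deriv j (\<lambda>\<beta>. composite_loss id (avg_nll T d b n) g p x \<beta> (dt \<theta>) y) (\<lambda>_. 0)
      = - (?s * (\<Sum>i<n. x i j * T (y i))) / real n"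
      unfolding partial_deriv_def composite_loss_def avg_nll_def expfam_density_def id_def ln_exp lin
      by (rule DERIV_imp_deriv)
    then show ?thesis by (simp add: abs_mult abs_divide divide_inverse mult_ac)
  qed
  show ?thesis
    unfolding zero_threshold_def sup_norm_def intercept_of_link[OF \<theta>]
    using pd by (intro arg_cong[where f=Max] image_cong) auto
qed

end
end

section \<open>Kolmogorov distance for a fixed sample size\<close>

lemma sup_norm_le_iff: "p \<ge> 1 \<Longrightarrow> sup_norm p v \<le> t \<longleftrightarrow> (\<forall>j<p. \<bar>v j\<bar> \<le> t)"
  unfolding sup_norm_def by (subst Max_le_iff) (auto simp: lessThan_empty_iff)

text \<open>Each column appears with both signs, so that the maximum of absolute values is a maximum
  of linear forms; indices from \<open>p\<close> on carry the negatives. The factor 1 / sqrt n gives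
  the columns norm 1.\<close>

definition signed_columns :: "nat \<Rightarrow> nat \<Rightarrow> (nat \<Rightarrow> nat \<Rightarrow> real) \<Rightarrow> nat \<Rightarrow> nat \<Rightarrow> real" where
  "signed_columns n p x j i = (if j < p then x i j else - x i (j - p)) / sqrt n"

lemma soft_max_design_signed:
  assumes n: "n \<ge> 1" and x: "standardized_design n p x B" and \<kappa>: "0 < \<kappa>" "\<kappa> \<le> \<beta>"
  shows "soft_max_design {..<2 * p} \<beta> (signed_columns n p x) n \<kappa> (B / sqrt n)"
proof -
  have p: "p \<ge> 1" and B: "\<And>i j. i < n \<Longrightarrow> j < p \<Longrightarrow> \<bar>x i j\<bar> \<le> B"
    and sq: "\<And>j. j < p \<Longrightarrow> (\<Sum>i<n. (x i j)\<^sup>2) = real n"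
    using x by (auto simp: standardized_design_def)
  have B0: "0 \<le> B" using B[of 0 0] n p by (auto intro: order_trans[OF abs_ge_zero])
  show ?thesis
  proof unfold_locales
    show "\<bar>signed_columns n p x j i\<bar> \<le> B / sqrt n" if "j \<in> {..<2 * p}" "i < n" for j i
      using B[of i "if j < p then j else j - p"] that
      by (auto simp: signed_columns_def abs_divide intro!: divide_right_mono)
    show "(\<Sum>i<n. (signed_columns n p x j i)\<^sup>2) = 1" if "j \<in> {..<2 * p}" for j
    proof -
      let ?j = "if j < p then j else j - p"
      have "(\<Sum>i<n. (signed_columns n p x j i)\<^sup>2) = (\<Sum>i<n. (x i ?j)\<^sup>2) / n"
        by (simp add: signed_columns_def power_divide sum_divide_distrib)
      moreover have "?j < p" using that by auto
      ultimately show ?thesis using sq[of ?j] n by simp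
    qed
  qed (use p \<kappa> B0 in \<open>auto simp: lessThan_empty_iff\<close>)
qed

lemma exceed_signed:
  assumes "soft_max_design {..<2 * p} \<beta> (signed_columns n p x) n \<kappa> \<eta>"
  shows "soft_max_design.exceed {..<2 * p} (signed_columns n p x) n t
    = {z \<in> extensional {..<n}. \<exists>j<p. t < \<bar>\<Sum>i<n. x i j * z i\<bar> / sqrt n}"
proof -
  interpret soft_max_design "{..<2 * p}" \<beta> "signed_columns n p x" n \<kappa> \<eta> by (rule assms)
  have lin: "lin z j = (\<Sum>i<n. x i j * z i) / sqrt n" "lin z (j + p) = - (\<Sum>i<n. x i j * z i) / sqrt n" if "j < p" for z j
    using that by (simp_all add: lin_def signed_columns_def sum_divide_distrib sum_negf)
  have "(\<exists>j<2 * p. t < lin z j) \<longleftrightarrow> (\<exists>j<p. t < \<bar>\<Sum>i<n. x i j * z i\<bar> / sqrt n)" for z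
  proof
    assume "\<exists>j<2 * p. t < lin z j"
    then obtain j where j: "j < 2 * p" "t < lin z j" by blast
    show "\<exists>j<p. t < \<bar>\<Sum>i<n. x i j * z i\<bar> / sqrt n"
    proof (cases "j < p")
      case True
      have "lin z j \<le> \<bar>\<Sum>i<n. x i j * z i\<bar> / sqrt n"
        unfolding lin(1)[OF True] by (intro divide_right_mono) auto
      then show ?thesis using j True by (intro exI[of _ j]) auto
    next
      case False
      then have p: "j - p < p" "j = (j - p) + p" using j by auto
      have "lin z j \<le> \<bar>\<Sum>i<n. x i (j - p) * z i\<bar> / sqrt n"
        by (subst p(2), subst lin(2)[OF p(1)]) (intro divide_right_mono, auto)
      then show ?thesis using j p by (intro exI[of _ "j - p"]) auto
    qed
  next
    assume "\<exists>j<p. t < \<bar>\<Sum>i<n. x i j * z i\<bar> / sqrt n"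
    then obtain j where j: "j < p" "t < \<bar>\<Sum>i<n. x i j * z i\<bar> / sqrt n" by blast
    then have "t < lin z j \<or> t < lin z (j + p)" unfolding lin[OF j(1)] by (auto simp: abs_if split: if_splits)
    moreover have "j < 2 * p" "j + p < 2 * p" using j by auto
    ultimately show "\<exists>j<2 * p. t < lin z j" by blast
  qed
  then show ?thesis unfolding exceed_def by (simp add: Bex_def)
qed

text \<open>The pivotal limit: the law of \<open>\<Lambda>\<close> for standard normal responses of known variance.\<close>

definition reference_law :: "nat \<Rightarrow> nat \<Rightarrow> (nat \<Rightarrow> nat \<Rightarrow> real) \<Rightarrow> real measure" where
  "reference_law n p x = distr (PiM {..<n} (\<lambda>_. std_normal)) borel (\<lambda>z. sup_norm p (\<lambda>j. (\<Sum>i<n. x i j * z i) / real n))"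

lemma measurable_reference:
  "(\<lambda>z. sup_norm p (\<lambda>j. (\<Sum>i<n. x i j * z i) / real n)) \<in> borel_measurable (PiM {..<n} (\<lambda>_. std_normal))"
  unfolding sup_norm_def
  by (intro borel_measurable_Max borel_measurable_abs borel_measurable_divide borel_measurable_sum borel_measurable_times)
    (auto intro!: measurable_compose[OF measurable_component_singleton])

lemma real_distribution_reference: "real_distribution (reference_law n p x)"
proof -
  interpret prob_space "PiM {..<n} (\<lambda>_. std_normal)" by (intro prob_space_PiM std_normal.prob_space_axioms)
  show ?thesis unfolding reference_law_def by (intro real_distribution_distr measurable_reference)
qed

text \<open>The score is divided by n but the signed columns only by sqrt n, so the threshold t
  corresponds to sqrt n t.\<close>

lemma cdf_reference:
  assumes D: "soft_max_design {..<2 * p} \<beta> (signed_columns n p x) n \<kappa> \<eta>" and n: "n \<ge> 1" and p: "p \<ge> 1"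
  shows "cdf (reference_law n p x) t
    = 1 - measure (PiM {..<n} (\<lambda>_. std_normal)) (soft_max_design.exceed {..<2 * p} (signed_columns n p x) n (sqrt n * t))"
proof -
  interpret D: soft_max_design "{..<2 * p}" \<beta> "signed_columns n p x" n \<kappa> \<eta> by (rule D)
  let ?G = "PiM {..<n} (\<lambda>_. std_normal)"
  interpret G: prob_space ?G by (intro prob_space_PiM std_normal.prob_space_axioms)
  have sp: "space ?G = extensional {..<n}" by (simp add: space_PiM PiE_UNIV_domain PiE_def)
  have "cdf (reference_law n p x) t = measure ?G ((\<lambda>z. sup_norm p (\<lambda>j. (\<Sum>i<n. x i j * z i) / real n)) -` {..t} \<inter> space ?G)"
    unfolding cdf_def reference_law_def by (intro measure_distr measurable_reference) auto
  also have "(\<lambda>z. sup_norm p (\<lambda>j. (\<Sum>i<n. x i j * z i) / real n)) -` {..t} \<inter> space ?G = space ?G - D.exceed (sqrt n * t)"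
  proof -
    have "\<bar>u / real n\<bar> \<le> t \<longleftrightarrow> \<not> sqrt n * t < \<bar>u\<bar> / sqrt n" for u
    proof -
      have "\<bar>u / real n\<bar> = \<bar>u\<bar> / sqrt n / sqrt n" by (simp add: abs_divide)
      then show ?thesis unfolding not_less mult.commute[of "sqrt n" t]
        using n by (simp only:) (rule pos_divide_le_eq, simp)
    qed
    then have "sup_norm p (\<lambda>j. (\<Sum>i<n. x i j * z i) / real n) \<le> t \<longleftrightarrow>
        (\<forall>j<p. \<not> sqrt n * t < \<bar>\<Sum>i<n. x i j * z i\<bar> / sqrt n)" for z
      unfolding sup_norm_le_iff[OF p] by (simp only:)
    then show ?thesis unfolding exceed_signed[OF D] sp by blast
  qed
  also have "measure ?G \<dots> = 1 - measure ?G (D.exceed (sqrt n * t))"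
    by (rule G.prob_compl[OF D.sets_exceed]) (simp_all add: std_normal.prob_space_axioms)
  finally show ?thesis .
qed

section \<open>From the noise to the fitted threshold\<close>

context vst_family
begin

lemma compose_law:
  assumes "\<theta> \<in> \<Theta>"
  defines "Z \<equiv> \<lambda>y. (T y - d1 \<theta>) / sqrt (d2 \<theta>)"
  shows "distr (PiM {..<n::nat} (\<lambda>_. law \<theta>)) (PiM {..<n} (\<lambda>_. distr (law \<theta>) borel Z)) (compose {..<n} Z)
    = PiM {..<n} (\<lambda>_. distr (law \<theta>) borel Z)"
    and "compose {..<n::nat} Z \<in> measurable (PiM {..<n} (\<lambda>_. law \<theta>)) (PiM {..<n} (\<lambda>_. distr (law \<theta>) borel Z))"
proof -
  interpret L: prob_space "law \<theta>" by (rule prob_law[OF assms(1)])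
  have Z [measurable]: "Z \<in> borel_measurable (law \<theta>)" unfolding Z_def by simp
  have "distr (law \<theta>) (distr (law \<theta>) borel Z) Z = distr (law \<theta>) borel Z" by (intro distr_cong) auto
  then show "distr (PiM {..<n} (\<lambda>_. law \<theta>)) (PiM {..<n} (\<lambda>_. distr (law \<theta>) borel Z)) (compose {..<n} Z)
    = PiM {..<n} (\<lambda>_. distr (law \<theta>) borel Z)"
    using distr_PiM_finite_prob_space'[of "{..<n}" "\<lambda>_. law \<theta>" "\<lambda>_. distr (law \<theta>) borel Z" Z]
      L.prob_space_axioms L.prob_space_distr[OF Z] by simp
  show "compose {..<n} Z \<in> measurable (PiM {..<n} (\<lambda>_. law \<theta>)) (PiM {..<n} (\<lambda>_. distr (law \<theta>) borel Z))"
    unfolding compose_def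
    by (intro measurable_restrict) (auto intro!: measurable_compose[OF measurable_component_singleton])
qed

text \<open>Nothing is known about \<open>d2\<close> outside \<Theta>, so measurability goes through
  its extension by 0, continuous on the open set \<Theta>.\<close>

lemma measurable_d2_comp:
  assumes f: "f \<in> borel_measurable M" and "\<And>y. y \<in> space M \<Longrightarrow> f y \<in> \<Theta>"
  shows "(\<lambda>y. d2 (f y)) \<in> borel_measurable M"
proof -
  have "(\<lambda>\<theta>. if \<theta> \<in> \<Theta> then d2 \<theta> else 0) \<in> borel_measurable borel"
    using open_\<Theta> by (intro borel_measurable_continuous_on_if continuous_at_imp_continuous_on ballI DERIV_isCont[OF DERIV_d(3)]) auto
  from measurable_compose[OF f this] show ?thesis
    by (rule measurable_cong[THEN iffD1, rotated]) (use assms(2) in auto)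
qed

text \<open>The three error terms are the probability that the sample mean of T is off by more than
  \<tau>, the Gaussian comparison, and the Gaussian tail beyond \<tau>'. A relative scale error
  \<epsilon> shifts a level s by a multiple of \<epsilon> s, so it is handled by one shift \<delta>
  = 2 \<epsilon> \<tau>' up to \<tau>', and by monotonicity above.\<close>

lemma threshold_kolmogorov_bound:
  fixes x :: "nat \<Rightarrow> nat \<Rightarrow> real" and est :: "(nat \<Rightarrow> real) \<Rightarrow> real"
    and n p m k :: nat and B \<kappa> \<beta> \<tau> \<tau>' \<epsilon> r \<theta> t :: real and g :: "real \<Rightarrow> real"
  defines "ref \<equiv> reference_law n p x"
  assumes g: "g = the_inv_into \<Theta> dt" and \<theta>: "\<theta> \<in> \<Theta>" and n: "n \<ge> 1" and x: "standardized_design n p x B"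
    and mle: "common_mle \<nu> \<Theta> T d b n est"
    and \<tau>: "\<tau> > 0" and \<epsilon>: "0 \<le> \<epsilon>" "\<epsilon> \<le> 1 / 2"
    and close: "\<And>y est. \<bar>(\<Sum>i<n. T (y i)) / n - d1 \<theta>\<bar> \<le> \<tau> \<Longrightarrow>
      ((\<exists>\<theta>. is_arg_min (\<lambda>\<theta>. avg_nll T d b n (\<lambda>_. \<theta>) y) (\<lambda>\<theta>. \<theta> \<in> \<Theta>) \<theta>) \<longrightarrow>
         is_arg_min (\<lambda>\<theta>. avg_nll T d b n (\<lambda>_. \<theta>) y) (\<lambda>\<theta>. \<theta> \<in> \<Theta>) est) \<Longrightarrow>
      \<bar>sqrt (d2 \<theta> / d2 est) - 1\<bar> \<le> \<epsilon>"
  defines "\<rho> \<equiv> distr (law \<theta>) borel (\<lambda>y. (T y - d1 \<theta>) / sqrt (d2 \<theta>))"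
  assumes noise: "std_noise \<rho> r" and \<kappa>: "0 < \<kappa>" "\<kappa> \<le> \<beta>" and small: "2 * \<beta> * (B / sqrt n) \<le> r"
    and card: "ln (2 * real p) \<le> \<beta> / \<kappa>" and \<tau>': "\<tau>' > 0"
    and k: "\<kappa> * (2 * \<epsilon> * \<tau>') + 2 * real m + 1 \<le> real k"
  defines "mscale \<equiv> 3 / 2 * sqrt (1 + ln (2 * real p))"
  defines "err \<equiv> (exp_cube_moment \<rho> r + exp_cube_moment std_normal r) / (\<integral>w. exp (- (r * \<bar>w\<bar>)) \<partial>std_normal)
     * (\<kappa> * \<beta>\<^sup>2 * (B / sqrt n) * harm n) + 2 * exp (- real m) + 2 * real k * mscale / \<kappa>"
  defines "P \<equiv> PiM {..<n} (\<lambda>_. law \<theta>)"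
  shows "\<bar>measure P {y \<in> space P. zero_threshold id (avg_nll T d b n) g p x (the_inv_into (dt ` \<Theta>) g (est y)) y \<le> t} - cdf ref t\<bar>
    \<le> d2 \<theta> / (real n * \<tau>\<^sup>2) + err + mscale / \<tau>'"
proof -
  have p: "p \<ge> 1" and centred: "\<And>j. j < p \<Longrightarrow> (\<Sum>i<n. x i j) = 0" using x by (auto simp: standardized_design_def)
  have D: "soft_max_design {..<2 * p} \<beta> (signed_columns n p x) n \<kappa> (B / sqrt n)"
    by (rule soft_max_design_signed[OF n x \<kappa>])
  interpret D: soft_max_design "{..<2 * p}" \<beta> "signed_columns n p x" n \<kappa> "B / sqrt n" by (rule D)
  interpret \<rho>: std_noise \<rho> r by (rule noise)
  interpret P: prob_space P unfolding P_def by (intro prob_space_PiM prob_law \<theta>)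
  interpret R: prob_space "PiM {..<n} (\<lambda>_. \<rho>)" by (intro prob_space_PiM \<rho>.prob_space_axioms)
  interpret G: prob_space "PiM {..<n} (\<lambda>_. std_normal)" by (intro prob_space_PiM std_normal.prob_space_axioms)
  define \<sigma> where "\<sigma> = sqrt (d2 \<theta>)"
  have \<sigma>: "\<sigma> > 0" "\<sigma>\<^sup>2 = d2 \<theta>" using d2_pos[OF \<theta>] by (auto simp: \<sigma>_def)
  define Z where "Z = (\<lambda>y. (T y - d1 \<theta>) / \<sigma>)"
  define zz where "zz = compose {..<n} Z"
  have zz_distr: "distr P (PiM {..<n} (\<lambda>_. \<rho>)) zz = PiM {..<n} (\<lambda>_. \<rho>)"
    and zz_meas: "zz \<in> measurable P (PiM {..<n} (\<lambda>_. \<rho>))"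
    unfolding P_def zz_def \<rho>_def Z_def \<sigma>_def by (rule compose_law[OF \<theta>])+
  have spaceP: "space P = space (PiM {..<n} (\<lambda>_. \<nu>))" unfolding P_def by (simp add: space_PiM)
  have setsP: "sets P = sets (PiM {..<n} (\<lambda>_. \<nu>))" unfolding P_def by (intro sets_PiM_cong) auto
  have est_\<Theta>: "est y \<in> \<Theta>" if "y \<in> space P" for y using mle that unfolding common_mle_def spaceP by blast
  have est_min: "(\<exists>\<theta>. is_arg_min (\<lambda>\<theta>. avg_nll T d b n (\<lambda>_. \<theta>) y) (\<lambda>\<theta>. \<theta> \<in> \<Theta>) \<theta>) \<longrightarrow>
         is_arg_min (\<lambda>\<theta>. avg_nll T d b n (\<lambda>_. \<theta>) y) (\<lambda>\<theta>. \<theta> \<in> \<Theta>) (est y)" if "y \<in> space P" for y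
    using mle that unfolding common_mle_def spaceP by blast
  have est_meas: "est \<in> borel_measurable P"
    using mle unfolding common_mle_def measurable_cong_sets[OF setsP refl] by blast
  \<comment> \<open>True over fitted standard deviation: the only way in which the estimate enters
    the threshold.\<close>
  define R where "R y = \<sigma> / sqrt (d2 (est y))" for y
  have R_pos: "R y > 0" if "y \<in> space P" for y using d2_pos[OF est_\<Theta>[OF that]] \<sigma> by (simp add: R_def)
  have R_meas: "R \<in> borel_measurable P"
  proof -
    have "(\<lambda>y. sqrt (d2 (est y))) \<in> borel_measurable P"
      by (rule measurable_compose[OF measurable_d2_comp[OF est_meas est_\<Theta>]]) simp_all
    then show ?thesis unfolding R_def by (intro borel_measurable_divide borel_measurable_const)
  qed
  let ?M = "\<lambda>j y. \<bar>\<Sum>i<n. x i j * zz y i\<bar> / sqrt n"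
  have zz_i: "zz y i = Z (y i)" if "i < n" for y i using that by (simp add: zz_def compose_def)
  have zz_comp: "(\<lambda>y. zz y i) \<in> borel_measurable P" if "i < n" for i
  proof -
    have "(\<lambda>y. zz y i) \<in> measurable P \<rho>"
      by (rule measurable_compose[OF zz_meas measurable_component_singleton]) (use that in simp)
    then show ?thesis unfolding measurable_cong_sets[OF refl \<rho>.sets_noise] .
  qed
  \<comment> \<open>\<open>W\<close> is exceedance with the fitted scale; \<open>Y\<close> below is
    the same event with the ratio \<open>R\<close> replaced by 1, whose probability is that of a
    pure noise event.\<close>
  define W where "W s = {y \<in> space P. \<exists>j<p. s < R y * ?M j y}" for s
  have M_meas: "?M j \<in> borel_measurable P" for j
    by (intro borel_measurable_divide borel_measurable_abs borel_measurable_sum borel_measurable_times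
        borel_measurable_const zz_comp) simp
  have W_meas: "W s \<in> sets P" for s
  proof -
    have "W s = (\<Union>j<p. {y \<in> space P. s < R y * ?M j y})" unfolding W_def by blast
    also have "\<dots> \<in> sets P"
      using borel_measurable_times[OF R_meas M_meas] by (intro sets.finite_UN) (auto simp: borel_measurable_iff_greater)
    finally show ?thesis .
  qed
  have score: "(\<Sum>i<n. x i j * T (y i)) = \<sigma> * (\<Sum>i<n. x i j * zz y i)" if "j < p" for j y
  proof -
    have "(\<Sum>i<n. x i j * T (y i)) = (\<Sum>i<n. \<sigma> * (x i j * zz y i) + d1 \<theta> * x i j)"
      using \<sigma>(1) by (intro sum.cong) (auto simp: zz_i Z_def field_simps)
    then show ?thesis by (simp add: sum.distrib sum_distrib_left[symmetric] centred[OF that])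
  qed
  have thr: "zero_threshold id (avg_nll T d b n) g p x (the_inv_into (dt ` \<Theta>) g (est y)) y \<le> t \<longleftrightarrow> y \<notin> W (sqrt n * t)"
    if y: "y \<in> space P" for y
  proof -
    have e: "\<bar>(\<Sum>i<n. x i j * T (y i)) / (real n * sqrt (d2 (est y)))\<bar> = R y * ?M j y / sqrt n" if "j < p" for j
      using d2_pos[OF est_\<Theta>[OF y]] \<sigma>(1) by (simp add: score[OF that] R_def abs_mult abs_divide)
    have "zero_threshold id (avg_nll T d b n) g p x (the_inv_into (dt ` \<Theta>) g (est y)) y \<le> t \<longleftrightarrow> (\<forall>j<p. R y * ?M j y / sqrt n \<le> t)"
    proof -
      have zt: "zero_threshold id (avg_nll T d b n) g p x (the_inv_into (dt ` \<Theta>) g (est y)) y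
          = sup_norm p (\<lambda>j. (\<Sum>i<n. x i j * T (y i)) / (real n * sqrt (d2 (est y))))"
        by (rule zero_threshold_eq[OF g est_\<Theta>[OF y] centred])
      show ?thesis unfolding zt sup_norm_le_iff[OF p] by (rule all_cong) (simp only: e)
    qed
    also have "\<dots> \<longleftrightarrow> (\<forall>j<p. R y * ?M j y \<le> sqrt n * t)"
    proof -
      have "u / sqrt n \<le> t \<longleftrightarrow> u \<le> sqrt n * t" for u
        using n by (simp add: pos_divide_le_eq mult.commute)
      then show ?thesis by (simp only:)
    qed
    finally show ?thesis using y unfolding W_def mem_Collect_eq not_less[symmetric] by blast
  qed
  have "{y \<in> space P. zero_threshold id (avg_nll T d b n) g p x (the_inv_into (dt ` \<Theta>) g (est y)) y \<le> t} = space P - W (sqrt n * t)"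
    using thr by blast
  then have lhs: "measure P {y \<in> space P. zero_threshold id (avg_nll T d b n) g p x (the_inv_into (dt ` \<Theta>) g (est y)) y \<le> t}
      = 1 - P.prob (W (sqrt n * t))"
    by (simp only: P.prob_compl[OF W_meas])
  have rhs: "cdf ref t = 1 - G.prob (D.exceed (sqrt n * t))" unfolding ref_def by (rule cdf_reference[OF D n p])
  \<comment> \<open>The deviation of the sample mean of T is \<sigma> / n times the absolute noise
    sum, so \<open>c\<close> is the level at which it equals \<tau>.\<close>
  define c where "c = real n * \<tau> / \<sigma>"
  define bad where "bad = {y \<in> space P. c < \<bar>\<Sum>i<n. zz y i\<bar>}"
  have "(\<lambda>y. \<bar>\<Sum>i<n. zz y i\<bar>) \<in> borel_measurable P"
    by (intro borel_measurable_abs borel_measurable_sum zz_comp) simp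
  then have bad_meas: "bad \<in> sets P" unfolding bad_def by (simp add: borel_measurable_iff_greater)
  define Y where "Y u = {y \<in> space P. zz y \<in> D.exceed u}" for u
  have ex_sets: "D.exceed u \<in> sets (PiM {..<n} (\<lambda>_. \<rho>))" for u
    by (rule D.sets_exceed[OF \<rho>.prob_space_axioms \<rho>.sets_noise])
  have Y_eq: "Y u = zz -` D.exceed u \<inter> space P" for u by (auto simp: Y_def)
  have Y_meas: "Y u \<in> sets P" for u unfolding Y_eq by (rule measurable_sets[OF zz_meas ex_sets])
  have PY: "P.prob (Y u) = R.prob (D.exceed u)" for u
    unfolding Y_eq by (rule measure_distr[OF zz_meas ex_sets[of u], symmetric, unfolded zz_distr])
  have Y_iff: "y \<in> Y u \<longleftrightarrow> y \<in> space P \<and> (\<exists>j<p. u < ?M j y)" for y u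
  proof -
    have "zz y \<in> extensional {..<n}" by (simp add: zz_def)
    then show ?thesis unfolding Y_def exceed_signed[OF D] by blast
  qed
  have bad_le: "P.prob bad \<le> d2 \<theta> / (real n * \<tau>\<^sup>2)"
  proof -
    have c: "c > 0" using n \<tau> \<sigma> by (simp add: c_def)
    have S: "{z \<in> space (PiM {..<n} (\<lambda>_. \<rho>)). c < \<bar>\<Sum>i<n. z i\<bar>} \<in> sets (PiM {..<n} (\<lambda>_. \<rho>))"
    proof -
      have [measurable]: "(\<lambda>z. z i) \<in> borel_measurable (PiM {..<n} (\<lambda>_. \<rho>))" if "i < n" for i
        using measurable_component_singleton[of i "{..<n}" "\<lambda>_. \<rho>"] that
        by (simp add: measurable_cong_sets[OF refl \<rho>.sets_noise])
      show ?thesis by measurable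
    qed
    have "bad = zz -` {z \<in> space (PiM {..<n} (\<lambda>_. \<rho>)). c < \<bar>\<Sum>i<n. z i\<bar>} \<inter> space P"
      using measurable_space[OF zz_meas] by (auto simp: bad_def)
    then have "P.prob bad = R.prob {z \<in> space (PiM {..<n} (\<lambda>_. \<rho>)). c < \<bar>\<Sum>i<n. z i\<bar>}"
      using measure_distr[OF zz_meas S] unfolding zz_distr by simp
    also have "\<dots> \<le> real n / c\<^sup>2" by (rule \<rho>.PiM_sum_chebyshev[OF c])
    also have "\<dots> = d2 \<theta> / (real n * \<tau>\<^sup>2)"
      using n \<sigma>(1) by (simp add: c_def \<sigma>(2)[symmetric] power2_eq_square)
    finally show ?thesis .
  qed
  have good: "\<bar>R y - 1\<bar> \<le> \<epsilon>" if y: "y \<in> space P" "y \<notin> bad" for y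
  proof -
    have "(\<Sum>i<n. T (y i)) = (\<Sum>i<n. \<sigma> * zz y i + d1 \<theta>)"
      using \<sigma>(1) by (intro sum.cong) (auto simp: zz_i Z_def)
    also have "\<dots> = \<sigma> * (\<Sum>i<n. zz y i) + n * d1 \<theta>" by (simp add: sum.distrib sum_distrib_left)
    finally have "\<bar>(\<Sum>i<n. T (y i)) / n - d1 \<theta>\<bar> = \<sigma> / n * \<bar>\<Sum>i<n. zz y i\<bar>"
      using n \<sigma>(1) by (simp add: add_divide_distrib abs_mult)
    also have "\<dots> \<le> \<sigma> / n * c" using y \<sigma>(1) by (intro mult_left_mono) (auto simp: bad_def)
    also have "\<dots> = \<tau>" using \<sigma>(1) n by (simp add: c_def)
    finally have "\<bar>sqrt (d2 \<theta> / d2 (est y)) - 1\<bar> \<le> \<epsilon>" using close est_min[OF y(1)] by blast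
    then show ?thesis by (simp add: R_def \<sigma>_def real_sqrt_divide)
  qed
  define \<delta> where "\<delta> = 2 * \<epsilon> * \<tau>'"
  have card': "ln (real (card {..<2 * p})) \<le> \<beta> / \<kappa>" using card by simp
  have sc: "mscale = 3 / 2 * sqrt (1 + ln (card {..<2 * p}))" by (simp add: mscale_def)
  have cmp: "R.prob (D.exceed u) \<le> G.prob (D.exceed (u + \<delta>)) + err" "G.prob (D.exceed u) \<le> R.prob (D.exceed (u + \<delta>)) + err" for u
    unfolding err_def sc using k unfolding \<delta>_def[symmetric]
    by (rule D.max_comparison[OF noise small card'])+
  have tail: "G.prob (D.exceed \<tau>') \<le> mscale / \<tau>'" unfolding sc by (rule D.gauss_exceed_tail[OF \<tau>'])
  have mid: "P.prob (W s) \<le> G.prob (D.exceed s) + err + P.prob bad" "G.prob (D.exceed s) \<le> P.prob (W s) + err + P.prob bad"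
    if s: "0 \<le> s" "s \<le> \<tau>'" for s
  proof -
    have \<delta>2: "\<delta> = 2 * (\<epsilon> * \<tau>')" by (simp add: \<delta>_def)
    have \<epsilon>\<tau>': "0 \<le> \<epsilon> * \<tau>'" using \<epsilon> \<tau>' by simp
    have es: "\<epsilon> * s \<le> \<epsilon> * \<tau>'" using s \<epsilon> by (intro mult_left_mono)
    have "W s \<subseteq> Y (s - \<delta>) \<union> bad"
    proof
      fix y assume "y \<in> W s"
      then obtain j where y: "y \<in> space P" "j < p" "s < R y * ?M j y" unfolding W_def by blast
      show "y \<in> Y (s - \<delta>) \<union> bad"
      proof (cases "y \<in> bad")
        case False
        have M0: "0 \<le> ?M j y" by simp
        have "R y * ?M j y \<le> (1 + \<epsilon>) * ?M j y" using good[OF y(1) False] M0 by (intro mult_right_mono) linarith+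
        then have "s < (1 + \<epsilon>) * ?M j y" using y by linarith
        \<comment> \<open>Since (1 + \<epsilon>) (1 - \<epsilon>) <= 1, lowering the level by
          \<epsilon> s compensates for a scale ratio of up to 1 + \<epsilon>.\<close>
        moreover have "(1 + \<epsilon>) * (s - \<epsilon> * s) \<le> s" using s \<epsilon> 
          using mult_nonneg_nonneg[of "\<epsilon> * \<epsilon>" s] by (simp add: algebra_simps)
        ultimately have "(1 + \<epsilon>) * (s - \<epsilon> * s) < (1 + \<epsilon>) * ?M j y" by linarith
        then have "s - \<epsilon> * s < ?M j y" using \<epsilon> by (rule_tac mult_left_less_imp_less) (assumption, linarith)
        moreover have "\<epsilon> * s \<le> \<delta>" using es \<delta>2 \<epsilon>\<tau>' by linarith
        ultimately have "s - \<delta> < ?M j y" by linarith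
        then show ?thesis using y(1,2) unfolding Un_iff Y_iff by blast
      qed simp
    qed
    from P.finite_measure_mono[OF this sets.Un[OF Y_meas bad_meas]]
    have "P.prob (W s) \<le> P.prob (Y (s - \<delta>)) + P.prob bad"
      by (rule order_trans[OF _ measure_Un_le[OF Y_meas bad_meas]])
    then show "P.prob (W s) \<le> G.prob (D.exceed s) + err + P.prob bad"
      using cmp(1)[of "s - \<delta>", folded PY] unfolding diff_add_cancel by linarith
    have "Y (s + \<delta>) \<subseteq> W s \<union> bad"
    proof
      fix y assume "y \<in> Y (s + \<delta>)"
      then obtain j where y: "y \<in> space P" "j < p" "s + \<delta> < ?M j y" unfolding Y_iff by blast
      show "y \<in> W s \<union> bad"
      proof (cases "y \<in> bad")
        case False
        \<comment> \<open>(1 - \<epsilon>) (1 + 2 \<epsilon>) >= 1 holds because \<epsilon> <= 1 /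
          2; this is the origin of the factor 2 in \<delta>.\<close>
        have "s \<le> (1 - \<epsilon>) * (s + 2 * (\<epsilon> * s))"
        proof -
          have "0 \<le> (\<epsilon> * s) * (1 - 2 * \<epsilon>)" using s \<epsilon> by (intro mult_nonneg_nonneg) auto
          then show ?thesis by (simp add: algebra_simps)
        qed
        also have "\<dots> \<le> (1 - \<epsilon>) * (s + \<delta>)" using es \<epsilon> by (intro mult_left_mono) (auto simp: \<delta>_def)
        also have "\<dots> < (1 - \<epsilon>) * ?M j y"
        proof (rule mult_strict_left_mono[OF y(3)])
          show "0 < 1 - \<epsilon>" using \<epsilon> by linarith
        qed
        also have "\<dots> \<le> R y * ?M j y"
        proof (rule mult_right_mono)
          show "1 - \<epsilon> \<le> R y" using good[OF y(1) False] by linarith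
        qed simp
        finally show ?thesis using y(1,2) unfolding Un_iff W_def mem_Collect_eq by blast
      qed simp
    qed
    from P.finite_measure_mono[OF this sets.Un[OF W_meas bad_meas]]
    have "P.prob (Y (s + \<delta>)) \<le> P.prob (W s) + P.prob bad"
      by (rule order_trans[OF _ measure_Un_le[OF W_meas bad_meas]])
    then show "G.prob (D.exceed s) \<le> P.prob (W s) + err + P.prob bad"
      using cmp(2)[of s, folded PY] by linarith
  qed
  \<comment> \<open>Adding the two opposite bounds at level 0 shows that the error is nonnegative,
    without inspecting the sign of each term of \<open>err\<close>.\<close>
  have e0: "0 \<le> P.prob bad + err" using mid[of 0] \<tau>' by linarith
  have t0: "0 \<le> mscale / \<tau>'" using tail measure_nonneg[of "PiM {..<n} (\<lambda>_. std_normal)" "D.exceed \<tau>'"] by linarith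
  have ex_sets': "D.exceed u \<in> sets (PiM {..<n} (\<lambda>_. std_normal))" for u
    by (rule D.sets_exceed) (simp_all add: std_normal.prob_space_axioms)
  have bound: "\<bar>P.prob (W s) - G.prob (D.exceed s)\<bar> \<le> P.prob bad + err + mscale / \<tau>'" for s
  proof -
    \<comment> \<open>Below 0 both events are certain; above \<tau>' both probabilities are bounded
      by their values at \<tau>'.\<close>
    consider "s < 0" | "0 \<le> s" "s \<le> \<tau>'" | "\<tau>' < s" by linarith
    then show ?thesis
    proof cases
      case 1
      have p0: "0 < p" using p by linarith
      have "W s = space P"
      proof -
        have "y \<in> W s" if y: "y \<in> space P" for y
        proof -
          have "0 \<le> R y * ?M 0 y" using R_pos[OF y] by (intro mult_nonneg_nonneg) auto
          then have "s < R y * ?M 0 y" using 1 by linarith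
          then show ?thesis using y p0 unfolding W_def by blast
        qed
        then show ?thesis unfolding W_def by blast
      qed
      moreover have "D.exceed s = space (PiM {..<n} (\<lambda>_. std_normal))"
      proof -
        have "s < \<bar>\<Sum>i<n. x i 0 * z i\<bar> / sqrt n" for z
          using 1 by (rule less_le_trans) simp
        moreover have "space (PiM {..<n} (\<lambda>_. std_normal)) = extensional {..<n}"
          by (simp add: space_PiM PiE_UNIV_domain PiE_def)
        ultimately show ?thesis unfolding exceed_signed[OF D] using p0 by blast
      qed
      ultimately have "P.prob (W s) = 1" "G.prob (D.exceed s) = 1"
        using P.prob_space G.prob_space by simp_all
      then show ?thesis using e0 t0 by linarith
    next
      case 2
      then show ?thesis using mid[OF 2] t0 by linarith
    next
      case 3
      have "P.prob (W s) \<le> P.prob (W \<tau>')"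
      proof (rule P.finite_measure_mono[OF _ W_meas])
        show "W s \<subseteq> W \<tau>'" unfolding W_def using less_trans[OF 3] by blast
      qed
      moreover have "G.prob (D.exceed s) \<le> G.prob (D.exceed \<tau>')"
      proof (rule G.finite_measure_mono[OF _ ex_sets'])
        show "D.exceed s \<subseteq> D.exceed \<tau>'" unfolding D.exceed_def using less_trans[OF 3] by blast
      qed
      ultimately show ?thesis
        using mid(1)[of \<tau>'] \<tau>' tail e0 measure_nonneg[of P "W s"]
          measure_nonneg[of "PiM {..<n} (\<lambda>_. std_normal)" "D.exceed s"]
        by linarith
    qed
  qed
  show ?thesis unfolding lhs rhs using bad_le bound[of "sqrt n * t"] by linarith
qed

end

section \<open>Asymptotics\<close>

lemma powr_mult_powr: "a + b = e \<Longrightarrow> (x::real) powr a * x powr b = x powr e"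
  by (simp only: powr_add[symmetric])

text \<open>Taking B >= 1 out of the growth condition gives L^7 <= D^7 N. For the rest, L^(7/2) B is
  at most D N^((1-c)/2), and the remaining factors N^(3 s - 1/2) and N^(s - 1/2) turn the exponent
  into - c / 4 and - 5 c / 12 for s = c / 12.\<close>

lemma growth_consequences:
  fixes L B D N c s :: real
  assumes L: "1 \<le> L" and B: "1 \<le> B" and D: "1 \<le> D" and N: "1 \<le> N"
    and g: "B ^ 4 * L ^ 7 \<le> D * N powr (1 - c)" and c: "0 < c" and s: "s = c / 12"
  shows "L \<le> D * N powr (1 / 7)"
    and "(sqrt L * N powr s) * (sqrt L * N powr s * L)\<^sup>2 * (B / sqrt N) \<le> D * N powr (- (c / 4))"
    and "2 * (sqrt L * N powr s * L) * (B / sqrt N) \<le> 2 * D * N powr (- (5 * c / 12))"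
proof -
  have N0: "N > 0" using N by simp
  have "1 * L ^ 7 \<le> B ^ 4 * L ^ 7" using B L by (intro mult_right_mono) auto
  also have "\<dots> \<le> D * N powr (1 - c)" by (rule g)
  also have "\<dots> \<le> D ^ 7 * N"
    using D N c self_le_power[of D 7] powr_mono[of "1 - c" 1 N] by (intro mult_mono) auto
  also have "\<dots> = (D * N powr (1 / 7)) ^ 7"
    using N0 by (simp add: power_mult_distrib powr_power)
  finally show "L \<le> D * N powr (1 / 7)"
    using D by (intro power_le_imp_le_base[of L 6]) (auto simp: eval_nat_numeral)
  \<comment> \<open>\<open>w\<close> is L^(7/2) B; its square L^7 B^2 falls under the growth
    condition because B^2 <= B^4.\<close>
  define w where "w = L ^ 3 * sqrt L * B"
  have q: "sqrt L * sqrt L = L" using L by simp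
  have "(L ^ 3 * x * B)\<^sup>2 = (x * x) * L ^ 6 * B\<^sup>2" for x
    by (simp add: power_mult_distrib power2_eq_square[of x])
  then have "w\<^sup>2 = (sqrt L * sqrt L) * L ^ 6 * B ^ 2" unfolding w_def .
  also have "\<dots> = L ^ 7 * B ^ 2" unfolding q by (simp add: eval_nat_numeral)
  also have "\<dots> \<le> L ^ 7 * B ^ 4"
    using L power_increasing[OF _ B, of 2 4] by (intro mult_left_mono) simp_all
  also have "\<dots> \<le> D * N powr (1 - c)" using g by (simp only: mult.commute)
  also have "\<dots> \<le> D\<^sup>2 * N powr (1 - c)"
    using self_le_power[OF D, of 2] by (intro mult_right_mono) simp_all
  also have "\<dots> = (D * N powr ((1 - c) / 2))\<^sup>2"
  proof -
    have "N powr (1 - c) = N powr ((1 - c) / 2) * N powr ((1 - c) / 2)"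
      by (rule powr_mult_powr[symmetric]) simp
    then show ?thesis by (simp only: power_mult_distrib power2_eq_square mult_ac)
  qed
  finally have w: "w \<le> D * N powr ((1 - c) / 2)"
    by (rule power2_le_imp_le) (use D in simp)
  have sqN: "inverse (sqrt N) = N powr (- (1 / 2))" using N0 by (simp add: powr_minus powr_half_sqrt)
  have i: "(N powr s) ^ 3 * inverse (sqrt N) = N powr (3 * s - 1 / 2)" "N powr s * inverse (sqrt N) = N powr (s - 1 / 2)"
    unfolding sqN power3_eq_cube powr_add[symmetric] by simp_all
  have e: "D * N powr ((1 - c) / 2) * N powr (3 * s - 1 / 2) = D * N powr (- (c / 4))"
    "D * N powr ((1 - c) / 2) * N powr (s - 1 / 2) = D * N powr (- (5 * c / 12))"
    unfolding mult.assoc powr_add[symmetric] by (simp_all add: s field_simps)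
  have "(x * a) * (x * a * L)\<^sup>2 * (B * z) = (x * x) * L\<^sup>2 * x * B * (a ^ 3 * z)" for x a z
    by (simp add: power2_eq_square power3_eq_cube)
  then have "(sqrt L * N powr s) * (sqrt L * N powr s * L)\<^sup>2 * (B / sqrt N)
      = (sqrt L * sqrt L) * L\<^sup>2 * sqrt L * B * ((N powr s) ^ 3 * inverse (sqrt N))"
    unfolding divide_inverse .
  also have "\<dots> = w * N powr (3 * s - 1 / 2)"
    unfolding q w_def i by (simp add: power2_eq_square power3_eq_cube)
  also have "\<dots> \<le> (D * N powr ((1 - c) / 2)) * N powr (3 * s - 1 / 2)" using w by (intro mult_right_mono) simp_all
  finally show "(sqrt L * N powr s) * (sqrt L * N powr s * L)\<^sup>2 * (B / sqrt N) \<le> D * N powr (- (c / 4))"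
    unfolding e .
  have wL: "sqrt L * L * B \<le> w"
  proof -
    have "L \<le> L ^ 3" using self_le_power[OF L, of 3] by simp
    then have "L * (sqrt L * B) \<le> L ^ 3 * (sqrt L * B)" using L B by (intro mult_right_mono) simp_all
    then show ?thesis by (simp add: w_def mult_ac)
  qed
  have "2 * (sqrt L * N powr s * L) * (B / sqrt N) = 2 * ((sqrt L * L * B) * N powr (s - 1 / 2))"
    unfolding i(2)[symmetric] divide_inverse[of "B"] by (simp only: mult_ac)
  also have "\<dots> \<le> 2 * ((D * N powr ((1 - c) / 2)) * N powr (s - 1 / 2))"
    using order_trans[OF wL w] by (intro mult_left_mono mult_right_mono) simp_all
  finally show "2 * (sqrt L * N powr s * L) * (B / sqrt N) \<le> 2 * D * N powr (- (5 * c / 12))"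
    unfolding e by (simp only: mult.assoc)
qed

text \<open>The mean square of a standardized column is 1, so its entries cannot all be smaller than
  1 in absolute value.\<close>

lemma standardized_design_bound_ge_1:
  assumes "standardized_design n p x B" "n \<ge> 1"
  shows "1 \<le> B"
proof -
  have p: "0 < p" and b: "\<And>i. i < n \<Longrightarrow> \<bar>x i 0\<bar> \<le> B" and sq: "(\<Sum>i<n. (x i 0)\<^sup>2) = real n"
    using assms by (auto simp: standardized_design_def)
  have B0: "0 \<le> B" using b[of 0] assms(2) by (auto intro: order_trans[OF abs_ge_zero])
  have "real n \<le> (\<Sum>i<n. B\<^sup>2)"
    unfolding sq[symmetric] using b B0 by (intro sum_mono) (auto simp: abs_le_square_iff[symmetric])
  then have "1\<^sup>2 \<le> B\<^sup>2" using assms(2) by simp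
  then show ?thesis using B0 by (rule power2_le_imp_le)
qed

text \<open>The bound 6 comes from 2 e <= 6; it replaces the logarithm of the doubled number of
  columns by the one in the growth condition.\<close>

lemma one_plus_ln_le:
  fixes n p :: nat
  assumes "p \<ge> 1" "n \<ge> 6"
  shows "1 + ln (2 * real p) \<le> ln (real p * real n)"
proof -
  have "exp 1 * (2 * real p) \<le> 3 * (2 * real p)" using exp_le by (intro mult_right_mono) auto
  also have "\<dots> \<le> real p * real n" using assms by (simp add: mult.commute mult_left_mono)
  finally have "ln (exp 1 * (2 * real p)) \<le> ln (real p * real n)" using assms by (intro ln_mono) auto
  then show ?thesis using assms by (simp add: ln_mult)
qed

context vst_family
begin

theorem pivotal_limit:
  fixes p :: "nat \<Rightarrow> nat" and X :: "nat \<Rightarrow> nat \<Rightarrow> nat \<Rightarrow> real" and B :: "nat \<Rightarrow> real" and c :: real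
  assumes g: "g = the_inv_into \<Theta> dt" and \<theta>: "\<theta> \<in> \<Theta>"
    and mle: "\<And>n. common_mle \<nu> \<Theta> T d b n (est n)"
    and design: "\<forall>\<^sub>F n in sequentially. standardized_design n (p n) (X n) (B n)"
    and c: "c > 0"
    and growth: "(\<lambda>n. B n ^ 4 * ln (real (p n) * real n) ^ 7) \<in> O(\<lambda>n. real n powr (1 - c))"
  defines "P \<equiv> \<lambda>n. PiM {..<n} (\<lambda>_. law \<theta>)"
  shows "(\<lambda>n. SUP t. \<bar>measure (P n) {y \<in> space (P n).
      zero_threshold id (avg_nll T d b n) g (p n) (X n) (the_inv_into (dt ` \<Theta>) g (est n y)) y \<le> t}
      - cdf (reference_law n (p n) (X n)) t\<bar>) \<longlonglongrightarrow> 0"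
    (is "(\<lambda>n. SUP t. ?dist n t) \<longlonglongrightarrow> 0")
proof -
  obtain r where r: "r > 0" and noise: "std_noise (distr (law \<theta>) borel (\<lambda>y. (T y - d1 \<theta>) / sqrt (d2 \<theta>))) r"
    using standardized_law[OF \<theta>] by blast
  obtain C \<delta> where C: "C \<ge> 0" "\<delta> > 0" and close: 
    "\<And>n y est \<tau>. n \<ge> 1 \<Longrightarrow> 0 \<le> \<tau> \<Longrightarrow> \<tau> \<le> \<delta> \<Longrightarrow> \<bar>(\<Sum>i<n. T (y i)) / n - d1 \<theta>\<bar> \<le> \<tau> \<Longrightarrow>
      ((\<exists>\<theta>. is_arg_min (\<lambda>\<theta>. avg_nll T d b n (\<lambda>_. \<theta>) y) (\<lambda>\<theta>. \<theta> \<in> \<Theta>) \<theta>) \<longrightarrow>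
         is_arg_min (\<lambda>\<theta>. avg_nll T d b n (\<lambda>_. \<theta>) y) (\<lambda>\<theta>. \<theta> \<in> \<Theta>) est) \<Longrightarrow>
      \<bar>sqrt (d2 \<theta> / d2 est) - 1\<bar> \<le> C * \<tau>"
    using mle_scale_close[OF \<theta>] by blast
  \<comment> \<open>Capping the exponent at 1 keeps s <= 1/12, which is below 1/3 - 1/7 = 4/21; this
    makes the exponent in the width count of \<open>bound\<close> negative once the factor n^(-s) is
    included.\<close>
  define c' where "c' = min c 1"
  have c': "0 < c'" "c' \<le> 1" "c' \<le> c" using c by (auto simp: c'_def)
  define s where "s = c' / 12"
  have s: "0 < s" "s \<le> 1 / 12" using c' by (auto simp: s_def)
  obtain C0 where C0: "\<forall>\<^sub>F n in sequentially. norm (B n ^ 4 * ln (real (p n) * real n) ^ 7) \<le> C0 * norm (real n powr (1 - c))"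
    using growth by (elim landau_o.bigE) blast
  define D where "D = max C0 1"
  define \<rho> where "\<rho> = distr (law \<theta>) borel (\<lambda>y. (T y - d1 \<theta>) / sqrt (d2 \<theta>))"
  define K where "K = (exp_cube_moment \<rho> r + exp_cube_moment std_normal r) / (\<integral>w. exp (- (r * \<bar>w\<bar>)) \<partial>std_normal)"
  have K: "K \<ge> 0" unfolding K_def exp_cube_moment_def
    by (intro divide_nonneg_nonneg add_nonneg_nonneg integral_nonneg_AE) auto
  define bound where "bound n = d2 \<theta> * real n powr (- (1 / 3)) + K * (D * real n powr (- (c' / 4)) * (1 + ln (real n)))
      + 2 / real n + 3 * real n powr (- s) * (2 * C * D * real n powr (2 * s + 1 / 7 - 1 / 3) + 2 * ln (real n) + 4)
      + 3 / 2 * real n powr (- s)" for n :: nat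
  have t1: "(\<lambda>n::nat. real n powr (- a)) \<longlonglongrightarrow> 0" if "a > 0" for a
    using that by real_asymp
  have t2: "(\<lambda>n::nat. real n powr (- a) * ln (real n)) \<longlonglongrightarrow> 0" if "a > 0" for a
    using that by real_asymp
  have "bound = (\<lambda>n. d2 \<theta> * real n powr (- (1 / 3)) + K * D * (real n powr (- (c' / 4)) + real n powr (- (c' / 4)) * ln (real n))
      + 2 * real n powr (- 1) + (6 * C * D * real n powr (- (1 / 3 - 1 / 7 - s)) + 6 * (real n powr (- s) * ln (real n)) + 12 * real n powr (- s))
      + 3 / 2 * real n powr (- s))"
  proof
    fix n :: nat
    have "real n powr (- s) * real n powr (2 * s + 1 / 7 - 1 / 3) = real n powr (- (1 / 3 - 1 / 7 - s))"
      by (simp add: powr_add[symmetric])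
    then have "3 * real n powr (- s) * (2 * C * D * real n powr (2 * s + 1 / 7 - 1 / 3)) = 6 * C * D * real n powr (- (1 / 3 - 1 / 7 - s))"
      by (simp add: mult_ac)
    moreover have "2 / real n = 2 * real n powr (- 1)" by (cases "n = 0") (auto simp: powr_minus divide_inverse)
    ultimately show "bound n = d2 \<theta> * real n powr (- (1 / 3)) + K * D * (real n powr (- (c' / 4)) + real n powr (- (c' / 4)) * ln (real n))
      + 2 * real n powr (- 1) + (6 * C * D * real n powr (- (1 / 3 - 1 / 7 - s)) + 6 * (real n powr (- s) * ln (real n)) + 12 * real n powr (- s))
      + 3 / 2 * real n powr (- s)"
      unfolding bound_def distrib_left by (simp add: algebra_simps)
  qed
  also have "\<dots> \<longlonglongrightarrow> d2 \<theta> * 0 + K * D * (0 + 0) + 2 * 0 + (6 * C * D * 0 + 6 * 0 + 12 * 0) + 3 / 2 * 0"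
    using s c' by (intro tendsto_intros t1 t2) auto
  finally have lim: "bound \<longlonglongrightarrow> 0" by simp
  have ev1: "\<forall>\<^sub>F n in sequentially. C * real n powr (- (1 / 3)) \<le> 1 / 2"
    using tendsto_mult[OF tendsto_const t1[of "1 / 3"], of C]
    by (intro eventually_mono[OF order_tendstoD(2)[of _ 0 _ "1 / 2"]]) auto
  have ev2: "\<forall>\<^sub>F n in sequentially. real n powr (- (1 / 3)) \<le> \<delta>"
    using t1[of "1 / 3"] C(2) by (intro eventually_mono[OF order_tendstoD(2)[of _ 0 _ \<delta>]]) auto
  have ev3: "\<forall>\<^sub>F n in sequentially. 2 * D * real n powr (- (5 * c' / 12)) \<le> r"
    using tendsto_mult[OF tendsto_const t1[of "5 * c' / 12"], of "2 * D"] c' r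
    by (intro eventually_mono[OF order_tendstoD(2)[of _ 0 _ r]]) auto
  have "\<forall>\<^sub>F n in sequentially. \<forall>t. ?dist n t \<le> bound n"
    using design C0 ev1 ev2 ev3 eventually_ge_at_top[of 6]
  proof eventually_elim
    case (elim n)
    define N where "N = real n"
    define L where "L = 1 + ln (2 * real (p n))"
    \<comment> \<open>Here \<beta> / \<kappa> = L exceeds the logarithm of the number of signed
      columns, and sqrt L / \<kappa> = N^(-s). \<open>\<epsilon>\<close> is the scale error for a
      deviation \<tau> = N^(-1/3), and \<open>m\<close> of size ln N makes the smoothing error at
      most 2 / N.\<close>
    define \<kappa> where "\<kappa> = sqrt L * N powr s"
    define \<beta> where "\<beta> = \<kappa> * L"
    define \<epsilon> where "\<epsilon> = C * N powr (- (1 / 3))"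
    define m where "m = nat \<lceil>ln N\<rceil>"
    define k where "k = nat \<lceil>\<kappa> * (2 * \<epsilon> * \<kappa>) + 2 * real m + 1\<rceil>"
    have n: "n \<ge> 1" "N \<ge> 6" "N > 0" using elim(6) by (simp_all add: N_def)
    have p: "p n \<ge> 1" using elim(1) by (auto simp: standardized_design_def)
    have L: "L \<ge> 1" using p by (simp add: L_def)
    have B: "B n \<ge> 1" by (rule standardized_design_bound_ge_1[OF elim(1) n(1)])
    have D: "D \<ge> 1" by (simp add: D_def)
    have lL: "L \<le> ln (real (p n) * real n)" unfolding L_def by (rule one_plus_ln_le[OF p elim(6)])
    have "B n ^ 4 * L ^ 7 \<le> B n ^ 4 * ln (real (p n) * real n) ^ 7"
      by (intro mult_left_mono power_mono lL) (use L B in simp_all)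
    also have "\<dots> \<le> C0 * N powr (1 - c)"
      using abs_le_D1[OF elim(2)[unfolded real_norm_def]] unfolding N_def
      by (simp only: abs_of_nonneg powr_ge_zero)
    also have "\<dots> \<le> D * N powr (1 - c')"
    proof (rule mult_mono)
      show "N powr (1 - c) \<le> N powr (1 - c')" using n c'(3) by (intro powr_mono) simp_all
    qed (use D in \<open>simp_all add: D_def\<close>)
    finally have gr: "B n ^ 4 * L ^ 7 \<le> D * N powr (1 - c')" .
    have N1: "1 \<le> N" using n by simp
    note gc = growth_consequences[OF L B D N1 gr c'(1) s_def]
    have \<kappa>: "\<kappa> > 0" using L n by (simp add: \<kappa>_def)
    have \<kappa>\<beta>: "\<kappa> \<le> \<beta>" using L \<kappa> by (simp add: \<beta>_def)
    have \<epsilon>: "0 \<le> \<epsilon>" "\<epsilon> \<le> 1 / 2" using C(1) elim(3) by (simp_all add: \<epsilon>_def N_def)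
    have lnN: "ln N \<ge> 0" using n by simp
    have m: "ln N \<le> m" "m \<le> ln N + 1" using lnN unfolding m_def by linarith+
    have k: "\<kappa> * (2 * \<epsilon> * \<kappa>) + 2 * real m + 1 \<le> real k" "real k \<le> \<kappa> * (2 * \<epsilon> * \<kappa>) + 2 * real m + 2"
    proof -
      have "0 \<le> \<kappa> * (2 * \<epsilon> * \<kappa>)" using \<kappa> \<epsilon> by simp
      then show "\<kappa> * (2 * \<epsilon> * \<kappa>) + 2 * real m + 1 \<le> real k" "real k \<le> \<kappa> * (2 * \<epsilon> * \<kappa>) + 2 * real m + 2"
        unfolding k_def by linarith+
    qed
    have small: "2 * \<beta> * (B n / sqrt (real n)) \<le> r"
      using gc(3) elim(5) unfolding \<beta>_def \<kappa>_def N_def by simp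
    have card: "ln (2 * real (p n)) \<le> \<beta> / \<kappa>" using \<kappa> by (simp add: \<beta>_def L_def)
    have \<tau>: "N powr (- (1 / 3)) > 0" using n by simp
    have close': "\<bar>sqrt (d2 \<theta> / d2 est) - 1\<bar> \<le> \<epsilon>"
      if "\<bar>(\<Sum>i<n. T (y i)) / n - d1 \<theta>\<bar> \<le> N powr (- (1 / 3))"
        "(\<exists>\<theta>. is_arg_min (\<lambda>\<theta>. avg_nll T d b n (\<lambda>_. \<theta>) y) (\<lambda>\<theta>. \<theta> \<in> \<Theta>) \<theta>) \<longrightarrow>
         is_arg_min (\<lambda>\<theta>. avg_nll T d b n (\<lambda>_. \<theta>) y) (\<lambda>\<theta>. \<theta> \<in> \<Theta>) est" for y est
      unfolding \<epsilon>_def using elim(4) by (intro close[OF n(1) _ _ that]) (simp_all add: N_def)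
    show ?case
    proof
      fix t
      \<comment> \<open>The truncation level \<tau>' is taken to be \<kappa> itself: it is large
        enough for the tail, which is of order sqrt L / \<kappa>, while the shift in widths is still
        only 2 \<epsilon> \<kappa>^2.\<close>
      have kb: "?dist n t \<le> d2 \<theta> / (real n * (N powr (- (1 / 3)))\<^sup>2)
          + (K * (\<kappa> * \<beta>\<^sup>2 * (B n / sqrt (real n)) * harm n) + 2 * exp (- real m)
            + 2 * real k * (3 / 2 * sqrt L) / \<kappa>) + 3 / 2 * sqrt L / \<kappa>"
        unfolding P_def K_def \<rho>_def L_def
        by (rule threshold_kolmogorov_bound[OF g \<theta> n(1) elim(1) mle \<tau> \<epsilon> _ noise \<kappa> \<kappa>\<beta> small card \<kappa> k(1)])
          (rule close')
      have 1: "d2 \<theta> / (real n * (N powr (- (1 / 3)))\<^sup>2) = d2 \<theta> * N powr (- (1 / 3))"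
      proof -
        have "N powr 1 * (N powr (- (1 / 3)) * N powr (- (1 / 3))) = N powr (1 / 3)"
          by (simp only: powr_add[symmetric]) simp
        then have "N * (N powr (- (1 / 3)))\<^sup>2 = N powr (1 / 3)"
          unfolding power2_eq_square powr_one[OF less_imp_le[OF n(3)]] .
        then show ?thesis by (simp only: N_def[symmetric] powr_minus divide_inverse)
      qed
      have 2: "K * (\<kappa> * \<beta>\<^sup>2 * (B n / sqrt (real n)) * harm n) \<le> K * (D * N powr (- (c' / 4)) * (1 + ln N))"
      proof (rule mult_left_mono[OF mult_mono K])
        show "\<kappa> * \<beta>\<^sup>2 * (B n / sqrt (real n)) \<le> D * N powr (- (c' / 4))"
          using gc(2) unfolding \<kappa>_def \<beta>_def N_def .
        show "harm n \<le> 1 + ln N" using harm_le[of n] n(1) unfolding N_def by linarith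
      qed (use D in \<open>simp_all add: harm_nonneg\<close>)
      have 3: "2 * exp (- real m) \<le> 2 / N"
      proof -
        have "exp (- real m) \<le> exp (- ln N)" using m(1) by simp
        also have "\<dots> = 1 / N" using n(3) by (simp add: exp_minus inverse_eq_divide)
        finally show ?thesis by simp
      qed
      have sL: "sqrt L / \<kappa> = N powr (- s)"
        using L unfolding \<kappa>_def powr_minus by (simp add: inverse_eq_divide)
      have 4: "2 * real k * (3 / 2 * sqrt L) / \<kappa> \<le> 3 * N powr (- s) * (2 * C * D * N powr (2 * s + 1 / 7 - 1 / 3) + 2 * ln N + 4)"
      proof -
        \<comment> \<open>Collects the shift 2 \<epsilon> \<kappa>^2 as 2 C L N^(2 s - 1/3); L is
          then replaced by D N^(1/7).\<close>
        have "(x * a) * (2 * (C * e) * (x * a)) = 2 * C * ((x * x) * (a * a * e))" for x a e by simp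
        then have "\<kappa> * (2 * \<epsilon> * \<kappa>) = 2 * C * ((sqrt L * sqrt L) * (N powr s * N powr s * N powr (- (1 / 3))))"
          unfolding \<kappa>_def \<epsilon>_def .
        also have "\<dots> = 2 * C * (L * (N powr s * N powr s * N powr (- (1 / 3))))" using L by simp
        also have "\<dots> \<le> 2 * C * ((D * N powr (1 / 7)) * (N powr s * N powr s * N powr (- (1 / 3))))"
          by (intro mult_left_mono mult_right_mono gc(1)) (use C in simp_all)
        also have "\<dots> = 2 * C * D * (N powr (1 / 7) * (N powr s * N powr s * N powr (- (1 / 3))))"
          by (simp only: mult.assoc)
        also have "\<dots> = 2 * C * D * N powr (2 * s + 1 / 7 - 1 / 3)"
          unfolding powr_add[symmetric] by (simp add: algebra_simps)
        finally have kk: "real k \<le> 2 * C * D * N powr (2 * s + 1 / 7 - 1 / 3) + 2 * ln N + 4"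
          using k(2) m(2) by linarith
        have "2 * real k * (3 / 2 * sqrt L) / \<kappa> = 3 * (sqrt L / \<kappa>) * real k" by simp
        also have "\<dots> = 3 * N powr (- s) * real k" unfolding sL ..
        also have "\<dots> \<le> 3 * N powr (- s) * (2 * C * D * N powr (2 * s + 1 / 7 - 1 / 3) + 2 * ln N + 4)"
          using kk by (intro mult_left_mono) auto
        finally show ?thesis .
      qed
      have 5: "3 / 2 * sqrt L / \<kappa> = 3 / 2 * N powr (- s)"
        unfolding sL[symmetric] by simp
      show "?dist n t \<le> bound n"
        using kb 1 2 3 4 5 unfolding bound_def P_def N_def by linarith
    qed
  qed
  then have ev: "\<forall>\<^sub>F n in sequentially. norm (SUP t. ?dist n t) \<le> bound n"
  proof eventually_elim
    case (elim n)
    have bdd: "bdd_above (range (?dist n))" using elim by (intro bdd_aboveI[of _ "bound n"]) auto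
    have "0 \<le> ?dist n 0" by simp
    also have "\<dots> \<le> (SUP t. ?dist n t)" by (rule cSUP_upper[OF UNIV_I bdd])
    finally have "0 \<le> (SUP t. ?dist n t)" .
    moreover have "(SUP t. ?dist n t) \<le> bound n" using elim by (intro cSUP_least) auto
    ultimately show ?case by simp
  qed
  show ?thesis by (rule Lim_null_comparison[OF ev lim])
qed

end

theorem theorem8:
  fixes \<nu> :: "real measure" and \<Theta> :: "real set"
    and T d b dt g :: "real \<Rightarrow> real"
    and \<theta>hat \<beta>\<^sub>0hat :: "nat \<Rightarrow> (nat \<Rightarrow> real) \<Rightarrow> real"
    and p :: "nat \<Rightarrow> nat" and X :: "nat \<Rightarrow> nat \<Rightarrow> nat \<Rightarrow> real"
    and B :: "nat \<Rightarrow> real" and c :: real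
    and E :: "real set" and P\<^sub>0 :: "real \<Rightarrow> nat \<Rightarrow> (nat \<Rightarrow> real) measure"
  assumes family: "exponential_family \<nu> \<Theta> T d b"
    and smooth: "C_k_on 3 d \<Theta>"
    and fourth_moment:
      "\<forall>\<theta>\<in>\<Theta>. integrable (density \<nu> (expfam_density T d b \<theta>)) (\<lambda>y. T y ^ 4)"
    and antiderivative:
      "\<forall>\<theta>\<in>\<Theta>. (dt has_real_derivative sqrt ((deriv ^^ 2) d \<theta>)) (at \<theta>)"
    and invertible: "inj_on dt \<Theta>"
    and link: "g = the_inv_into \<Theta> dt"
    and intercepts: "E = dt ` \<Theta>"
    and null_model: "P\<^sub>0 = (\<lambda>\<beta>\<^sub>0 n. glm_law \<nu> T d b g n (p n) (X n) \<beta>\<^sub>0 (\<lambda>_. 0))"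
    and mle: "\<forall>n. common_mle \<nu> \<Theta> T d b n (\<theta>hat n)"
    and intercept_mle: "\<beta>\<^sub>0hat = (\<lambda>n y. the_inv_into E g (\<theta>hat n y))"
    and consistency: "consistent E P\<^sub>0 \<beta>\<^sub>0hat"
    and design: "\<forall>\<^sub>F n in sequentially. standardized_design n (p n) (X n) (B n)"
    and c_pos: "c > 0"
    and growth:
      "(\<lambda>n. B n ^ 4 * ln (real (p n) * real n) ^ 7) \<in> O(\<lambda>n. real n powr (1 - c))"
  shows "asymptotically_pivotal E P\<^sub>0
    (\<lambda>n y. zero_threshold id (avg_nll T d b n) g (p n) (X n) (\<beta>\<^sub>0hat n y) y)"
proof -
  interpret vst_family \<nu> \<Theta> T d b dt
    using family smooth antiderivative invertible by unfold_locales auto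
  show ?thesis
    unfolding asymptotically_pivotal_def
  \<comment> \<open>The witness has to be chosen before the intercept; it is built from n, p and the
    design alone.\<close>
  proof (intro exI[of _ "\<lambda>n. reference_law n (p n) (X n)"] conjI allI ballI)
    show "real_distribution (reference_law n (p n) (X n))" for n
      by (rule real_distribution_reference)
    fix \<beta>\<^sub>0 assume "\<beta>\<^sub>0 \<in> E"
    then obtain \<theta> where \<theta>: "\<theta> \<in> \<Theta>" "\<beta>\<^sub>0 = dt \<theta>" unfolding intercepts by blast
    have law: "P\<^sub>0 \<beta>\<^sub>0 n = PiM {..<n} (\<lambda>_. law \<theta>)" for n
      unfolding null_model glm_law_def by (simp add: lin_pred_def \<theta>(2) link_dt[OF link \<theta>(1)])
    show "(\<lambda>n. SUP t. \<bar>measure (P\<^sub>0 \<beta>\<^sub>0 n) {y \<in> space (P\<^sub>0 \<beta>\<^sub>0 n).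
          zero_threshold id (avg_nll T d b n) g (p n) (X n) (\<beta>\<^sub>0hat n y) y \<le> t}
        - cdf (reference_law n (p n) (X n)) t\<bar>) \<longlonglongrightarrow> 0"
      unfolding law intercept_mle intercepts
      using mle by (intro pivotal_limit[OF link \<theta>(1) _ design c_pos growth]) simp
  qed
qed

end
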